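(* Let $J\subset\Pi$ be a subset. The map $X_d\mapsto\delta_{d,d_J}$, $d\in W^J$, can be extended uniquely to a $\mathbb C$-linear homogeneous symmetrizing form $\operatorname{tr}_J$ of degree $-2\ell(w_0)+2\ell(w_J)$ on $C^J$.
   Context: $W$ is the Weyl group of a finite dimensional complex semisimple Lie algebra $\mathfrak g$ with Cartan subalgebra $\mathfrak h$, simple roots $\Pi$, positive roots $\Phi^+$, length function $\ell$ and longest element $w_0$. $R:=S(\mathfrak h^* )$ is graded with $\mathfrak h^*$ in degree $2$; $I_W$ is the homogeneous ideal generated by the $W$-invariants of positive degree and $C:=R/I_W$ is the coinvariant algebra. For $J\subset\Pi$, $W_J$ is the parabolic subgroup generated by the $s_\alpha$, $\alpha\in J$, with longest element $w_J$; $W^J$ is the set of minimal length left coset representatives of $W_J$ in $W$; $C^J:=C^{W_J}$; $d_J$ is the unique element of $W^J$ with $w_0\in d_JW_J$. For $\alpha\in\Pi$ the Demazure operator is $\Delta_{s_\alpha}(f):=(f-s_\alpha f)/\alpha$ on $R$; for a reduced expression $w=s_{j_1}\cdots s_{j_k}$, $\Delta_w:=\Delta_{s_{j_1}}\cdots\Delta_{s_{j_k}}$. It induces an endomorphism of $C$, also denoted $\Delta_w$. Put $D:=\frac1{|W|}\prod_{\alpha\in\Phi^+}\alpha\in R$ with image $\overline D\in C$, and $X_w:=\Delta_{w^{-1}w_0}\overline D\in C$; it is homogeneous of degree $2\ell(w)$. It is known that $\{X_w\mid w\in W^J\}$ is a $\mathbb C$-basis of $C^J$. A symmetrizing form on a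 finite dimensional algebra $A$ is a linear map $\operatorname{tr}:A\to\mathbb C$ with $\operatorname{tr}(ab)=\operatorname{tr}(ba)$ such that $(a,b)\mapsto\operatorname{tr}(ab)$ is non-degenerate; homogeneous of degree $-k$ means it is a homogeneous map of degree $-k$ to $\mathbb C$ placed in degree $0$. *)

theory Defs
  imports
    Complex_Main
    "HOL-Library.Function_Algebras"
    "HOL-Library.FuncSet"
    "HOL-Algebra.QuotRing"
    "HOL-Algebra.Module"
begin

section \<open>Root data of semisimple Lie algebras\<close>

text \<open>
  The type \<open>'h\<close> with the scalar multiplication \<open>hscale\<close> is the Cartan subalgebra; the roots are
  linear functionals on it, and \<open>coroot \<alpha>\<close> is the element of the Cartan subalgebra usually written
  \<open>h\<^sub>\<alpha>\<close> or \<open>\<alpha>\<close> with a check. The Lie algebra enters only through its root system, and the root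
  systems of the complex semisimple Lie algebras (with respect to a Cartan subalgebra) are, up to
  isomorphism, exactly the reduced crystallographic ones.
\<close>

record 'h root_datum =
  hscale :: "complex \<Rightarrow> 'h \<Rightarrow> 'h"
  roots :: "('h \<Rightarrow> complex) set"
  coroot :: "('h \<Rightarrow> complex) \<Rightarrow> 'h"
  simple_roots :: "('h \<Rightarrow> complex) set"

definition fscale :: "complex \<Rightarrow> ('h \<Rightarrow> complex) \<Rightarrow> 'h \<Rightarrow> complex" where
  "fscale c f = (\<lambda>x. c * f x)"

definition dual_space :: "('h::ab_group_add, 'm) root_datum_scheme \<Rightarrow> ('h \<Rightarrow> complex) set" where
  "dual_space G = {\<mu>. Vector_Spaces.linear (hscale G) (*) \<mu>}"

definition positive_roots :: "('h::ab_group_add, 'm) root_datum_scheme \<Rightarrow> ('h \<Rightarrow> complex) set" where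
  "positive_roots G =
     {\<beta> \<in> roots G. \<exists>n :: ('h \<Rightarrow> complex) \<Rightarrow> nat. \<beta> = (\<Sum>\<alpha>\<in>simple_roots G. fscale (of_nat (n \<alpha>)) \<alpha>)}"

text \<open>
  The axioms of a reduced root system in the complex vector space \<open>dual_space G\<close>, in the form valid
  over any field of characteristic zero, together with a base of simple roots.
  The axioms determine \<open>coroot G\<close> on the roots; its values elsewhere are never used.
\<close>

definition semisimple_root_datum :: "('h::ab_group_add, 'm) root_datum_scheme \<Rightarrow> bool" where
  "semisimple_root_datum G \<longleftrightarrow>
     vector_space (hscale G) \<and>
     (\<exists>B. finite B \<and> module.span (hscale G) B = UNIV) \<and>
     finite (roots G) \<and>
     module.span fscale (roots G) = dual_space G \<and>
     (\<forall>\<alpha>\<in>roots G. \<alpha> (coroot G \<alpha>) = 2) \<and>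
     (\<forall>\<alpha>\<in>roots G. \<forall>\<beta>\<in>roots G. \<beta> - fscale (\<beta> (coroot G \<alpha>)) \<alpha> \<in> roots G) \<and>
     (\<forall>\<alpha>\<in>roots G. \<forall>\<beta>\<in>roots G. \<beta> (coroot G \<alpha>) \<in> \<int>) \<and>
     (\<forall>\<alpha>\<in>roots G. \<forall>c. fscale c \<alpha> \<in> roots G \<longrightarrow> c = 1 \<or> c = -1) \<and>
     simple_roots G \<subseteq> roots G \<and>
     \<not> module.dependent fscale (simple_roots G) \<and>
     (\<forall>\<beta>\<in>roots G. \<beta> \<in> positive_roots G \<or> - \<beta> \<in> positive_roots G)"


section \<open>The Weyl group\<close>

text \<open>
  Weyl group elements are represented by the linear automorphisms of the Cartan subalgebra that they
  induce; \<open>act w\<close> below is the corresponding action on functions. On linear functionals it gives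
  the usual formula \<open>act (reflection G \<alpha>) \<mu> = \<mu> - \<mu> (coroot G \<alpha>) \<alpha>\<close>.
\<close>

definition reflection :: "('h::ab_group_add, 'm) root_datum_scheme \<Rightarrow> ('h \<Rightarrow> complex) \<Rightarrow> 'h \<Rightarrow> 'h" where
  "reflection G \<alpha> = (\<lambda>x. x - hscale G (\<alpha> x) (coroot G \<alpha>))"

definition act :: "('h \<Rightarrow> 'h) \<Rightarrow> ('h \<Rightarrow> complex) \<Rightarrow> ('h \<Rightarrow> complex)" where
  "act w f = f \<circ> inv_into UNIV w"

definition word_prod ::
  "('h::ab_group_add, 'm) root_datum_scheme \<Rightarrow> ('h \<Rightarrow> complex) list \<Rightarrow> 'h \<Rightarrow> 'h" where
  "word_prod G js = foldr (\<lambda>\<alpha> w. reflection G \<alpha> \<circ> w) js id"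

text \<open>Reflections are involutions, so the products of reflections form a group.\<close>

definition generated_by ::
  "('h::ab_group_add, 'm) root_datum_scheme \<Rightarrow> ('h \<Rightarrow> complex) set \<Rightarrow> ('h \<Rightarrow> 'h) set" where
  "generated_by G A = {word_prod G js | js. set js \<subseteq> A}"

definition weyl_group :: "('h::ab_group_add, 'm) root_datum_scheme \<Rightarrow> ('h \<Rightarrow> 'h) set" where
  "weyl_group G = generated_by G (roots G)"

definition parabolic ::
  "('h::ab_group_add, 'm) root_datum_scheme \<Rightarrow> ('h \<Rightarrow> complex) set \<Rightarrow> ('h \<Rightarrow> 'h) set" where
  "parabolic G J = generated_by G J"

definition weyl_length :: "('h::ab_group_add, 'm) root_datum_scheme \<Rightarrow> ('h \<Rightarrow> 'h) \<Rightarrow> nat" where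
  "weyl_length G w =
     (LEAST k. \<exists>js. set js \<subseteq> simple_roots G \<and> length js = k \<and> word_prod G js = w)"

definition reduced_expression ::
  "('h::ab_group_add, 'm) root_datum_scheme \<Rightarrow> ('h \<Rightarrow> complex) list \<Rightarrow> ('h \<Rightarrow> 'h) \<Rightarrow> bool" where
  "reduced_expression G js w \<longleftrightarrow>
     set js \<subseteq> simple_roots G \<and> word_prod G js = w \<and> length js = weyl_length G w"

definition longest_in ::
  "('h::ab_group_add, 'm) root_datum_scheme \<Rightarrow> ('h \<Rightarrow> 'h) set \<Rightarrow> 'h \<Rightarrow> 'h" where
  "longest_in G U = (THE w. w \<in> U \<and> (\<forall>v\<in>U. weyl_length G v \<le> weyl_length G w))"

definition w_0 :: "('h::ab_group_add, 'm) root_datum_scheme \<Rightarrow> 'h \<Rightarrow> 'h" where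
  "w_0 G = longest_in G (weyl_group G)"

definition w_par ::
  "('h::ab_group_add, 'm) root_datum_scheme \<Rightarrow> ('h \<Rightarrow> complex) set \<Rightarrow> 'h \<Rightarrow> 'h" where
  "w_par G J = longest_in G (parabolic G J)"

definition min_coset_reps ::
  "('h::ab_group_add, 'm) root_datum_scheme \<Rightarrow> ('h \<Rightarrow> complex) set \<Rightarrow> ('h \<Rightarrow> 'h) set" where
  "min_coset_reps G J =
     {w \<in> weyl_group G. \<forall>v\<in>parabolic G J. weyl_length G w \<le> weyl_length G (w \<circ> v)}"

definition d_par ::
  "('h::ab_group_add, 'm) root_datum_scheme \<Rightarrow> ('h \<Rightarrow> complex) set \<Rightarrow> 'h \<Rightarrow> 'h" where
  "d_par G J = (THE d. d \<in> min_coset_reps G J \<and> (\<exists>v\<in>parabolic G J. w_0 G = d \<circ> v))"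


section \<open>The symmetric algebra and the coinvariant algebra\<close>

text \<open>
  The symmetric algebra of the dual space is realised as the algebra of polynomial functions on the
  Cartan subalgebra (the two agree because the field of complex numbers is infinite).
  \<open>sym_power G k\<close> is the \<open>k\<close>-th symmetric power, spanned by \<open>k\<close>-fold products of linear functionals;
  it sits in degree \<open>2k\<close>.
\<close>

definition sym_power :: "('h::ab_group_add, 'm) root_datum_scheme \<Rightarrow> nat \<Rightarrow> ('h \<Rightarrow> complex) set" where
  "sym_power G k =
     module.span fscale {prod_list fs | fs. set fs \<subseteq> dual_space G \<and> length fs = k}"

definition sym_alg :: "('h::ab_group_add, 'm) root_datum_scheme \<Rightarrow> ('h \<Rightarrow> complex) ring" where
  "sym_alg G =
     \<lparr>carrier = module.span fscale (\<Union>k. sym_power G k),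
      mult = (*), one = 1, zero = 0, add = (+)\<rparr>"

definition sym_graded :: "('h::ab_group_add, 'm) root_datum_scheme \<Rightarrow> nat \<Rightarrow> ('h \<Rightarrow> complex) set" where
  "sym_graded G m = (if even m then sym_power G (m div 2) else {0})"

definition coinv_ideal :: "('h::ab_group_add, 'm) root_datum_scheme \<Rightarrow> ('h \<Rightarrow> complex) set" where
  "coinv_ideal G =
     genideal (sym_alg G) {f. \<exists>m>0. f \<in> sym_graded G m \<and> (\<forall>w\<in>weyl_group G. act w f = f)}"

definition coinv_class ::
  "('h::ab_group_add, 'm) root_datum_scheme \<Rightarrow> ('h \<Rightarrow> complex) \<Rightarrow> ('h \<Rightarrow> complex) set" where
  "coinv_class G f = coinv_ideal G +>\<^bsub>sym_alg G\<^esub> f"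

definition coinv_alg ::
  "('h::ab_group_add, 'm) root_datum_scheme \<Rightarrow> (complex, ('h \<Rightarrow> complex) set) module" where
  "coinv_alg G = (let Q = sym_alg G Quot coinv_ideal G in
     \<lparr>carrier = carrier Q, mult = mult Q, one = one Q, zero = zero Q, add = add Q,
      smult = (\<lambda>c a. coinv_class G (\<lambda>_. c) \<otimes>\<^bsub>Q\<^esub> a)\<rparr>)"

definition coinv_graded ::
  "('h::ab_group_add, 'm) root_datum_scheme \<Rightarrow> nat \<Rightarrow> ('h \<Rightarrow> complex) set set" where
  "coinv_graded G m = coinv_class G ` sym_graded G m"

text \<open>The map on the coinvariant algebra induced by a map that preserves the ideal.\<close>

definition coinv_induced ::
  "('h::ab_group_add, 'm) root_datum_scheme \<Rightarrow> (('h \<Rightarrow> complex) \<Rightarrow> ('h \<Rightarrow> complex)) \<Rightarrow>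
   ('h \<Rightarrow> complex) set \<Rightarrow> ('h \<Rightarrow> complex) set" where
  "coinv_induced G F a = the_elem ((\<lambda>f. coinv_class G (F f)) ` a)"

definition coinv_alg_par ::
  "('h::ab_group_add, 'm) root_datum_scheme \<Rightarrow> ('h \<Rightarrow> complex) set \<Rightarrow>
   (complex, ('h \<Rightarrow> complex) set) module" where
  "coinv_alg_par G J = (coinv_alg G)
     \<lparr>carrier := {a \<in> carrier (coinv_alg G). \<forall>w\<in>parabolic G J. coinv_induced G (act w) a = a}\<rparr>"

definition coinv_par_graded ::
  "('h::ab_group_add, 'm) root_datum_scheme \<Rightarrow> ('h \<Rightarrow> complex) set \<Rightarrow> nat \<Rightarrow>
   ('h \<Rightarrow> complex) set set" where
  "coinv_par_graded G J m = coinv_graded G m \<inter> carrier (coinv_alg_par G J)"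


section \<open>Demazure operators and the Schubert basis\<close>

text \<open>
  The quotient \<open>(f - act (reflection G \<alpha>) f) / \<alpha>\<close> is taken in the algebra of polynomial functions:
  pointwise division would be wrong on the zero set of \<open>\<alpha>\<close>.
\<close>

definition demazure_simple ::
  "('h::ab_group_add, 'm) root_datum_scheme \<Rightarrow> ('h \<Rightarrow> complex) \<Rightarrow>
   ('h \<Rightarrow> complex) \<Rightarrow> ('h \<Rightarrow> complex)" where
  "demazure_simple G \<alpha> f =
     (THE g. g \<in> carrier (sym_alg G) \<and> \<alpha> * g = f - act (reflection G \<alpha>) f)"

text \<open>The operator does not depend on the chosen reduced expression.\<close>

definition demazure ::
  "('h::ab_group_add, 'm) root_datum_scheme \<Rightarrow> ('h \<Rightarrow> 'h) \<Rightarrow>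
   ('h \<Rightarrow> complex) \<Rightarrow> ('h \<Rightarrow> complex)" where
  "demazure G w = foldr (demazure_simple G) (SOME js. reduced_expression G js w)"

definition top_poly :: "('h::ab_group_add, 'm) root_datum_scheme \<Rightarrow> 'h \<Rightarrow> complex" where
  "top_poly G = fscale (1 / of_nat (card (weyl_group G))) (\<Prod>\<alpha>\<in>positive_roots G. \<alpha>)"

definition schubert ::
  "('h::ab_group_add, 'm) root_datum_scheme \<Rightarrow> ('h \<Rightarrow> 'h) \<Rightarrow> ('h \<Rightarrow> complex) set" where
  "schubert G w = coinv_induced G (demazure G (inv_into UNIV w \<circ> w_0 G)) (coinv_class G (top_poly G))"


section \<open>Symmetrizing forms\<close>

definition symmetrizing_form ::
  "(complex, 'a, 'm) module_scheme \<Rightarrow> ('a \<Rightarrow> complex) \<Rightarrow> bool" where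
  "symmetrizing_form A tr \<longleftrightarrow>
     (\<exists>B. finite B \<and> B \<subseteq> carrier A \<and>
        (\<forall>a\<in>carrier A. \<exists>c. a = (\<Oplus>\<^bsub>A\<^esub>b\<in>B. c b \<odot>\<^bsub>A\<^esub> b))) \<and>
     (\<forall>a\<in>carrier A. \<forall>b\<in>carrier A. tr (a \<oplus>\<^bsub>A\<^esub> b) = tr a + tr b) \<and>
     (\<forall>c. \<forall>a\<in>carrier A. tr (c \<odot>\<^bsub>A\<^esub> a) = c * tr a) \<and>
     (\<forall>a\<in>carrier A. \<forall>b\<in>carrier A. tr (a \<otimes>\<^bsub>A\<^esub> b) = tr (b \<otimes>\<^bsub>A\<^esub> a)) \<and>
     (\<forall>a\<in>carrier A. (\<forall>b\<in>carrier A. tr (a \<otimes>\<^bsub>A\<^esub> b) = 0) \<longrightarrow> a = \<zero>\<^bsub>A\<^esub>) \<and>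
     (\<forall>b\<in>carrier A. (\<forall>a\<in>carrier A. tr (a \<otimes>\<^bsub>A\<^esub> b) = 0) \<longrightarrow> b = \<zero>\<^bsub>A\<^esub>)"

text \<open>
  A form of degree \<open>k\<close> maps the component of degree \<open>m\<close> into the component of degree \<open>m + k\<close>
  of the complex numbers, which is zero unless \<open>m + k = 0\<close>.
\<close>

definition homogeneous_form :: "(nat \<Rightarrow> 'a set) \<Rightarrow> int \<Rightarrow> ('a \<Rightarrow> complex) \<Rightarrow> bool" where
  "homogeneous_form grading k tr \<longleftrightarrow>
     (\<forall>m. \<forall>a\<in>grading m. int m + k \<noteq> 0 \<longrightarrow> tr a = 0)"

end

theory Submission
  imports Defs "HOL-Computational_Algebra.Polynomial"
begin

text \<open>
  Antisymmetrising a polynomial function over the Weyl group, dividing by the product of the positive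
  roots and evaluating at the origin gives a linear form \<open>tr\<close> with respect to which the Demazure
  operators are self-adjoint. If all \<open>\<Delta>\<^sub>s f\<close> lie in the coinvariant ideal, then \<open>f\<close> is congruent to its
  average over the group, so by induction on the degree the ideal is exactly the kernel of the pairing
  \<open>(f, g) \<mapsto> tr (f g)\<close>. The form on the invariants of a parabolic subgroup is \<open>f \<mapsto> tr (f \<pi>\<^sub>J)\<close> up to a scalar,
  where \<open>\<pi>\<^sub>J\<close> is the product of the positive roots of the parabolic subsystem; it is non-degenerate since every
  antisymmetrisation over the subgroup is \<open>\<pi>\<^sub>J\<close> times an invariant. Non-degeneracy and homogeneity force the
  component of top degree to be spanned by the Schubert class of \<open>d\<^sub>J\<close>, which gives uniqueness. That this
  class is non-zero, and that all classes indexed by minimal coset representatives are invariant, rests on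
  the independence of \<open>\<Delta>\<^sub>w\<close> from the reduced expression.
\<close>

text \<open>The delicate point is that the class of d_J is non-zero. Since d_J = w_0 w_J, this class
  is represented by the operator of w_J applied to D, and a reduced word for d_J followed by one for
  w_J is a reduced word for w_0. So the operator of w_0 must not send D into the ideal. If it did,
  every composite of Demazure operators would send D to a function vanishing at the origin, and the
  descent in degree would place D itself in the ideal; this is excluded by tr D = 1, a case of tr (D
  h) = h(0). The summand 2 l(w_J) in the degree of the form comes from the factor
  \<open>\<pi>\<^sub>J\<close>: it is a product of l(w_J) roots, while tr sees only products of
  l(w_0) linear forms. The length theory is built on inversion sets, because the axioms supply only
  roots, coroots and a base.\<close>

interpretation fs: vector_space "fscale :: complex \<Rightarrow> ('h \<Rightarrow> complex) \<Rightarrow> 'h \<Rightarrow> complex"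
  by unfold_locales (auto simp: fscale_def fun_eq_iff algebra_simps)

lemma fscale_apply: "fscale c f x = c * f x"
  by (simp add: fscale_def)

lemma sum_fun_apply: "(\<Sum>i\<in>A. f i) x = (\<Sum>i\<in>A. f i x :: complex)"
  by (induction A rule: infinite_finite_induct) (auto simp: zero_fun_apply one_fun_apply plus_fun_apply times_fun_apply)

lemma prod_fun_apply: "(\<Prod>i\<in>A. f i) x = (\<Prod>i\<in>A. f i x :: complex)"
  by (induction A rule: infinite_finite_induct) (auto simp: zero_fun_apply one_fun_apply plus_fun_apply times_fun_apply)

text \<open>The pointwise rules are kept out of the simplifier, which would otherwise apply them to
  eta-expanded functions.\<close>

lemmas pointwise = plus_fun_apply zero_fun_apply times_fun_apply one_fun_apply fscale_apply
  uminus_apply minus_apply sum_fun_apply prod_fun_apply comp_apply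

declare plus_fun_apply [simp del] zero_fun_apply [simp del] times_fun_apply [simp del]
  one_fun_apply [simp del] uminus_apply [simp del] minus_apply [simp del]
  comp_apply [simp del]

lemma fscale_zero [simp]: "fscale 0 f = 0" "fscale c 0 = 0"
  and fscale_one [simp]: "fscale 1 f = f"
  by (auto simp: fun_eq_iff pointwise)

lemma const_mult: "(\<lambda>_. c) * f = fscale c f"
  by (auto simp: fun_eq_iff pointwise)

lemma fscale_mult_left: "fscale c f * g = fscale c (f * g)"
  and fscale_mult_right: "f * fscale c g = fscale c (f * g)"
  by (auto simp: fun_eq_iff pointwise)

locale root_system_datum =
  fixes G :: "'h::ab_group_add root_datum"
  assumes ssrd: "semisimple_root_datum G"
begin

text \<open>Here \<open>\<Delta>\<close> stands for the simple roots, \<open>\<Pi>\<close> being syntax for dependent function spaces; the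
  operators \<open>\<Delta>\<^sub>s\<close> are written \<open>dem\<close>.\<close>

abbreviation "hsc \<equiv> hscale G"
abbreviation "\<Phi> \<equiv> roots G"
abbreviation "\<Delta> \<equiv> simple_roots G"
abbreviation "Pos \<equiv> positive_roots G"
abbreviation "cor \<equiv> coroot G"
abbreviation "s \<equiv> reflection G"
abbreviation "R \<equiv> carrier (sym_alg G)"
abbreviation "wp \<equiv> word_prod G"

section \<open>Consequences of the axioms and linear functionals\<close>

sublocale hs: vector_space hsc
  using ssrd by (simp add: semisimple_root_datum_def)

lemma finite_roots: "finite \<Phi>"
  and span_roots: "fs.span \<Phi> = dual_space G"
  and root_cor: "\<alpha> \<in> \<Phi> \<Longrightarrow> \<alpha> (cor \<alpha>) = 2"
  and root_refl: "\<alpha> \<in> \<Phi> \<Longrightarrow> \<beta> \<in> \<Phi> \<Longrightarrow> \<beta> - fscale (\<beta> (cor \<alpha>)) \<alpha> \<in> \<Phi>"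
  and root_reduced: "\<alpha> \<in> \<Phi> \<Longrightarrow> fscale c \<alpha> \<in> \<Phi> \<Longrightarrow> c = 1 \<or> c = -1"
  and simple_sub: "\<Delta> \<subseteq> \<Phi>"
  and indep: "fs.independent \<Delta>"
  and pos_or_neg: "\<beta> \<in> \<Phi> \<Longrightarrow> \<beta> \<in> Pos \<or> - \<beta> \<in> Pos"
  using ssrd unfolding semisimple_root_datum_def by blast+

lemma finite_simple: "finite \<Delta>"
  using simple_sub finite_roots finite_subset by blast

lemma dual_add: "\<mu> \<in> dual_space G \<Longrightarrow> \<mu> (x + y) = \<mu> x + \<mu> y"
  and dual_scale: "\<mu> \<in> dual_space G \<Longrightarrow> \<mu> (hsc c x) = c * \<mu> x"
  by (auto simp: dual_space_def Vector_Spaces.linear_iff)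

lemma dual_diff: "\<mu> \<in> dual_space G \<Longrightarrow> \<mu> (x - y) = \<mu> x - \<mu> y"
  using dual_add[of \<mu> "x - y" y] by simp

lemma dualI: "(\<And>x y. \<mu> (x + y) = \<mu> x + \<mu> y) \<Longrightarrow> (\<And>c x. \<mu> (hsc c x) = c * \<mu> x)
   \<Longrightarrow> \<mu> \<in> dual_space G"
  by (auto simp: dual_space_def Vector_Spaces.linear_iff hs.vector_space_axioms)
     (unfold_locales, auto simp: algebra_simps)

lemma root_dual: "\<alpha> \<in> \<Phi> \<Longrightarrow> \<alpha> \<in> dual_space G"
  using span_roots fs.span_base by blast

lemma dual_subspace: "fs.subspace (dual_space G)"
  using span_roots fs.subspace_span by metis

subsection \<open>Polynomial functions\<close>

definition monomials :: "nat \<Rightarrow> ('h \<Rightarrow> complex) set" where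
  "monomials k = {prod_list fs | fs. set fs \<subseteq> dual_space G \<and> length fs = k}"

lemma sym_power_eq: "sym_power G k = fs.span (monomials k)"
  by (simp add: sym_power_def monomials_def)

lemma R_eq: "R = fs.span (\<Union>k. sym_power G k)"
  by (simp add: sym_alg_def)

lemma sym_power_subspace: "fs.subspace (sym_power G k)"
  by (simp add: sym_power_eq)

lemma R_subspace: "fs.subspace R"
  by (simp add: R_eq)

lemmas R_add = fs.subspace_add[OF R_subspace] and R_scale = fs.subspace_scale[OF R_subspace]
  and R_diff = fs.subspace_diff[OF R_subspace] and R_zero = fs.subspace_0[OF R_subspace]
  and R_neg = fs.subspace_neg[OF R_subspace] and R_sum = fs.subspace_sum[OF R_subspace]
lemmas sp_add = fs.subspace_add[OF sym_power_subspace] and sp_scale = fs.subspace_scale[OF sym_power_subspace]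
  and sp_diff = fs.subspace_diff[OF sym_power_subspace] and sp_zero = fs.subspace_0[OF sym_power_subspace]
  and sp_sum = fs.subspace_sum[OF sym_power_subspace]

lemma sp_R: "f \<in> sym_power G k \<Longrightarrow> f \<in> R"
  unfolding R_eq by (auto intro: fs.span_base)

lemma monomials_0: "monomials 0 = {1}"
  by (auto simp: monomials_def)

lemma monomials_Suc: "monomials (Suc k) = {\<mu> * f | \<mu> f. \<mu> \<in> dual_space G \<and> f \<in> monomials k}"
proof -
  have "\<exists>\<mu> f. x = \<mu> * f \<and> \<mu> \<in> dual_space G \<and> f \<in> monomials k" if "x \<in> monomials (Suc k)" for x
  proof -
    from that obtain fs where "x = prod_list fs" "set fs \<subseteq> dual_space G" "length fs = Suc k"
      by (auto simp: monomials_def)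
    thus ?thesis
      by (cases fs) (auto simp: monomials_def)
  qed
  moreover have "\<mu> * f \<in> monomials (Suc k)" if mf: "\<mu> \<in> dual_space G" "f \<in> monomials k" for \<mu> f
  proof -
    from mf obtain fs where "f = prod_list fs" "set fs \<subseteq> dual_space G" "length fs = k"
      by (auto simp: monomials_def)
    thus ?thesis
      unfolding monomials_def using mf by (intro CollectI exI[of _ "\<mu> # fs"]) auto
  qed
  ultimately show ?thesis by blast
qed

lemma sym_power_0: "f \<in> sym_power G 0 \<longleftrightarrow> (\<exists>c. f = (\<lambda>_. c))"
  by (auto simp: sym_power_eq monomials_0 fs.span_singleton fscale_def one_fun_def)

lemma sp_dual_mult:
  assumes "\<mu> \<in> dual_space G" "f \<in> sym_power G k"
  shows "\<mu> * f \<in> sym_power G (Suc k)"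
proof -
  have "fs.span (monomials k) \<subseteq> {f. \<mu> * f \<in> fs.span (monomials (Suc k))}"
  proof (rule fs.span_minimal)
    show "monomials k \<subseteq> {f. \<mu> * f \<in> fs.span (monomials (Suc k))}"
    proof
      fix f assume "f \<in> monomials k"
      hence "\<mu> * f \<in> monomials (Suc k)" using assms(1) unfolding monomials_Suc by blast
      thus "f \<in> {f. \<mu> * f \<in> fs.span (monomials (Suc k))}" by (simp add: fs.span_base)
    qed
    show "fs.subspace {f. \<mu> * f \<in> fs.span (monomials (Suc k))}"
      by (rule fs.subspaceI)
         (simp_all only: mem_Collect_eq distrib_left fscale_mult_right mult_zero_right fs.span_zero fs.span_add fs.span_scale)
  qed
  thus ?thesis using assms(2) unfolding sym_power_eq by blast
qed

text \<open>The degree is an argument of the predicate, so that statements relating a function to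
  its degree can be proved factor by factor. A plain span induction does not see the factors of a
  monomial, which are therefore treated by a separate induction on \<open>k\<close>.\<close>

lemma sp_induct [consumes 1, case_names const add scale mult]:
  assumes "f \<in> sym_power G k"
    and "\<And>c. P 0 (\<lambda>_. c)"
    and "\<And>k f g. f \<in> sym_power G k \<Longrightarrow> g \<in> sym_power G k \<Longrightarrow> P k f \<Longrightarrow> P k g \<Longrightarrow> P k (f + g)"
    and "\<And>k c f. f \<in> sym_power G k \<Longrightarrow> P k f \<Longrightarrow> P k (fscale c f)"
    and "\<And>k \<mu> f. \<mu> \<in> dual_space G \<Longrightarrow> f \<in> sym_power G k \<Longrightarrow> P k f \<Longrightarrow> P (Suc k) (\<mu> * f)"
  shows "P k f"
proof -
  have m: "P k f" if "f \<in> monomials k" for f k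
    using that
  proof (induction k arbitrary: f)
    case 0
    thus ?case using assms(2)[of 1] by (simp add: monomials_0 one_fun_def)
  next
    case (Suc k)
    then obtain \<mu> g where g: "f = \<mu> * g" "\<mu> \<in> dual_space G" "g \<in> monomials k"
      by (auto simp: monomials_Suc)
    hence "g \<in> sym_power G k" by (simp add: sym_power_eq fs.span_base)
    with g Suc.IH assms(5) show ?case by blast
  qed
  \<comment> \<open>The base case of span induction asks for zero in every degree. In positive
    degree it is obtained from \<open>mult\<close> as the product of the zero functional with a
    monomial of zeros.\<close>
  have z: "P k 0"
  proof (cases k)
    case 0
    thus ?thesis using assms(2)[of 0] by (simp add: zero_fun_def)
  next
    case (Suc k')
    have "prod_list (replicate k' 0) \<in> monomials k'"
      unfolding monomials_def using fs.subspace_0[OF dual_subspace] 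
      by (intro CollectI exI[of _ "replicate k' 0"]) auto
    from assms(5)[OF fs.subspace_0[OF dual_subspace] _ m[OF this]] show ?thesis
      using Suc \<open>_ \<in> monomials k'\<close> by (auto simp: sym_power_eq fs.span_base)
  qed
  have "f \<in> fs.span (monomials k)" using assms(1) by (simp add: sym_power_eq)
  hence "f \<in> sym_power G k \<and> P k f"
  proof (induction rule: fs.span_induct_alt)
    case base
    show ?case using z sp_zero by blast
  next
    case (step c x y)
    have "x \<in> sym_power G k" using step by (simp add: sym_power_eq fs.span_base)
    with step m show ?case by (intro conjI sp_add sp_scale assms(3,4)) auto
  qed
  thus ?thesis ..
qed

lemma R_const: "(\<lambda>_. c) \<in> R"
  using sym_power_0 sp_R by blast

lemma R_one: "1 \<in> R"
  using R_const[of 1] by (simp add: one_fun_def)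

lemma R_dual_mult:
  assumes "\<mu> \<in> dual_space G" "f \<in> R"
  shows "\<mu> * f \<in> R"
proof -
  have "fs.span (\<Union>k. sym_power G k) \<subseteq> {f. \<mu> * f \<in> R}"
  proof (rule fs.span_minimal)
    show "(\<Union>k. sym_power G k) \<subseteq> {f. \<mu> * f \<in> R}"
      using sp_dual_mult[OF assms(1)] sp_R by blast
    show "fs.subspace {f. \<mu> * f \<in> R}"
      by (rule fs.subspaceI)
         (simp_all only: mem_Collect_eq distrib_left fscale_mult_right mult_zero_right R_zero R_add R_scale)
  qed
  thus ?thesis using assms(2) unfolding R_eq by blast
qed

lemma R_dual: "\<mu> \<in> dual_space G \<Longrightarrow> \<mu> \<in> R"
  using R_dual_mult[of \<mu> 1] R_one by simp

lemma R_graded_induct [consumes 1, case_names homog zero add]: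
  assumes "f \<in> R"
    and "\<And>k f. f \<in> sym_power G k \<Longrightarrow> P f" "P 0"
    and "\<And>f g. f \<in> R \<Longrightarrow> g \<in> R \<Longrightarrow> P f \<Longrightarrow> P g \<Longrightarrow> P (f + g)"
  shows "P f"
proof -
  have "f \<in> R \<and> P f"
    using assms(1) unfolding R_eq
  proof (induction rule: fs.span_induct_alt)
    case base
    show ?case using assms(3) fs.span_zero by blast
  next
    case (step c x y)
    then obtain k where "x \<in> sym_power G k" by auto
    hence "fscale c x \<in> sym_power G k" by (rule sp_scale)
    thus ?case using step assms(2,4) sp_R unfolding R_eq by (metis fs.span_add)
  qed
  thus ?thesis ..
qed

lemma R_induct [consumes 1, case_names const add scale mult]:
  assumes "f \<in> R"
    and "\<And>c. P (\<lambda>_. c)"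
    and "\<And>f g. f \<in> R \<Longrightarrow> g \<in> R \<Longrightarrow> P f \<Longrightarrow> P g \<Longrightarrow> P (f + g)"
    and "\<And>c f. f \<in> R \<Longrightarrow> P f \<Longrightarrow> P (fscale c f)"
    and "\<And>\<mu> f. \<mu> \<in> dual_space G \<Longrightarrow> f \<in> R \<Longrightarrow> P f \<Longrightarrow> P (\<mu> * f)"
  shows "P f"
  using assms(1)
proof (induction rule: R_graded_induct)
  case (homog k f)
  thus ?case
  proof (induction rule: sp_induct)
    case (const c)
    show ?case by (rule assms(2))
  next
    case (add k f g)
    show ?case by (rule assms(3)[OF sp_R[OF add(1)] sp_R[OF add(2)] add(3,4)])
  next
    case (scale k c f)
    show ?case by (rule assms(4)[OF sp_R[OF scale(1)] scale(2)])
  next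
    case (mult k \<mu> f)
    show ?case by (rule assms(5)[OF mult(1) sp_R[OF mult(2)] mult(3)])
  qed
next
  case zero
  show ?case using assms(2)[of 0] by (simp add: zero_fun_def)
qed (use assms(3) in blast)

lemma R_mult: "f \<in> R \<Longrightarrow> g \<in> R \<Longrightarrow> f * g \<in> R"
proof (induction f rule: R_induct)
  case (const c)
  thus ?case by (simp add: const_mult R_scale)
qed (auto simp: distrib_right mult.assoc fscale_mult_left intro: R_add R_scale R_dual_mult)

lemma sp_mult: "f \<in> sym_power G k \<Longrightarrow> g \<in> sym_power G l \<Longrightarrow> f * g \<in> sym_power G (k + l)"
proof (induction f rule: sp_induct)
  case (const c)
  thus ?case by (simp add: const_mult sp_scale)
qed (auto simp: distrib_right mult.assoc fscale_mult_left intro: sp_add sp_scale sp_dual_mult)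

lemma R_prod: "(\<And>i. i \<in> A \<Longrightarrow> f i \<in> R) \<Longrightarrow> (\<Prod>i\<in>A. f i) \<in> R"
  by (induction A rule: infinite_finite_induct) (auto intro: R_mult R_one)

lemma sp_prod:
  assumes "finite A" "\<And>i. i \<in> A \<Longrightarrow> f i \<in> dual_space G"
  shows "(\<Prod>i\<in>A. f i) \<in> sym_power G (card A)"
  using assms
proof (induction A)
  case empty
  show ?case using sym_power_0[of 1] by (auto simp: one_fun_def)
qed (auto intro: sp_dual_mult)

lemma sp_scaling: "f \<in> sym_power G k \<Longrightarrow> f (hsc c x) = c ^ k * f x"
  by (induction rule: sp_induct) (auto simp: dual_scale pointwise algebra_simps)

lemma sp_at_zero: "f \<in> sym_power G k \<Longrightarrow> k > 0 \<Longrightarrow> f 0 = 0"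
  using sp_scaling[of f k 0 0] by (auto simp: zero_power)

text \<open>The number \<open>n\<close> of components is what the induction in
  \<open>descent\<close> runs on.\<close>

lemma R_decomp:
  assumes "f \<in> R"
  shows "\<exists>n F. (\<forall>k. F k \<in> sym_power G k) \<and> f = (\<Sum>k<n. F k)"
  using assms
proof (induction rule: R_graded_induct)
  case (homog k f)
  show ?case
    by (rule exI[of _ "Suc k"], rule exI[of _ "\<lambda>i. if i = k then f else 0"])
       (auto simp: homog sp_zero)
next
  case zero
  show ?case by (rule exI[of _ 0], rule exI[of _ "\<lambda>_. 0"]) (auto simp: sp_zero)
next
  case (add f g)
  then obtain n F m H where F: "\<forall>k. F k \<in> sym_power G k" "f = (\<Sum>k<n. F k)"
    and H: "\<forall>k. H k \<in> sym_power G k" "g = (\<Sum>k<m. H k)" by blast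
  have 1: "f = (\<Sum>k<max n m. if k < n then F k else 0)"
    unfolding F by (intro sum.mono_neutral_cong_left) auto
  have 2: "g = (\<Sum>k<max n m. if k < m then H k else 0)"
    unfolding H by (intro sum.mono_neutral_cong_left) auto
  have "f + g = (\<Sum>k<max n m. (if k < n then F k else 0) + (if k < m then H k else 0))"
    unfolding sum.distrib using 1 2 by simp
  thus ?case using F(1) H(1)
    by (intro exI[of _ "max n m"] exI[of _ "\<lambda>k. (if k < n then F k else 0) + (if k < m then H k else 0)"])
       (auto intro!: sp_add simp: sp_zero)
qed

subsection \<open>Restriction to lines\<close>

text \<open>Restriction to lines transfers facts about univariate polynomials to \<open>R\<close>:
  absence of zero divisors in \<open>R_domain\<close>, comparison of coefficients in
  \<open>tr_homog\<close>.\<close>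

lemma R_line: "f \<in> R \<Longrightarrow> \<exists>p. \<forall>t. f (x + hsc t y) = poly p t"
proof (induction rule: R_induct)
  case (const c)
  show ?case by (rule exI[of _ "[:c:]"]) auto
next
  case (add f g)
  then obtain p q where "\<forall>t. f (x + hsc t y) = poly p t" "\<forall>t. g (x + hsc t y) = poly q t" by blast
  thus ?case by (intro exI[of _ "p + q"]) (auto simp: pointwise)
next
  case (scale c f)
  then obtain p where "\<forall>t. f (x + hsc t y) = poly p t" by blast
  thus ?case by (intro exI[of _ "Polynomial.smult c p"]) (auto simp: pointwise)
next
  case (mult \<mu> f)
  then obtain p where "\<forall>t. f (x + hsc t y) = poly p t" by blast
  thus ?case using mult by (intro exI[of _ "[:\<mu> x, \<mu> y:] * p"]) (auto simp: dual_add dual_scale pointwise algebra_simps)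
qed

text \<open>On the line joining a point where \<open>f\<close> is non-zero to a point where
  \<open>g\<close> is non-zero, neither restriction is the zero polynomial.\<close>

lemma R_domain:
  assumes "f \<in> R" "g \<in> R" "f * g = 0"
  shows "f = 0 \<or> g = 0"
proof (rule ccontr)
  assume "\<not> ?thesis"
  then obtain x y where xy: "f x \<noteq> 0" "g y \<noteq> 0" by (auto simp: fun_eq_iff pointwise)
  obtain p where p: "\<And>t. f (x + hsc t (y - x)) = poly p t" using R_line[OF assms(1)] by blast
  obtain q where q: "\<And>t. g (x + hsc t (y - x)) = poly q t" using R_line[OF assms(2)] by blast
  have "poly (p * q) t = 0" for t
    using fun_cong[OF assms(3), of "x + hsc t (y - x)"] by (simp add: p q pointwise)
  hence "p * q = 0" using poly_all_0_iff_0 by blast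
  moreover have "poly p 0 \<noteq> 0" using p[of 0] xy by simp
  moreover have "poly q 1 \<noteq> 0" using q[of 1] xy by simp
  ultimately show False by auto
qed

lemma R_cancel:
  assumes "p \<in> R" "p \<noteq> 0" "f \<in> R" "g \<in> R" "p * f = p * g"
  shows "f = g"
proof -
  have "p * (f - g) = 0" by (simp only: right_diff_distrib assms(5) diff_self)
  hence "f - g = 0" using R_domain[OF assms(1) R_diff[OF assms(3,4)]] assms(2) by blast
  thus ?thesis by (simp only: right_minus_eq)
qed

lemma R_prod_nonzero:
  assumes "finite A" "\<And>i. i \<in> A \<Longrightarrow> f i \<in> R" "\<And>i. i \<in> A \<Longrightarrow> f i \<noteq> 0"
  shows "(\<Prod>i\<in>A. f i) \<noteq> 0"
  using assms
proof (induction A)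
  case empty
  show ?case by (auto simp: fun_eq_iff pointwise)
next
  case (insert i A)
  thus ?case using R_domain[of "f i" "\<Prod>i\<in>A. f i"] R_prod[of A f] by auto
qed

subsection \<open>Divisibility by linear forms\<close>

definition dual_preserving :: "('h \<Rightarrow> 'h) \<Rightarrow> bool" where
  "dual_preserving t \<longleftrightarrow> (\<forall>\<mu>\<in>dual_space G. \<mu> \<circ> t \<in> dual_space G)"

lemma comp_add: "(f + g) \<circ> t = (f \<circ> t) + (g \<circ> t)" 
  and comp_mult: "(f * g) \<circ> t = (f \<circ> t) * (g \<circ> t)" 
  and comp_scale: "fscale c f \<circ> t = fscale c (f \<circ> t)" 
  and comp_zero: "0 \<circ> t = 0" 
  and comp_prod: "(\<Prod>i\<in>A. f' i) \<circ> t = (\<Prod>i\<in>A. f' i \<circ> t)" 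
  for f g :: "'h \<Rightarrow> complex" and f' :: "'a \<Rightarrow> 'h \<Rightarrow> complex" and t :: "'h \<Rightarrow> 'h"
  by (auto simp: fun_eq_iff pointwise)

lemma sp_comp: "f \<in> sym_power G k \<Longrightarrow> dual_preserving t \<Longrightarrow> f \<circ> t \<in> sym_power G k"
proof (induction rule: sp_induct)
  case (const c)
  show ?case by (simp add: sym_power_0 fun_eq_iff pointwise)
qed (auto simp: comp_add comp_mult comp_scale dual_preserving_def intro: sp_add sp_scale sp_dual_mult)

lemma R_comp: "f \<in> R \<Longrightarrow> dual_preserving t \<Longrightarrow> f \<circ> t \<in> R"
proof (induction rule: R_graded_induct)
  case zero
  show ?case by (simp add: comp_zero R_zero)
qed (auto simp: comp_add intro: R_add sp_R sp_comp)

text \<open>One family contains the reflection (\<open>c = 1\<close>) and the projection along the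
  coroot (\<open>c = 1/2\<close>), so a single induction yields both the existence of Demazure
  quotients and a divisibility criterion.\<close>

definition shear :: "complex \<Rightarrow> ('h \<Rightarrow> complex) \<Rightarrow> 'h \<Rightarrow> 'h" where
  "shear c \<beta> = (\<lambda>x. x - hsc (c * \<beta> x) (cor \<beta>))"

lemma reflection_shear: "s \<beta> = shear 1 \<beta>"
  by (simp add: reflection_def shear_def)

lemma dual_shear: 
  assumes "\<mu> \<in> dual_space G"
  shows "\<mu> \<circ> shear c \<beta> = \<mu> - fscale (c * \<mu> (cor \<beta>)) \<beta>"
  using assms by (auto simp: fun_eq_iff pointwise shear_def dual_diff dual_scale)

lemma dual_preserving_shear: "\<beta> \<in> \<Phi> \<Longrightarrow> dual_preserving (shear c \<beta>)"
  unfolding dual_preserving_def by (simp add: dual_shear fs.subspace_diff[OF dual_subspace] fs.subspace_scale[OF dual_subspace] root_dual)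

text \<open>For linear forms the difference is a multiple of \<beta> by \<open>dual_shear\<close>;
  the twisted product rule \<mu> f - \<mu>' f' = (\<mu> - \<mu>') f + \<mu>' (f - f') carries this
  to products. Degree 0 is separate because \<open>k - 1\<close> is truncated: there the quotient
  must be zero, not merely constant.\<close>

lemma shear_divisible:
  assumes "\<beta> \<in> \<Phi>" "f \<in> sym_power G k"
  shows "\<exists>g. (if k = 0 then g = 0 else g \<in> sym_power G (k - 1)) \<and> f - (f \<circ> shear c \<beta>) = \<beta> * g"
  using assms(2)
proof (induction rule: sp_induct)
  case (const a)
  show ?case by (rule exI[of _ 0]) (auto simp: fun_eq_iff pointwise)
next
  case (add k f g)
  then obtain u v where uv: "(if k = 0 then u = 0 else u \<in> sym_power G (k - 1))" "f - (f \<circ> shear c \<beta>) = \<beta> * u"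
    "(if k = 0 then v = 0 else v \<in> sym_power G (k - 1))" "g - (g \<circ> shear c \<beta>) = \<beta> * v" by blast
  have "f + g - ((f + g) \<circ> shear c \<beta>) = (f - (f \<circ> shear c \<beta>)) + (g - (g \<circ> shear c \<beta>))"
    by (simp add: comp_add)
  hence "f + g - ((f + g) \<circ> shear c \<beta>) = \<beta> * (u + v)"
    unfolding uv by (simp add: distrib_left)
  moreover have "if k = 0 then u + v = 0 else u + v \<in> sym_power G (k - 1)"
    using uv(1,3) by (auto intro: sp_add)
  ultimately show ?case by (intro exI[of _ "u + v"] conjI)
next
  case (scale k a f)
  then obtain u where u: "(if k = 0 then u = 0 else u \<in> sym_power G (k - 1))" "f - (f \<circ> shear c \<beta>) = \<beta> * u" by blast
  have "fscale a f - (fscale a f \<circ> shear c \<beta>) = fscale a (f - (f \<circ> shear c \<beta>))"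
    by (auto simp: fun_eq_iff pointwise algebra_simps)
  hence "fscale a f - (fscale a f \<circ> shear c \<beta>) = \<beta> * fscale a u"
    unfolding u by (simp add: fscale_mult_right)
  moreover have "if k = 0 then fscale a u = 0 else fscale a u \<in> sym_power G (k - 1)"
    using u(1) by (auto intro: sp_scale)
  ultimately show ?case by (intro exI[of _ "fscale a u"] conjI)
next
  case (mult k \<mu> f)
  then obtain u where u: "(if k = 0 then u = 0 else u \<in> sym_power G (k - 1))" "f - (f \<circ> shear c \<beta>) = \<beta> * u" by blast
  have "\<mu> * f - ((\<mu> * f) \<circ> shear c \<beta>) = (\<mu> - (\<mu> \<circ> shear c \<beta>)) * f + (\<mu> \<circ> shear c \<beta>) * (f - (f \<circ> shear c \<beta>))"
    by (auto simp: fun_eq_iff pointwise algebra_simps)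
  also have "\<dots> = fscale (c * \<mu> (cor \<beta>)) \<beta> * f + (\<mu> \<circ> shear c \<beta>) * (\<beta> * u)"
    using mult u by (simp add: dual_shear)
  also have "\<dots> = \<beta> * (fscale (c * \<mu> (cor \<beta>)) f + (\<mu> \<circ> shear c \<beta>) * u)"
    by (auto simp: fun_eq_iff pointwise algebra_simps)
  finally have "\<mu> * f - ((\<mu> * f) \<circ> shear c \<beta>) = \<beta> * (fscale (c * \<mu> (cor \<beta>)) f + (\<mu> \<circ> shear c \<beta>) * u)" .
  moreover have "fscale (c * \<mu> (cor \<beta>)) f + (\<mu> \<circ> shear c \<beta>) * u \<in> sym_power G k"
  proof (intro sp_add sp_scale mult)
    have "\<mu> \<circ> shear c \<beta> \<in> dual_space G" using dual_preserving_shear[OF assms(1)] mult by (auto simp: dual_preserving_def)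
    thus "(\<mu> \<circ> shear c \<beta>) * u \<in> sym_power G k"
      using u(1) sp_dual_mult[of "\<mu> \<circ> shear c \<beta>" u "k - 1"] by (cases k) (auto simp: sp_zero)
  qed
  ultimately show ?case by (intro exI[of _ "fscale (c * \<mu> (cor \<beta>)) f + (\<mu> \<circ> shear c \<beta>) * u"] conjI) (simp, assumption)
qed

lemma shear_divisible_R:
  assumes "\<beta> \<in> \<Phi>" "f \<in> R"
  shows "\<exists>g\<in>R. f - (f \<circ> shear c \<beta>) = \<beta> * g"
  using assms(2)
proof (induction rule: R_graded_induct)
  case (homog k f)
  thus ?case using shear_divisible[OF assms(1) homog, of c] sp_R R_zero by metis
next
  case zero
  show ?case by (rule bexI[of _ 0]) (auto simp: R_zero comp_zero)
next
  case (add f g)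
  then obtain u v where uv: "u \<in> R" "f - (f \<circ> shear c \<beta>) = \<beta> * u"
    "v \<in> R" "g - (g \<circ> shear c \<beta>) = \<beta> * v" by blast
  have "f + g - ((f + g) \<circ> shear c \<beta>) = (f - (f \<circ> shear c \<beta>)) + (g - (g \<circ> shear c \<beta>))"
    by (simp add: comp_add)
  hence "f + g - ((f + g) \<circ> shear c \<beta>) = \<beta> * (u + v)"
    unfolding uv by (simp add: distrib_left)
  thus ?case by (rule bexI[OF _ R_add[OF uv(1,3)]])
qed

lemma root_nonzero: "\<beta> \<in> \<Phi> \<Longrightarrow> \<beta> \<noteq> 0"
  using root_cor by (force simp: fun_eq_iff pointwise)

text \<open>\<open>shear (1/2) \<beta>\<close> is the projection onto the kernel of \<open>\<beta>\<close>, so that a polynomial function is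
  divisible by \<open>\<beta>\<close> if and only if its composition with this projection vanishes.\<close>

lemma root_shear_half: "\<beta> \<in> \<Phi> \<Longrightarrow> \<beta> \<circ> shear (1/2) \<beta> = 0"
  using root_dual by (simp add: dual_shear root_cor)

text \<open>Replaces unique factorisation. With g = P h and \<beta> dividing g, compose with the
  projection that kills \<beta>: P stays non-zero, as no other root in the set is proportional to
  \<beta>, so h is killed and hence divisible by \<beta>.\<close>

lemma prod_roots_dvd:
  assumes "finite A" "A \<subseteq> \<Phi>" "\<And>\<beta>. \<beta> \<in> A \<Longrightarrow> - \<beta> \<notin> A"
    and "g \<in> R" "\<And>\<beta>. \<beta> \<in> A \<Longrightarrow> \<exists>h\<in>R. g = \<beta> * h"
  shows "\<exists>h\<in>R. g = (\<Prod>\<beta>\<in>A. \<beta>) * h"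
  using assms(1-3,5)
proof (induction A)
  case empty
  show ?case using assms(4) by auto
next
  case (insert \<beta> A)
  then obtain h where h: "h \<in> R" "g = (\<Prod>\<beta>\<in>A. \<beta>) * h" by fastforce
  obtain k where k: "k \<in> R" "g = \<beta> * k" using insert.prems(3) by blast
  let ?p = "shear (1/2) \<beta>"
  have \<beta>: "\<beta> \<in> \<Phi>" using insert by auto
  have "(\<Prod>\<gamma>\<in>A. \<gamma> \<circ> ?p) * (h \<circ> ?p) = g \<circ> ?p" by (simp add: h comp_mult comp_prod)
  also have "g \<circ> ?p = 0" by (simp add: k comp_mult root_shear_half \<beta>)
  finally have "(\<Prod>\<gamma>\<in>A. \<gamma> \<circ> ?p) * (h \<circ> ?p) = 0" .
  moreover have "(\<Prod>\<gamma>\<in>A. \<gamma> \<circ> ?p) \<noteq> 0"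
  proof (rule R_prod_nonzero)
    fix \<gamma> assume \<gamma>: "\<gamma> \<in> A"
    hence \<gamma>': "\<gamma> \<in> \<Phi>" using insert by auto
    show "\<gamma> \<circ> ?p \<in> R" using R_comp R_dual root_dual dual_preserving_shear \<gamma>' \<beta> by blast
    show "\<gamma> \<circ> ?p \<noteq> 0"
    proof
      assume "\<gamma> \<circ> ?p = 0"
      hence e: "\<gamma> = fscale (1/2 * \<gamma> (cor \<beta>)) \<beta>" using dual_shear[of \<gamma> "1/2" \<beta>] root_dual[OF \<gamma>'] by simp
      hence "1/2 * \<gamma> (cor \<beta>) = 1 \<or> 1/2 * \<gamma> (cor \<beta>) = -1" using root_reduced[OF \<beta>] \<gamma>' by metis
      hence "\<gamma> = \<beta> \<or> \<gamma> = - \<beta>" 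
      proof
        assume "1/2 * \<gamma> (cor \<beta>) = 1"
        with e have "\<gamma> = fscale 1 \<beta>" by metis
        thus ?thesis by simp
      next
        assume "1/2 * \<gamma> (cor \<beta>) = -1"
        with e have "\<gamma> = fscale (-1) \<beta>" by metis
        thus ?thesis by simp
      qed
      thus False using \<gamma> insert by auto
    qed
  qed (use insert in auto)
  moreover have "(\<Prod>\<gamma>\<in>A. \<gamma> \<circ> ?p) \<in> R"
    using insert by (intro R_prod R_comp R_dual root_dual dual_preserving_shear) auto
  moreover have "h \<circ> ?p \<in> R" using h \<beta> by (intro R_comp dual_preserving_shear)
  ultimately have "h \<circ> ?p = 0" using R_domain by blast
  with shear_divisible_R[OF \<beta> h(1), of "1/2"] obtain m where m: "m \<in> R" "h = \<beta> * m" by auto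
  show ?case using insert m h by (intro bexI[of _ m]) (auto simp: mult_ac)
qed

subsection \<open>The Weyl group\<close>

abbreviation "W \<equiv> weyl_group G"
abbreviation "iv \<equiv> inv_into (UNIV :: 'h set)"

lemma refl_invol: "\<alpha> \<in> \<Phi> \<Longrightarrow> s \<alpha> \<circ> s \<alpha> = id"
proof
  fix x assume a: "\<alpha> \<in> \<Phi>"
  have "\<alpha> (s \<alpha> x) = - \<alpha> x"
    unfolding reflection_def using root_dual[OF a] root_cor[OF a] by (simp add: dual_diff dual_scale)
  thus "(s \<alpha> \<circ> s \<alpha>) x = id x"
    by (simp add: reflection_def pointwise hs.scale_minus_left)
qed

lemma refl_bij: "\<alpha> \<in> \<Phi> \<Longrightarrow> bij (s \<alpha>)"
  using refl_invol o_bij by blast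

lemma refl_inv: "\<alpha> \<in> \<Phi> \<Longrightarrow> iv (s \<alpha>) = s \<alpha>"
  using refl_invol inv_unique_comp by blast

lemma wp_Nil [simp]: "wp [] = id"
  and wp_Cons [simp]: "wp (\<alpha> # js) = s \<alpha> \<circ> wp js"
  by (simp_all add: word_prod_def comp_apply)

lemma wp_append: "wp (js @ ks) = wp js \<circ> wp ks"
  by (induction js) (simp_all only: append.simps wp_Nil wp_Cons id_comp comp_assoc)

lemma wp_bij: "set js \<subseteq> \<Phi> \<Longrightarrow> bij (wp js)"
  by (induction js) (auto intro: bij_comp refl_bij)

lemma wp_inv: "set js \<subseteq> \<Phi> \<Longrightarrow> iv (wp js) = wp (rev js)"
proof (induction js)
  case (Cons \<alpha> js)
  thus ?case using wp_bij[of js] refl_bij[of \<alpha>] by (simp add: o_inv_distrib wp_append refl_inv)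
qed auto

lemma gen_id: "id \<in> generated_by G A"
  unfolding generated_by_def by (intro CollectI exI[of _ "[]"]) auto

lemma gen_comp: "u \<in> generated_by G A \<Longrightarrow> v \<in> generated_by G A \<Longrightarrow> u \<circ> v \<in> generated_by G A"
  unfolding generated_by_def by clarsimp (metis wp_append set_append Un_subset_iff)

lemma gen_inv: "A \<subseteq> \<Phi> \<Longrightarrow> u \<in> generated_by G A \<Longrightarrow> iv u \<in> generated_by G A"
  unfolding generated_by_def by clarsimp (metis wp_inv set_rev order_trans)

lemma gen_refl: "\<alpha> \<in> A \<Longrightarrow> s \<alpha> \<in> generated_by G A"
  unfolding generated_by_def by (intro CollectI exI[of _ "[\<alpha>]"]) auto

lemma gen_mono: "A \<subseteq> B \<Longrightarrow> generated_by G A \<subseteq> generated_by G B"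
  unfolding generated_by_def by blast

lemma gen_induct [consumes 1, case_names id refl]:
  assumes "w \<in> generated_by G A" "P id" "\<And>\<alpha> w. \<alpha> \<in> A \<Longrightarrow> w \<in> generated_by G A \<Longrightarrow> P w \<Longrightarrow> P (s \<alpha> \<circ> w)"
  shows "P w"
proof -
  obtain js where "w = wp js" "set js \<subseteq> A" using assms(1) by (auto simp: generated_by_def)
  moreover have "set js \<subseteq> A \<Longrightarrow> P (wp js)" for js
  proof (induction js)
    case (Cons a js)
    hence "wp js \<in> generated_by G A" by (auto simp: generated_by_def)
    thus ?case using Cons assms(3) by auto
  qed (use assms(2) in auto)
  ultimately show ?thesis by blast
qed

lemmas W_id = gen_id[of \<Phi>, folded weyl_group_def]
  and W_comp = gen_comp[of _ \<Phi>, folded weyl_group_def]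
  and W_inv = gen_inv[OF subset_refl, folded weyl_group_def]
  and W_refl = gen_refl[of _ \<Phi>, folded weyl_group_def]
  and W_induct [consumes 1, case_names id refl] = gen_induct[of _ \<Phi>, folded weyl_group_def]

lemma W_bij: "w \<in> W \<Longrightarrow> bij w"
  by (auto simp: weyl_group_def generated_by_def wp_bij)

lemma W_inv_comp: "w \<in> W \<Longrightarrow> iv w \<circ> w = id" "w \<in> W \<Longrightarrow> w \<circ> iv w = id"
  using W_bij by (auto simp: bij_is_inj bij_is_surj surj_iff[symmetric])

lemma W_inv_inv: "w \<in> W \<Longrightarrow> iv (iv w) = w"
  using W_bij inv_inv_eq by blast

lemma W_inv_distrib: "u \<in> W \<Longrightarrow> v \<in> W \<Longrightarrow> iv (u \<circ> v) = iv v \<circ> iv u"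
  using W_bij o_inv_distrib by blast

lemma W_linear: "w \<in> W \<Longrightarrow> w (x + y) = w x + w y \<and> w (hsc c x) = hsc c (w x)"
proof (induction arbitrary: x y c rule: W_induct)
  case (refl \<alpha> w)
  have a: "s \<alpha> (x + y) = s \<alpha> x + s \<alpha> y" "s \<alpha> (hsc c x) = hsc c (s \<alpha> x)" for x y c
    using root_dual[OF refl(1)] 
    by (auto simp: reflection_def dual_add dual_scale hs.scale_left_distrib hs.scale_right_diff_distrib)
  show ?case using refl(3) by (simp add: a pointwise)
qed auto

lemma W_dual_preserving: "w \<in> W \<Longrightarrow> dual_preserving w"
  unfolding dual_preserving_def by (auto intro!: dualI simp: W_linear dual_add dual_scale pointwise)

lemma W_zero: "w \<in> W \<Longrightarrow> w 0 = 0"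
  using W_linear[of w 0 0 0] by auto

subsection \<open>The action on functions\<close>

lemma act_add: "act w (f + g) = act w f + act w g"
  and act_mult: "act w (f * g) = act w f * act w g"
  and act_scale: "act w (fscale c f) = fscale c (act w f)"
  and act_diff: "act w (f - g) = act w f - act w g"
  and act_neg: "act w (- f) = - act w f"
  and act_zero: "act w 0 = 0"
  and act_const: "act w (\<lambda>_. c) = (\<lambda>_. c)"
  and act_sum: "act w (\<Sum>i\<in>A. f' i) = (\<Sum>i\<in>A. act w (f' i))"
  and act_prod: "act w (\<Prod>i\<in>A. f' i) = (\<Prod>i\<in>A. act w (f' i))"
  for f g :: "'h \<Rightarrow> complex" and f' :: "'a \<Rightarrow> 'h \<Rightarrow> complex"
  by (auto simp: act_def fun_eq_iff pointwise)

lemma act_id [simp]: "act id f = f"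
  by (simp add: act_def)

lemma act_refl: "\<alpha> \<in> \<Phi> \<Longrightarrow> act (s \<alpha>) f = f \<circ> s \<alpha>"
  by (simp add: act_def refl_inv)

lemma act_comp: "u \<in> W \<Longrightarrow> v \<in> W \<Longrightarrow> act (u \<circ> v) f = act u (act v f)"
  by (simp add: act_def W_inv_distrib comp_assoc)

lemma act_inv_act: "w \<in> W \<Longrightarrow> act (iv w) (act w f) = f"
  and act_act_inv: "w \<in> W \<Longrightarrow> act w (act (iv w) f) = f"
  using act_comp[of "iv w" w f] act_comp[of w "iv w" f] by (auto simp: W_inv W_inv_comp)

lemma act_eq_iff: "w \<in> W \<Longrightarrow> act w f = act w g \<longleftrightarrow> f = g"
  using act_inv_act by metis

lemma act_R: "w \<in> W \<Longrightarrow> f \<in> R \<Longrightarrow> act w f \<in> R"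
  unfolding act_def by (intro R_comp W_dual_preserving W_inv)

lemma act_sp: "w \<in> W \<Longrightarrow> f \<in> sym_power G k \<Longrightarrow> act w f \<in> sym_power G k"
  unfolding act_def by (intro sp_comp W_dual_preserving W_inv)

lemma act_dual: "w \<in> W \<Longrightarrow> f \<in> dual_space G \<Longrightarrow> act w f \<in> dual_space G"
  unfolding act_def using W_dual_preserving[OF W_inv] by (auto simp: dual_preserving_def)

lemma act_at_zero: "w \<in> W \<Longrightarrow> act w f 0 = f 0"
  by (simp add: act_def W_zero W_inv pointwise)

lemma act_refl_dual: "\<alpha> \<in> \<Phi> \<Longrightarrow> \<mu> \<in> dual_space G \<Longrightarrow> act (s \<alpha>) \<mu> = \<mu> - fscale (\<mu> (cor \<alpha>)) \<alpha>"
  using dual_shear[of \<mu> 1 \<alpha>] act_refl[of \<alpha> \<mu>] by (simp add: reflection_shear)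

lemma act_roots: "w \<in> W \<Longrightarrow> \<beta> \<in> \<Phi> \<Longrightarrow> act w \<beta> \<in> \<Phi>"
proof (induction rule: W_induct)
  case (refl \<alpha> w)
  thus ?case by (simp add: act_comp W_refl act_refl_dual root_dual root_refl)
qed simp

lemma act_refl_self: "\<beta> \<in> \<Phi> \<Longrightarrow> act (s \<beta>) \<beta> = - \<beta>"
  using act_refl_dual[of \<beta> \<beta>] root_dual root_cor by (auto simp: fun_eq_iff pointwise)

section \<open>Faithfulness on the roots and equivariance of coroots\<close>

lemma dual_separates:
  assumes "\<And>\<mu>. \<mu> \<in> dual_space G \<Longrightarrow> \<mu> x = 0"
  shows "x = 0"
proof (rule ccontr)
  assume x: "x \<noteq> 0"
  let ?B = "hs.extend_basis {x}"
  have i: "hs.independent {x}" using x by (simp add: hs.dependent_single)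
  have B: "hs.independent ?B" "hs.span ?B = UNIV" "x \<in> ?B"
    using hs.independent_extend_basis[OF i] hs.span_extend_basis[OF i] hs.extend_basis_superset[OF i] by auto
  have "Vector_Spaces.linear hsc (*) (\<lambda>v. hs.representation ?B v x)"
    by (rule hs.linear_representation) (use B in auto)
  hence "(\<lambda>v. hs.representation ?B v x) \<in> dual_space G" by (simp add: dual_space_def)
  from assms[OF this] hs.representation_basis[OF B(1,3)] show False by simp
qed

lemma roots_separate:
  assumes "\<And>\<beta>. \<beta> \<in> \<Phi> \<Longrightarrow> \<beta> x = 0"
  shows "x = 0"
proof (rule dual_separates)
  fix \<mu> assume "\<mu> \<in> dual_space G"
  hence "\<mu> \<in> fs.span \<Phi>" by (simp add: span_roots)
  thus "\<mu> x = 0"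
    by (induction rule: fs.span_induct_alt) (auto simp: assms pointwise)
qed

lemma act_faithful:
  assumes "u \<in> W" "v \<in> W" "\<And>\<beta>. \<beta> \<in> \<Phi> \<Longrightarrow> act u \<beta> = act v \<beta>"
  shows "u = v"
proof -
  have "iv u x - iv v x = 0" for x
  proof (rule roots_separate)
    fix \<beta> assume b: "\<beta> \<in> \<Phi>"
    have "\<beta> (iv u x) = \<beta> (iv v x)" using fun_cong[OF assms(3)[OF b], of x] by (simp add: act_def pointwise)
    thus "\<beta> (iv u x - iv v x) = 0" using root_dual[OF b] by (simp add: dual_diff)
  qed
  hence "iv u = iv v" by auto
  thus ?thesis using W_inv_inv assms(1,2) by metis
qed

text \<open>A group element is determined by its action on the roots, a map from a finite set to
  itself.\<close>

lemma finite_W: "finite W"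
proof (rule finite_imageD)
  show "inj_on (\<lambda>w. restrict (act w) \<Phi>) W"
    by (rule inj_onI, rule act_faithful) (auto simp: restrict_def fun_eq_iff, metis)
  show "finite ((\<lambda>w. restrict (act w) \<Phi>) ` W)"
    by (rule finite_subset[OF _ finite_PiE[OF finite_roots, of "\<lambda>_. \<Phi>"]])
       (auto simp: finite_roots act_roots)
qed

text \<open>The difference \<open>u\<close> of two candidate coroots gives unipotent transformations
  \<open>\<mu> \<mapsto> \<mu> + n \<mu>(u) \<gamma>\<close> that preserve the finite set of roots.\<close>

lemma cor_act:
  assumes "w \<in> W" "\<beta> \<in> \<Phi>"
  shows "cor (act w \<beta>) = w (cor \<beta>)"
proof -
  define \<gamma> where "\<gamma> = act w \<beta>"
  define u where "u = w (cor \<beta>) - cor \<gamma>"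
  have \<gamma>: "\<gamma> \<in> \<Phi>" using assms act_roots \<gamma>_def by blast
  have "\<gamma> (w (cor \<beta>)) = \<beta> ((iv w \<circ> w) (cor \<beta>))" by (simp add: \<gamma>_def act_def pointwise)
  also have "\<dots> = 2" using assms by (simp only: W_inv_comp root_cor id_apply)
  finally have \<gamma>u: "\<gamma> u = 0" and \<gamma>w: "\<gamma> (w (cor \<beta>)) = 2"
    unfolding u_def using root_dual[OF \<gamma>] root_cor[OF \<gamma>] by (auto simp: dual_diff)
  have step: "\<mu> + fscale (\<mu> u) \<gamma> \<in> \<Phi>" if m: "\<mu> \<in> \<Phi>" for \<mu>
  proof -
    \<comment> \<open>Both \<open>s \<gamma>\<close> and the conjugate of \<open>s \<beta>\<close>
      by \<open>w\<close> negate \<gamma>; their product fixes \<gamma> and is the unipotent map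
      that sends \<mu> to \<mu> + \<mu>(u) \<gamma>.\<close>
    let ?t = "s \<gamma> \<circ> (w \<circ> (s \<beta> \<circ> iv w))"
    have m': "\<mu> \<in> dual_space G" "act (iv w) \<mu> \<in> dual_space G" using m root_dual assms act_dual W_inv by auto
    have ma: "act (iv w) \<mu> (cor \<beta>) = \<mu> (w (cor \<beta>))" using assms by (simp add: act_def W_inv_inv pointwise)
    have "act (w \<circ> (s \<beta> \<circ> iv w)) \<mu> = act w (act (s \<beta>) (act (iv w) \<mu>))"
      using assms by (simp add: act_comp W_comp W_inv W_refl)
    also have "\<dots> = act w (act (iv w) \<mu> - fscale (\<mu> (w (cor \<beta>))) \<beta>)"
      using assms m' ma by (simp add: act_refl_dual)
    also have "\<dots> = \<mu> - fscale (\<mu> (w (cor \<beta>))) \<gamma>"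
      using assms by (simp add: act_diff act_scale act_act_inv \<gamma>_def)
    finally have "act ?t \<mu> = act (s \<gamma>) (\<mu> - fscale (\<mu> (w (cor \<beta>))) \<gamma>)"
      using assms \<gamma> by (simp add: act_comp W_comp W_inv W_refl)
    also have "\<dots> = \<mu> - fscale (\<mu> (cor \<gamma>)) \<gamma> + fscale (\<mu> (w (cor \<beta>))) \<gamma>"
      using \<gamma> m' by (simp add: act_diff act_scale act_refl_dual act_refl_self)
    also have "\<dots> = \<mu> + fscale (\<mu> u) \<gamma>"
      using m' by (auto simp: fun_eq_iff pointwise u_def dual_diff algebra_simps)
    finally show ?thesis using act_roots[of ?t \<mu>] m assms \<gamma> by (simp add: W_comp W_inv W_refl)
  qed
  have "\<mu> u = 0" if m: "\<mu> \<in> \<Phi>" for \<mu>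
  proof (rule ccontr)
    assume nz: "\<mu> u \<noteq> 0"
    have it: "\<mu> + fscale (of_nat n * \<mu> u) \<gamma> \<in> \<Phi>" for n
    proof (induction n)
      case 0
      have "\<mu> + fscale 0 \<gamma> = \<mu>" by (auto simp: fun_eq_iff pointwise)
      thus ?case using m by simp
    next
      case (Suc n)
      have "(\<mu> + fscale (of_nat n * \<mu> u) \<gamma>) + fscale ((\<mu> + fscale (of_nat n * \<mu> u) \<gamma>) u) \<gamma> 
        = \<mu> + fscale (of_nat (Suc n) * \<mu> u) \<gamma>"
        using \<gamma>u by (auto simp: fun_eq_iff pointwise algebra_simps)
      thus ?case using step[OF Suc] by metis
    qed
    have "inj (\<lambda>n::nat. \<mu> + fscale (of_nat n * \<mu> u) \<gamma>)"
    proof (rule injI)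
      fix m n :: nat
      assume "\<mu> + fscale (of_nat m * \<mu> u) \<gamma> = \<mu> + fscale (of_nat n * \<mu> u) \<gamma>"
      from fun_cong[OF this, of "cor \<gamma>"] show "m = n" using nz root_cor[OF \<gamma>] by (auto simp: pointwise)
    qed
    hence "infinite (range (\<lambda>n::nat. \<mu> + fscale (of_nat n * \<mu> u) \<gamma>))" using range_inj_infinite by blast
    moreover have "range (\<lambda>n::nat. \<mu> + fscale (of_nat n * \<mu> u) \<gamma>) \<subseteq> \<Phi>" using it by blast
    ultimately show False using finite_roots finite_subset by blast
  qed
  hence "u = 0" by (rule roots_separate)
  thus ?thesis by (simp add: u_def \<gamma>_def)
qed

text \<open>This is where equivariance of the coroots pays off: conjugating a reflection gives the
  reflection in the transformed root, on which the deletion of letters in words rests.\<close>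

lemma refl_conj:
  assumes "w \<in> W" "\<beta> \<in> \<Phi>"
  shows "s (act w \<beta>) \<circ> w = w \<circ> s \<beta>"
proof
  fix x
  have w: "w (x - y) = w x - w y" for x y
    using W_linear[OF assms(1), of "x - y" y] by (simp add: algebra_simps)
  have "act w \<beta> (w x) = \<beta> ((iv w \<circ> w) x)" by (simp add: act_def pointwise)
  thus "(s (act w \<beta>) \<circ> w) x = (w \<circ> s \<beta>) x"
    using assms by (simp add: reflection_def cor_act w W_linear W_inv_comp comp_apply)
qed

lemma cor_neg:
  assumes "\<beta> \<in> \<Phi>"
  shows "cor (- \<beta>) = - cor \<beta>"
proof -
  have "cor (- \<beta>) = s \<beta> (cor \<beta>)" using cor_act[OF W_refl[OF assms] assms] act_refl_self[OF assms] by metis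
  also have "\<dots> = cor \<beta> - hsc (1 + 1) (cor \<beta>)" by (simp add: reflection_def root_cor[OF assms])
  also have "\<dots> = - cor \<beta>" unfolding hs.scale_left_distrib by simp
  finally show ?thesis .
qed

lemma refl_neg: "\<beta> \<in> \<Phi> \<Longrightarrow> s (- \<beta>) = s \<beta>"
  by (rule ext) (simp only: reflection_def cor_neg uminus_apply hs.scale_minus_left hs.scale_minus_right minus_minus)

subsection \<open>Positive roots\<close>

definition simple_coeff :: "('h \<Rightarrow> complex) \<Rightarrow> ('h \<Rightarrow> complex) \<Rightarrow> complex" where
  "simple_coeff = fs.representation \<Delta>"

lemma pos_root: "\<beta> \<in> Pos \<Longrightarrow> \<beta> \<in> \<Phi>"
  by (simp add: positive_roots_def)

lemma finite_pos: "finite Pos"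
  by (rule finite_subset[OF _ finite_roots]) (auto simp: positive_roots_def)

lemma roots_span: "\<beta> \<in> \<Phi> \<Longrightarrow> \<beta> \<in> fs.span \<Delta>"
proof -
  have p: "\<beta> \<in> fs.span \<Delta>" if b: "\<beta> \<in> Pos" for \<beta>
  proof -
    obtain n :: "_ \<Rightarrow> nat" where n: "\<beta> = (\<Sum>\<alpha>\<in>\<Delta>. fscale (of_nat (n \<alpha>)) \<alpha>)"
      using b unfolding positive_roots_def by blast
    show ?thesis unfolding n by (intro fs.span_sum fs.span_scale fs.span_base)
  qed
  assume "\<beta> \<in> \<Phi>"
  then consider "\<beta> \<in> Pos" | "- \<beta> \<in> Pos" using pos_or_neg by blast
  thus ?thesis
  proof cases
    case 2
    from fs.span_neg[OF p[OF this]] show ?thesis by (simp only: minus_minus)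
  qed (rule p)
qed

lemma simple_coeff_diff: "\<beta> \<in> fs.span \<Delta> \<Longrightarrow> \<gamma> \<in> fs.span \<Delta> \<Longrightarrow> simple_coeff (\<beta> - \<gamma>) \<alpha> = simple_coeff \<beta> \<alpha> - simple_coeff \<gamma> \<alpha>"
  and simple_coeff_neg: "\<beta> \<in> fs.span \<Delta> \<Longrightarrow> simple_coeff (- \<beta>) \<alpha> = - simple_coeff \<beta> \<alpha>"
  and simple_coeff_scale: "\<beta> \<in> fs.span \<Delta> \<Longrightarrow> simple_coeff (fscale c \<beta>) \<alpha> = c * simple_coeff \<beta> \<alpha>"
  and simple_coeff_sum: "(\<And>i. i \<in> A \<Longrightarrow> v i \<in> fs.span \<Delta>) \<Longrightarrow> simple_coeff (\<Sum>i\<in>A. v i) \<alpha> = (\<Sum>i\<in>A. simple_coeff (v i) \<alpha>)"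
  and simple_coeff_basis: "\<alpha> \<in> \<Delta> \<Longrightarrow> simple_coeff \<alpha> = (\<lambda>\<gamma>. if \<gamma> = \<alpha> then 1 else 0)"
  and simple_coeff_eq: "\<beta> \<in> fs.span \<Delta> \<Longrightarrow> (\<Sum>\<alpha>\<in>\<Delta>. fscale (simple_coeff \<beta> \<alpha>) \<alpha>) = \<beta>"
  using indep finite_simple
  by (simp_all add: simple_coeff_def fs.representation_diff fs.representation_neg fs.representation_scale
      fs.representation_sum fs.representation_basis fs.sum_representation_eq)

lemma simple_coeff_pos: "\<beta> \<in> Pos \<Longrightarrow> \<alpha> \<in> \<Delta> \<Longrightarrow> \<exists>n. simple_coeff \<beta> \<alpha> = of_nat n"
proof -
  assume "\<beta> \<in> Pos" and a: "\<alpha> \<in> \<Delta>"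
  then obtain n :: "_ \<Rightarrow> nat" where b: "\<beta> = (\<Sum>\<alpha>\<in>\<Delta>. fscale (of_nat (n \<alpha>)) \<alpha>)"
    by (auto simp: positive_roots_def)
  have "simple_coeff \<beta> \<alpha> = (\<Sum>\<gamma>\<in>\<Delta>. of_nat (n \<gamma>) * simple_coeff \<gamma> \<alpha>)"
    unfolding b by (simp add: simple_coeff_sum simple_coeff_scale fs.span_scale fs.span_base)
  also have "\<dots> = (\<Sum>\<gamma>\<in>\<Delta>. if \<gamma> = \<alpha> then of_nat (n \<alpha>) else 0)"
    by (intro sum.cong) (auto simp: simple_coeff_basis)
  also have "\<dots> = of_nat (n \<alpha>)" using a finite_simple by simp
  finally show ?thesis by blast
qed

lemma simple_coeff_nonzero: "\<beta> \<in> \<Phi> \<Longrightarrow> \<exists>\<alpha>\<in>\<Delta>. simple_coeff \<beta> \<alpha> \<noteq> 0"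
proof (rule ccontr)
  assume b: "\<beta> \<in> \<Phi>" and "\<not> ?thesis"
  hence "\<And>\<alpha>. \<alpha> \<in> \<Delta> \<Longrightarrow> simple_coeff \<beta> \<alpha> = 0" by blast
  hence "(\<Sum>\<alpha>\<in>\<Delta>. fscale (simple_coeff \<beta> \<alpha>) \<alpha>) = 0" by (intro sum.neutral) auto
  hence "\<beta> = 0" using simple_coeff_eq[OF roots_span[OF b]] by simp
  thus False using root_nonzero b by blast
qed

lemma simple_pos: "\<alpha> \<in> \<Delta> \<Longrightarrow> \<alpha> \<in> Pos"
proof -
  assume a: "\<alpha> \<in> \<Delta>"
  hence a': "\<alpha> \<in> \<Phi>" using simple_sub by blast
  have "simple_coeff (- \<alpha>) \<alpha> = -1" using simple_coeff_neg[OF roots_span[OF a'], of \<alpha>] a by (simp add: simple_coeff_basis)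
  moreover have "(of_nat n :: complex) \<noteq> -1" for n
    by (metis of_nat_neq_0 add.commute eq_neg_iff_add_eq_0 of_nat_Suc)
  ultimately have "- \<alpha> \<notin> Pos" using simple_coeff_pos[of "- \<alpha>" \<alpha>] a by metis
  thus ?thesis using pos_or_neg[OF a'] by blast
qed

lemma pos_not_neg: "\<beta> \<in> Pos \<Longrightarrow> - \<beta> \<notin> Pos"
proof
  assume b: "\<beta> \<in> Pos" "- \<beta> \<in> Pos"
  then obtain \<alpha> where a: "\<alpha> \<in> \<Delta>" "simple_coeff \<beta> \<alpha> \<noteq> 0" using simple_coeff_nonzero pos_root by blast
  obtain n m where "simple_coeff \<beta> \<alpha> = of_nat n" "simple_coeff (- \<beta>) \<alpha> = of_nat m" using b a simple_coeff_pos by blast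
  hence "(of_nat m :: complex) = - of_nat n"
    using simple_coeff_neg[OF roots_span[OF pos_root[OF b(1)]], of \<alpha>] by simp
  hence "of_nat (n + m) = (0 :: complex)" by simp
  hence "n = 0" by (simp only: of_nat_eq_0_iff)
  thus False using a \<open>simple_coeff \<beta> \<alpha> = of_nat n\<close> by simp
qed

lemma neg_pos_iff: "\<beta> \<in> \<Phi> \<Longrightarrow> - \<beta> \<in> Pos \<longleftrightarrow> \<beta> \<notin> Pos"
  using pos_not_neg pos_or_neg by blast

lemma simple_coeff_pos_nonneg: "\<beta> \<in> Pos \<Longrightarrow> \<alpha> \<in> \<Delta> \<Longrightarrow> Re (simple_coeff \<beta> \<alpha>) \<ge> 0 \<and> simple_coeff \<beta> \<alpha> = of_real (Re (simple_coeff \<beta> \<alpha>))"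
  using simple_coeff_pos[of \<beta> \<alpha>] by auto

lemma simple_coeff_neg_nonpos: "\<beta> \<in> \<Phi> \<Longrightarrow> \<beta> \<notin> Pos \<Longrightarrow> \<alpha> \<in> \<Delta> \<Longrightarrow> Re (simple_coeff \<beta> \<alpha>) \<le> 0"
  using simple_coeff_pos_nonneg[of "- \<beta>" \<alpha>] neg_pos_iff[of \<beta>] simple_coeff_neg[OF roots_span, of \<beta> \<alpha>] by auto

text \<open>Reflection in \<alpha> changes only the \<alpha>-coefficient. As \<beta> is not
  proportional to \<alpha>, it has a positive coefficient elsewhere, and one positive coefficient
  makes a root positive.\<close>

lemma simple_refl_pos:
  assumes "\<beta> \<in> Pos" "\<alpha> \<in> \<Delta>" "\<beta> \<noteq> \<alpha>"
  shows "act (s \<alpha>) \<beta> \<in> Pos"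
proof -
  have ab: "\<alpha> \<in> \<Phi>" "\<beta> \<in> \<Phi>" using assms simple_sub pos_root by auto
  have "\<exists>\<gamma>\<in>\<Delta>. \<gamma> \<noteq> \<alpha> \<and> simple_coeff \<beta> \<gamma> \<noteq> 0"
  proof (rule ccontr)
    assume "\<not> ?thesis"
    hence z: "\<And>\<gamma>. \<gamma> \<in> \<Delta> \<Longrightarrow> \<gamma> \<noteq> \<alpha> \<Longrightarrow> simple_coeff \<beta> \<gamma> = 0" by blast
    have "\<beta> = (\<Sum>\<gamma>\<in>\<Delta>. fscale (simple_coeff \<beta> \<gamma>) \<gamma>)" using simple_coeff_eq ab roots_span by metis
    also have "\<dots> = (\<Sum>\<gamma>\<in>\<Delta>. if \<gamma> = \<alpha> then fscale (simple_coeff \<beta> \<alpha>) \<alpha> else 0)"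
      by (intro sum.cong) (auto simp: z)
    also have "\<dots> = fscale (simple_coeff \<beta> \<alpha>) \<alpha>" using assms finite_simple by simp
    finally have b: "\<beta> = fscale (simple_coeff \<beta> \<alpha>) \<alpha>" .
    hence "simple_coeff \<beta> \<alpha> = 1 \<or> simple_coeff \<beta> \<alpha> = -1" using root_reduced[OF ab(1)] ab(2) by metis
    moreover have "simple_coeff \<beta> \<alpha> \<noteq> -1" using simple_coeff_pos_nonneg[OF assms(1,2)] by auto
    ultimately have "\<beta> = fscale 1 \<alpha>" using b by metis
    thus False using assms by simp
  qed
  then obtain \<gamma> where g: "\<gamma> \<in> \<Delta>" "\<gamma> \<noteq> \<alpha>" "simple_coeff \<beta> \<gamma> \<noteq> 0" by blast
  have "simple_coeff (act (s \<alpha>) \<beta>) \<gamma> = simple_coeff \<beta> \<gamma> - \<beta> (cor \<alpha>) * simple_coeff \<alpha> \<gamma>"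
    using ab by (simp add: act_refl_dual root_dual simple_coeff_diff simple_coeff_scale roots_span fs.span_scale)
  hence "simple_coeff (act (s \<alpha>) \<beta>) \<gamma> = simple_coeff \<beta> \<gamma>" using g assms by (simp add: simple_coeff_basis)
  moreover have "Re (simple_coeff \<beta> \<gamma>) > 0" 
    using simple_coeff_pos_nonneg[OF assms(1) g(1)] g(3) by (metis of_real_0 order_le_less)
  ultimately show ?thesis using simple_coeff_neg_nonpos[of "act (s \<alpha>) \<beta>" \<gamma>] g ab act_roots W_refl by fastforce
qed

subsection \<open>Inversions and length\<close>

definition Inv :: "('h \<Rightarrow> 'h) \<Rightarrow> ('h \<Rightarrow> complex) set" where
  "Inv w = {\<beta> \<in> Pos. act w \<beta> \<notin> Pos}"

text \<open>Equals the word length by \<open>weyl_length_wp\<close>. Counting inversions replaces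
  minimisation over words by manipulation of finite sets.\<close>

definition N :: "('h \<Rightarrow> 'h) \<Rightarrow> nat" where
  "N w = card (Inv w)"

text \<open>The entry of a letter is that letter moved by the inverse of the part of the word to its
  right. For a reduced word these are exactly the inversions; in general some entries are negative
  or repeated.\<close>

primrec inversion_list :: "('h \<Rightarrow> complex) list \<Rightarrow> ('h \<Rightarrow> complex) list" where
  "inversion_list [] = []"
| "inversion_list (\<alpha> # js) = act (iv (wp js)) \<alpha> # inversion_list js"

lemma finite_Inv: "finite (Inv w)"
  using finite_pos by (simp add: Inv_def)

lemma wp_W: "set js \<subseteq> \<Phi> \<Longrightarrow> wp js \<in> W"
  by (auto simp: weyl_group_def generated_by_def)

text \<open>A simple reflection permutes the positive roots other than \<alpha>. Hence the sign of
  an image can change only at the roots that \<open>w\<close> sends to \<alpha> or its negative,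
  which are \<gamma> and its negative.\<close>

lemma Inv_simple:
  assumes "w \<in> W" "\<alpha> \<in> \<Delta>"
  defines "\<gamma> \<equiv> act (iv w) \<alpha>"
  shows "\<gamma> \<in> Pos \<Longrightarrow> Inv (s \<alpha> \<circ> w) = insert \<gamma> (Inv w) \<and> \<gamma> \<notin> Inv w"
    and "\<gamma> \<notin> Pos \<Longrightarrow> Inv w = insert (- \<gamma>) (Inv (s \<alpha> \<circ> w)) \<and> - \<gamma> \<notin> Inv (s \<alpha> \<circ> w)"
proof -
  have a: "\<alpha> \<in> \<Phi>" "\<alpha> \<in> Pos" using assms simple_sub simple_pos by auto
  have g: "\<gamma> \<in> \<Phi>" "act w \<gamma> = \<alpha>" "act w (- \<gamma>) = - \<alpha>"
    unfolding \<gamma>_def using assms a act_roots W_inv by (auto simp: act_act_inv act_neg)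
  have eq: "act w \<beta> = \<alpha> \<longleftrightarrow> \<beta> = \<gamma>" "act w \<beta> = - \<alpha> \<longleftrightarrow> \<beta> = - \<gamma>" for \<beta>
    using g act_eq_iff[OF assms(1)] by metis+
  have key: "act (s \<alpha> \<circ> w) \<beta> \<in> Pos \<longleftrightarrow> act w \<beta> \<in> Pos" if b: "\<beta> \<in> \<Phi>" "\<beta> \<noteq> \<gamma>" "\<beta> \<noteq> - \<gamma>" for \<beta>
  proof -
    have d: "act w \<beta> \<in> \<Phi>" "act w \<beta> \<noteq> \<alpha>" "act w \<beta> \<noteq> - \<alpha>" using b assms eq act_roots by auto
    have c: "act (s \<alpha> \<circ> w) \<beta> = act (s \<alpha>) (act w \<beta>)" using assms a by (simp add: act_comp W_refl)
    show ?thesis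
    proof
      assume "act w \<beta> \<in> Pos"
      thus "act (s \<alpha> \<circ> w) \<beta> \<in> Pos" using d c simple_refl_pos assms(2) by simp
    next
      assume p: "act (s \<alpha> \<circ> w) \<beta> \<in> Pos"
      show "act w \<beta> \<in> Pos"
      proof (rule ccontr)
        assume "act w \<beta> \<notin> Pos"
        hence "- act w \<beta> \<in> Pos" using d neg_pos_iff by blast
        moreover have "- act w \<beta> \<noteq> \<alpha>" using d(3) by auto
        ultimately have "- act (s \<alpha> \<circ> w) \<beta> \<in> Pos" using simple_refl_pos[of "- act w \<beta>" \<alpha>] assms(2) 
          by (simp add: c act_neg)
        thus False using p pos_not_neg by blast
      qed
    qed
  qed
  have s_gam: "act (s \<alpha> \<circ> w) \<gamma> = - \<alpha>" "act (s \<alpha> \<circ> w) (- \<gamma>) = \<alpha>"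
    using assms a g by (auto simp: act_comp W_refl act_refl_self act_neg)
  have na: "- \<alpha> \<notin> Pos" using a pos_not_neg by blast
  show "Inv (s \<alpha> \<circ> w) = insert \<gamma> (Inv w) \<and> \<gamma> \<notin> Inv w" if p: "\<gamma> \<in> Pos"
  proof -
    have ng: "- \<gamma> \<notin> Pos" using p pos_not_neg by blast
    have "\<beta> \<in> Inv (s \<alpha> \<circ> w) \<longleftrightarrow> \<beta> \<in> insert \<gamma> (Inv w)" for \<beta>
    proof (cases "\<beta> = \<gamma>")
      case True
      thus ?thesis using p s_gam(1) na by (simp add: Inv_def)
    next
      case False
      thus ?thesis using key[of \<beta>] ng pos_root[of \<beta>] unfolding Inv_def by blast
    qed
    moreover have "\<gamma> \<notin> Inv w" using g(2) a(2) by (simp add: Inv_def)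
    ultimately show ?thesis by blast
  qed
  show "Inv w = insert (- \<gamma>) (Inv (s \<alpha> \<circ> w)) \<and> - \<gamma> \<notin> Inv (s \<alpha> \<circ> w)" if p: "\<gamma> \<notin> Pos"
  proof -
    have ng: "- \<gamma> \<in> Pos" using p g(1) neg_pos_iff by blast
    have "\<beta> \<in> Inv w \<longleftrightarrow> \<beta> \<in> insert (- \<gamma>) (Inv (s \<alpha> \<circ> w))" for \<beta>
    proof (cases "\<beta> = - \<gamma>")
      case True
      thus ?thesis using ng g(3) na by (simp add: Inv_def)
    next
      case False
      thus ?thesis using key[of \<beta>] p pos_root[of \<beta>] unfolding Inv_def by blast
    qed
    moreover have "- \<gamma> \<notin> Inv (s \<alpha> \<circ> w)" using s_gam(2) a(2) by (simp add: Inv_def)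
    ultimately show ?thesis by blast
  qed
qed

lemma N_simple:
  assumes "w \<in> W" "\<alpha> \<in> \<Delta>"
  shows "act (iv w) \<alpha> \<in> Pos \<Longrightarrow> N (s \<alpha> \<circ> w) = Suc (N w)"
    and "act (iv w) \<alpha> \<notin> Pos \<Longrightarrow> N w = Suc (N (s \<alpha> \<circ> w))"
  using Inv_simple[OF assms] finite_Inv by (auto simp: N_def)

lemma length_inversion_list [simp]: "length (inversion_list js) = length js"
  by (induction js) auto

lemma Inv_id [simp]: "Inv id = {}"
  by (simp add: Inv_def)

lemma N_id [simp]: "N id = 0"
  by (simp add: N_def)

lemma Inv_subset_inversion_list: "set js \<subseteq> \<Delta> \<Longrightarrow> Inv (wp js) \<subseteq> set (inversion_list js)"
proof (induction js)
  case (Cons \<alpha> js)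
  have w: "wp js \<in> W" using Cons simple_sub by (intro wp_W) auto
  have a: "\<alpha> \<in> \<Delta>" using Cons by auto
  show ?case
  proof (cases "act (iv (wp js)) \<alpha> \<in> Pos")
    case True
    thus ?thesis using Inv_simple(1)[OF w a] Cons by auto
  next
    case False
    thus ?thesis using Inv_simple(2)[OF w a] Cons by auto
  qed
qed auto

lemma N_le_length: "set js \<subseteq> \<Delta> \<Longrightarrow> N (wp js) \<le> length js"
  unfolding N_def using card_mono[OF _ Inv_subset_inversion_list] card_length[of "inversion_list js"] by fastforce

text \<open>The strong exchange property in explicit form: pushing the letter to the right end of
  the word turns it into the reflection in its entry of the inversion list, which the extra factor
  cancels.\<close>

lemma wp_delete:
  assumes "set js \<subseteq> \<Phi>" "i < length js"
  shows "wp (take i js @ drop (Suc i) js) = wp js \<circ> s (inversion_list js ! i)"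
  using assms
proof (induction js arbitrary: i)
  case (Cons \<alpha> js)
  have w: "wp js \<in> W" and a: "\<alpha> \<in> \<Phi>" using Cons by (auto intro: wp_W)
  show ?case
  proof (cases i)
    case 0
    have "s \<alpha> \<circ> wp js = wp js \<circ> s (act (iv (wp js)) \<alpha>)"
      using refl_conj[OF w, of "act (iv (wp js)) \<alpha>"] w a by (simp add: act_act_inv act_roots W_inv)
    hence "(s \<alpha> \<circ> wp js) \<circ> s (act (iv (wp js)) \<alpha>) = wp js \<circ> (s (act (iv (wp js)) \<alpha>) \<circ> s (act (iv (wp js)) \<alpha>))"
      by (simp add: comp_assoc)
    also have "\<dots> = wp js" using refl_invol w a by (simp add: act_roots W_inv)
    finally show ?thesis using 0 by simp
  next
    case (Suc j)
    thus ?thesis using Cons by (simp add: comp_assoc)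
  qed
qed auto

text \<open>If a new first letter lowers \<open>N\<close>, the corresponding inversion of the old
  product occurs in the inversion list of its reduced word, and deleting that letter gives the new
  product. Letters are only deleted, never replaced, so the reduced word stays inside the given
  alphabet; parabolic subgroups need this.\<close>

lemma reduced_word_exists:
  "set js \<subseteq> \<Delta> \<Longrightarrow> \<exists>ks. set ks \<subseteq> set js \<and> wp ks = wp js \<and> length ks = N (wp js)"
proof (induction js)
  case (Cons \<alpha> js)
  then obtain ks where ks: "set ks \<subseteq> set js" "wp ks = wp js" "length ks = N (wp js)" by auto
  have w: "wp js \<in> W" using Cons simple_sub by (intro wp_W) auto
  have a: "\<alpha> \<in> \<Delta>" "\<alpha> \<in> \<Phi>" using Cons simple_sub by auto
  let ?\<gamma> = "act (iv (wp js)) \<alpha>"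
  show ?case
  proof (cases "?\<gamma> \<in> Pos")
    case True
    thus ?thesis using ks N_simple(1)[OF w a(1)] by (intro exI[of _ "\<alpha> # ks"]) auto
  next
    case False
    have g: "?\<gamma> \<in> \<Phi>" using a w by (intro act_roots W_inv)
    have "- ?\<gamma> \<in> Inv (wp js)" using Inv_simple(2)[OF w a(1) False] by blast
    hence "- ?\<gamma> \<in> set (inversion_list ks)" using Inv_subset_inversion_list[of ks] ks Cons by auto
    then obtain i where i: "i < length ks" "inversion_list ks ! i = - ?\<gamma>" by (auto simp: in_set_conv_nth)
    let ?ks = "take i ks @ drop (Suc i) ks"
    have "wp ?ks = wp ks \<circ> s (- ?\<gamma>)" using wp_delete[of ks i] i ks Cons simple_sub by auto
    also have "\<dots> = wp js \<circ> s ?\<gamma>" using g by (simp add: refl_neg ks)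
    also have "\<dots> = s \<alpha> \<circ> wp js"
      using refl_conj[OF w g] w by (simp add: act_act_inv)
    finally have "wp ?ks = wp (\<alpha> # js)" by simp
    moreover have "length ?ks = N (wp (\<alpha> # js))" using i ks N_simple(2)[OF w a(1) False] by simp
    moreover have "set ?ks \<subseteq> set (\<alpha> # js)"
      using ks set_take_subset[of i ks] set_drop_subset[of "Suc i" ks] by auto
    ultimately show ?thesis by blast
  qed
qed auto

lemma weyl_length_wp: "set js \<subseteq> \<Delta> \<Longrightarrow> weyl_length G (wp js) = N (wp js)"
  unfolding weyl_length_def
proof (rule Least_equality)
  assume "set js \<subseteq> \<Delta>"
  thus "\<exists>ks. set ks \<subseteq> \<Delta> \<and> length ks = N (wp js) \<and> wp ks = wp js"
    using reduced_word_exists by (metis order_trans)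
qed (use N_le_length in metis)

subsection \<open>Parabolic subgroups\<close>

abbreviation "par \<equiv> parabolic G"

text \<open>The positive roots of the parabolic subsystem, given by their support. That they are the
  positive roots conjugate to \<open>J\<close> under the parabolic subgroup is recovered from
  \<open>PosJ_conj\<close> and \<open>par_PosJ\<close>.\<close>

definition PosJ :: "('h \<Rightarrow> complex) set \<Rightarrow> ('h \<Rightarrow> complex) set" where
  "PosJ J = {\<beta> \<in> Pos. \<forall>\<alpha>\<in>\<Delta> - J. simple_coeff \<beta> \<alpha> = 0}"

lemma PosJ_Pos: "\<beta> \<in> PosJ J \<Longrightarrow> \<beta> \<in> Pos"
  by (simp add: PosJ_def)

lemma PosJ_roots: "PosJ J \<subseteq> \<Phi>"
  using PosJ_Pos pos_root by blast

lemma finite_PosJ: "finite (PosJ J)"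
  using finite_pos by (simp add: PosJ_def)

lemma PosJ_simple: "PosJ \<Delta> = Pos"
  by (simp add: PosJ_def)

lemma simple_coeff_refl: "\<beta> \<in> \<Phi> \<Longrightarrow> \<alpha> \<in> \<Delta> \<Longrightarrow> \<gamma> \<noteq> \<alpha> \<Longrightarrow> simple_coeff (act (s \<alpha>) \<beta>) \<gamma> = simple_coeff \<beta> \<gamma>"
proof -
  assume b: "\<beta> \<in> \<Phi>" "\<alpha> \<in> \<Delta>" "\<gamma> \<noteq> \<alpha>"
  hence a: "\<alpha> \<in> \<Phi>" using simple_sub by blast
  have "simple_coeff (act (s \<alpha>) \<beta>) \<gamma> = simple_coeff \<beta> \<gamma> - \<beta> (cor \<alpha>) * simple_coeff \<alpha> \<gamma>"
    using a b by (simp add: act_refl_dual root_dual simple_coeff_diff simple_coeff_scale roots_span fs.span_scale)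
  thus ?thesis using b by (simp add: simple_coeff_basis)
qed

text \<open>A root supported on \<open>J\<close> is a non-negative combination of \<open>J\<close>.
  If every image of \<open>J\<close> has coefficients at most 0, so has the image of the root.
  Coefficients are complex numbers, hence the real parts.\<close>

lemma neg_all:
  assumes "w \<in> W" "\<And>\<alpha>. \<alpha> \<in> J \<Longrightarrow> act w \<alpha> \<notin> Pos" "\<beta> \<in> PosJ J" "J \<subseteq> \<Delta>"
  shows "act w \<beta> \<notin> Pos"
proof
  assume p: "act w \<beta> \<in> Pos"
  have b: "\<beta> \<in> Pos" "\<beta> \<in> \<Phi>" using assms(3) PosJ_Pos pos_root by blast+
  have sp: "act w \<alpha> \<in> fs.span \<Delta>" if "\<alpha> \<in> \<Delta>" for \<alpha>
    using that simple_sub assms(1) act_roots roots_span by blast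
  obtain \<gamma> where g: "\<gamma> \<in> \<Delta>" "simple_coeff (act w \<beta>) \<gamma> \<noteq> 0" using simple_coeff_nonzero p pos_root by blast
  have "act w \<beta> = act w (\<Sum>\<alpha>\<in>\<Delta>. fscale (simple_coeff \<beta> \<alpha>) \<alpha>)" using simple_coeff_eq[OF roots_span[OF b(2)]] by metis
  also have "\<dots> = (\<Sum>\<alpha>\<in>\<Delta>. fscale (simple_coeff \<beta> \<alpha>) (act w \<alpha>))" by (simp add: act_sum act_scale)
  finally have "simple_coeff (act w \<beta>) \<gamma> = (\<Sum>\<alpha>\<in>\<Delta>. simple_coeff \<beta> \<alpha> * simple_coeff (act w \<alpha>) \<gamma>)"
    using sp by (simp add: simple_coeff_sum simple_coeff_scale fs.span_scale)
  hence "Re (simple_coeff (act w \<beta>) \<gamma>) = (\<Sum>\<alpha>\<in>\<Delta>. Re (simple_coeff \<beta> \<alpha> * simple_coeff (act w \<alpha>) \<gamma>))" by simp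
  also have "\<dots> \<le> 0"
  proof (rule sum_nonpos)
    fix \<alpha> assume a: "\<alpha> \<in> \<Delta>"
    show "Re (simple_coeff \<beta> \<alpha> * simple_coeff (act w \<alpha>) \<gamma>) \<le> 0"
    proof (cases "\<alpha> \<in> J")
      case True
      obtain r where r: "simple_coeff \<beta> \<alpha> = of_real r" "r \<ge> 0" using simple_coeff_pos_nonneg[OF b(1) a] by blast
      have "Re (simple_coeff (act w \<alpha>) \<gamma>) \<le> 0"
        using simple_coeff_neg_nonpos[OF _ assms(2)[OF True] g(1)] act_roots[OF assms(1)] a simple_sub by blast
      thus ?thesis using r by (simp add: mult_nonneg_nonpos)
    next
      case False
      thus ?thesis using assms(3) a by (simp add: PosJ_def)
    qed
  qed
  finally show False using simple_coeff_pos_nonneg[OF p g(1)] g(2) 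
    by (metis of_real_0 order_antisym)
qed

context
  fixes J :: "('h \<Rightarrow> complex) set"
  assumes J: "J \<subseteq> \<Delta>"
begin

lemma J_roots: "J \<subseteq> \<Phi>"
  using J simple_sub by blast

lemmas par_id = gen_id[of J, folded parabolic_def]
  and par_comp = gen_comp[of _ J, folded parabolic_def]
  and par_inv = gen_inv[OF J_roots, folded parabolic_def]
  and par_refl = gen_refl[of _ J, folded parabolic_def]
  and par_induct [consumes 1, case_names id refl] = gen_induct[of _ J, folded parabolic_def]

lemma par_W: "w \<in> par J \<Longrightarrow> w \<in> W"
  unfolding parabolic_def weyl_group_def using gen_mono[OF J_roots] by blast

lemma par_reduced: "w \<in> par J \<Longrightarrow> \<exists>js. set js \<subseteq> J \<and> wp js = w \<and> length js = N w"
proof -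
  assume "w \<in> par J"
  then obtain js where js: "set js \<subseteq> J" "w = wp js" unfolding parabolic_def generated_by_def by blast
  obtain ks where "set ks \<subseteq> set js" "wp ks = wp js" "length ks = N (wp js)"
    using reduced_word_exists[of js] js J by blast
  thus ?thesis using js by blast
qed

lemma par_length: "w \<in> par J \<Longrightarrow> weyl_length G w = N w"
proof -
  assume "w \<in> par J"
  then obtain js where "set js \<subseteq> J" "w = wp js" unfolding parabolic_def generated_by_def by blast
  thus ?thesis using weyl_length_wp[of js] J by blast
qed

lemma J_PosJ: "\<alpha> \<in> J \<Longrightarrow> \<alpha> \<in> PosJ J"
  using J simple_pos by (auto simp: PosJ_def simple_coeff_basis)

lemma refl_PosJ:
  assumes "\<beta> \<in> PosJ J" "\<alpha> \<in> J" "\<beta> \<noteq> \<alpha>"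
  shows "act (s \<alpha>) \<beta> \<in> PosJ J"
proof -
  have a: "\<alpha> \<in> \<Delta>" and b: "\<beta> \<in> \<Phi>" using assms J PosJ_roots by blast+
  have "simple_coeff (act (s \<alpha>) \<beta>) \<gamma> = 0" if "\<gamma> \<in> \<Delta> - J" for \<gamma>
    using simple_coeff_refl[OF b a, of \<gamma>] that assms by (auto simp: PosJ_def)
  thus ?thesis using simple_refl_pos[OF PosJ_Pos[OF assms(1)] a assms(3)] by (simp add: PosJ_def)
qed

text \<open>Reflections in \<open>J\<close> leave the coefficients outside \<open>J\<close>
  unchanged, so a root with such a coefficient never becomes a letter of \<open>J\<close> and stays
  positive at each step.\<close>

lemma par_compl:
  assumes "w \<in> par J" "\<beta> \<in> Pos - PosJ J"
  shows "act w \<beta> \<in> Pos - PosJ J"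
  using assms(1)
proof (induction rule: par_induct)
  case id
  show ?case using assms(2) unfolding act_id .
next
  case (refl \<alpha> w)
  let ?\<beta> = "act w \<beta>"
  have a: "\<alpha> \<in> \<Delta>" "\<alpha> \<in> \<Phi>" and ne: "?\<beta> \<noteq> \<alpha>" using refl J J_PosJ simple_sub by blast+
  have b: "?\<beta> \<in> \<Phi>" using refl pos_root by blast
  obtain \<gamma> where g: "\<gamma> \<in> \<Delta> - J" "simple_coeff ?\<beta> \<gamma> \<noteq> 0" using refl by (auto simp: PosJ_def)
  have "simple_coeff (act (s \<alpha>) ?\<beta>) \<gamma> \<noteq> 0" 
  proof -
    have "\<gamma> \<noteq> \<alpha>" using g(1) refl(1) by blast
    thus ?thesis using simple_coeff_refl[OF b a(1)] g(2) by simp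
  qed
  moreover have "act (s \<alpha>) ?\<beta> \<in> Pos" using simple_refl_pos a ne refl by blast
  ultimately have "act (s \<alpha>) ?\<beta> \<in> Pos - PosJ J" using g by (auto simp: PosJ_def)
  thus ?case using act_comp[OF W_refl[OF a(2)] par_W[OF refl(2)]] by metis
qed

text \<open>Otherwise the image or its negative is a positive root outside the subsystem, and by
  \<open>par_compl\<close> the inverse element would keep it there.\<close>

lemma par_PosJ:
  assumes "w \<in> par J" "\<beta> \<in> PosJ J"
  shows "act w \<beta> \<in> PosJ J \<or> - act w \<beta> \<in> PosJ J"
proof -
  have b: "\<beta> \<in> \<Phi>" using assms PosJ_roots by blast
  have wb: "act w \<beta> \<in> \<Phi>" using act_roots par_W assms b by blast
  have "- act w \<beta> \<in> PosJ J" if "act w \<beta> \<notin> PosJ J"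
  proof (rule ccontr)
    assume n: "- act w \<beta> \<notin> PosJ J"
    have "act w \<beta> \<in> Pos - PosJ J \<or> act w (- \<beta>) \<in> Pos - PosJ J"
      using that n neg_pos_iff[OF wb] by (auto simp: act_neg)
    hence "act (iv w) (act w \<beta>) \<in> Pos - PosJ J \<or> act (iv w) (act w (- \<beta>)) \<in> Pos - PosJ J"
      using par_compl[OF par_inv[OF assms(1)]] by blast
    hence "\<beta> \<in> Pos - PosJ J \<or> - \<beta> \<in> Pos" using act_inv_act par_W assms(1) by auto
    thus False using assms(2) PosJ_Pos pos_not_neg by blast
  qed
  thus ?thesis by blast
qed

lemma par_Inv: "w \<in> par J \<Longrightarrow> Inv w \<subseteq> PosJ J"
  using par_compl by (auto simp: Inv_def)

lemma par_N_le: "w \<in> par J \<Longrightarrow> N w \<le> card (PosJ J)"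
  unfolding N_def using card_mono[OF finite_PosJ par_Inv] .

lemma Inv_full: "w \<in> par J \<Longrightarrow> N w = card (PosJ J) \<Longrightarrow> Inv w = PosJ J"
  using card_subset_eq[OF finite_PosJ par_Inv] by (simp add: N_def)

text \<open>If \<open>v\<close> has maximal length, no left multiplication by a letter lengthens it,
  so its inverse makes all of \<open>J\<close> negative and, by \<open>neg_all\<close>, all of
  \<open>PosJ J\<close>. Therefore the inverse of \<open>v\<close> is the witness.\<close>

lemma longest_exists: "\<exists>u\<in>par J. N u = card (PosJ J)"
proof -
  have fin: "finite (N ` par J)"
    by (rule finite_subset[of _ "{..card (PosJ J)}"]) (use par_N_le in auto)
  have "Max (N ` par J) \<in> N ` par J" by (rule Max_in[OF fin]) (use par_id in auto)
  then obtain v where v: "v \<in> par J" "Max (N ` par J) = N v" by (rule imageE)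
  have max: "N u \<le> N v" if "u \<in> par J" for u
    using Max_ge[OF fin imageI[OF that]] v(2) by simp
  have neg: "act (iv v) \<alpha> \<notin> Pos" if a: "\<alpha> \<in> J" for \<alpha>
  proof
    assume "act (iv v) \<alpha> \<in> Pos"
    hence "N (s \<alpha> \<circ> v) = Suc (N v)" using N_simple(1)[OF par_W[OF v(1)]] a J by blast
    moreover have "s \<alpha> \<circ> v \<in> par J" by (rule par_comp[OF par_refl[OF a] v(1)])
    ultimately show False using max[of "s \<alpha> \<circ> v"] by simp
  qed
  have u: "iv v \<in> par J" by (rule par_inv[OF v(1)])
  have "Inv (iv v) = PosJ J"
    using par_Inv[OF u] neg_all[OF par_W[OF u] neg _ J] PosJ_Pos unfolding Inv_def by blast
  thus ?thesis using u by (intro bexI[of _ "iv v"]) (simp_all add: N_def)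
qed

lemma N_zero:
  assumes "w \<in> par J" "N w = 0"
  shows "w = id"
proof -
  obtain js where "wp js = w" "length js = N w" using par_reduced[OF assms(1)] by blast
  thus ?thesis using assms(2) wp_Nil by auto
qed

text \<open>\<open>v\<close> turns the subsystem's positive roots negative and \<open>u\<close>
  turns them back, which leaves no inversions. With \<open>u = v\<close> this gives the involution
  property, and uniqueness follows from both.\<close>

lemma longest_comp:
  assumes "u \<in> par J" "N u = card (PosJ J)" "v \<in> par J" "N v = card (PosJ J)"
  shows "u \<circ> v = id"
proof (rule N_zero)
  show uv: "u \<circ> v \<in> par J" using assms par_comp by blast
  have "act (u \<circ> v) \<beta> \<in> Pos" if b: "\<beta> \<in> PosJ J" for \<beta>
  proof -
    have "act v \<beta> \<notin> Pos" using Inv_full[OF assms(3,4)] b by (auto simp: Inv_def)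
    hence "- act v \<beta> \<in> PosJ J" using par_PosJ[OF assms(3) b] PosJ_Pos by blast
    hence "act u (- act v \<beta>) \<notin> Pos" using Inv_full[OF assms(1,2)] by (auto simp: Inv_def)
    hence "- act (u \<circ> v) \<beta> \<notin> Pos" using assms par_W by (simp add: act_comp act_neg)
    moreover have "act (u \<circ> v) \<beta> \<in> \<Phi>" using b PosJ_roots par_W[OF uv] act_roots by blast
    ultimately show ?thesis using neg_pos_iff by blast
  qed
  hence "Inv (u \<circ> v) = {}" using par_Inv[OF uv] by (auto simp: Inv_def)
  thus "N (u \<circ> v) = 0" by (simp add: N_def)
qed

lemma longest_unique:
  assumes "u \<in> par J" "N u = card (PosJ J)" "v \<in> par J" "N v = card (PosJ J)"
  shows "u = v"
proof -
  have "u = u \<circ> (v \<circ> v)" using longest_comp assms by simp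
  also have "\<dots> = (u \<circ> v) \<circ> v" by (simp only: comp_assoc)
  also have "\<dots> = v" using longest_comp assms by simp
  finally show ?thesis .
qed

lemma w_par_spec: "w_par G J \<in> par J \<and> N (w_par G J) = card (PosJ J)"
proof -
  obtain u where u: "u \<in> par J" "N u = card (PosJ J)" using longest_exists by blast
  have "w_par G J = u"
    unfolding w_par_def longest_in_def
  proof (rule the_equality)
    show "u \<in> par J \<and> (\<forall>v\<in>par J. weyl_length G v \<le> weyl_length G u)"
      using u par_length par_N_le by simp
    fix w assume w: "w \<in> par J \<and> (\<forall>v\<in>par J. weyl_length G v \<le> weyl_length G w)"
    hence "weyl_length G u \<le> weyl_length G w" using u by blast
    hence "N w = card (PosJ J)" using w u par_length par_N_le[of w] by simp
    thus "w = u" using longest_unique w u by blast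
  qed
  thus ?thesis using u by simp
qed

lemmas w_par_par = w_par_spec[THEN conjunct1] and w_par_N = w_par_spec[THEN conjunct2]

lemma w_par_invol: "w_par G J \<circ> w_par G J = id"
  using longest_comp w_par_par w_par_N by blast

lemma w_par_Inv: "Inv (w_par G J) = PosJ J"
  using Inv_full w_par_par w_par_N by blast

lemma inversion_list_conj: "set js \<subseteq> J \<Longrightarrow> \<beta> \<in> set (inversion_list js) \<Longrightarrow> \<exists>v\<in>par J. \<exists>\<alpha>\<in>J. \<beta> = act v \<alpha>"
proof (induction js)
  case (Cons \<alpha> js)
  have "wp js \<in> par J" using Cons.prems unfolding parabolic_def generated_by_def by auto
  hence "iv (wp js) \<in> par J" by (rule par_inv)
  thus ?case using Cons by auto
qed simp

text \<open>Every such root is an inversion of the longest element, and the inversions of a word in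
  \<open>J\<close> are letters transformed by its suffixes.\<close>

lemma PosJ_conj: "\<beta> \<in> PosJ J \<Longrightarrow> \<exists>v\<in>par J. \<exists>\<alpha>\<in>J. \<beta> = act v \<alpha>"
proof -
  assume b: "\<beta> \<in> PosJ J"
  obtain js where js: "set js \<subseteq> J" "wp js = w_par G J" using par_reduced w_par_par by blast
  have "\<beta> \<in> set (inversion_list js)" using Inv_subset_inversion_list[of js] js J b w_par_Inv by auto
  thus ?thesis using inversion_list_conj js by blast
qed

lemma refl_act:
  assumes "v \<in> W" "\<alpha> \<in> \<Phi>"
  shows "s (act v \<alpha>) = v \<circ> s \<alpha> \<circ> iv v"
proof -
  have "s (act v \<alpha>) \<circ> v \<circ> iv v = v \<circ> s \<alpha> \<circ> iv v" using refl_conj assms by simp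
  thus ?thesis using assms by (simp add: comp_assoc W_inv_comp)
qed

lemma refl_par: "\<beta> \<in> PosJ J \<Longrightarrow> s \<beta> \<in> par J"
proof -
  assume "\<beta> \<in> PosJ J"
  then obtain v \<alpha> where v: "v \<in> par J" "\<alpha> \<in> J" "\<beta> = act v \<alpha>" using PosJ_conj by blast
  hence "s \<beta> = v \<circ> s \<alpha> \<circ> iv v" using refl_act par_W J_roots by blast
  thus ?thesis using v par_comp par_inv par_refl by metis
qed

end

text \<open>\<open>W\<close> is generated by all root reflections, whereas lengths use simple ones;
  every root is up to sign conjugate to a simple root, so the two generating sets agree.\<close>

lemma W_par: "W = par \<Delta>"
proof
  show "par \<Delta> \<subseteq> W" using par_W by blast
  show "W \<subseteq> par \<Delta>"
  proof
    fix w assume "w \<in> W"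
    thus "w \<in> par \<Delta>"
    proof (induction rule: W_induct)
      case id
      show ?case by (rule par_id[OF order_refl])
    next
      case (refl \<beta> w)
      have "s \<beta> \<in> par \<Delta>"
      proof (cases "\<beta> \<in> Pos")
        case True
        thus ?thesis using refl_par[of \<Delta> \<beta>] PosJ_simple by blast
      next
        case False
        hence "- \<beta> \<in> PosJ \<Delta>" using refl neg_pos_iff PosJ_simple by blast
        thus ?thesis using refl_par[of \<Delta> "- \<beta>"] refl_neg[OF refl(1)] by simp
      qed
      thus ?case using refl par_comp[of \<Delta>] by blast
    qed
  qed
qed

abbreviation "w0 \<equiv> w_0 G"

lemma w0_par: "w0 = w_par G \<Delta>"
  by (simp add: w_0_def w_par_def W_par)

lemma w0_W: "w0 \<in> W" and w0_N: "N w0 = card Pos" and w0_Inv: "Inv w0 = Pos"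
  and w0_invol: "w0 \<circ> w0 = id"
  using w_par_par[of \<Delta>] w_par_N[of \<Delta>] w_par_Inv[of \<Delta>] w_par_invol[of \<Delta>]
  by (auto simp: w0_par W_par PosJ_simple)

lemma W_length: "w \<in> W \<Longrightarrow> weyl_length G w = N w"
  using par_length[of \<Delta>] W_par by blast

lemma W_reduced: "w \<in> W \<Longrightarrow> \<exists>js. reduced_expression G js w"
  using par_reduced[of \<Delta> w] W_par W_length unfolding reduced_expression_def by auto

lemma W_N_le: "w \<in> W \<Longrightarrow> N w \<le> card Pos"
  using par_N_le[of \<Delta>] W_par PosJ_simple by auto

lemma W_N_max: "w \<in> W \<Longrightarrow> N w = card Pos \<Longrightarrow> w = w0"
  using longest_unique[of \<Delta> w w0] w0_W w0_N W_par PosJ_simple by auto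

lemma iv_w0: "iv w0 = w0"
  using w0_invol inv_unique_comp by blast

lemma w0_neg: "\<beta> \<in> Pos \<Longrightarrow> - act w0 \<beta> \<in> Pos"
  using w0_Inv w0_W neg_pos_iff act_roots pos_root unfolding Inv_def by blast

lemma w0_pos_iff: "\<beta> \<in> \<Phi> \<Longrightarrow> act w0 \<beta> \<in> Pos \<longleftrightarrow> \<beta> \<notin> Pos"
  using w0_neg[of \<beta>] w0_neg[of "- \<beta>"] pos_not_neg neg_pos_iff by (auto simp: act_neg)

lemma N_iv: "w \<in> W \<Longrightarrow> N (iv w) = N w"
proof -
  assume w: "w \<in> W"
  have "bij_betw (\<lambda>\<beta>. - act w \<beta>) (Inv w) (Inv (iv w))"
  proof (rule bij_betw_byWitness[where f' = "\<lambda>\<beta>. - act (iv w) \<beta>"])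
    show "\<forall>\<beta>\<in>Inv w. - act (iv w) (- act w \<beta>) = \<beta>" "\<forall>\<beta>\<in>Inv (iv w). - act w (- act (iv w) \<beta>) = \<beta>"
      using w by (auto simp: act_neg act_inv_act act_act_inv)
    have "- act v \<beta> \<in> Inv (iv v)" if v: "v \<in> W" "\<beta> \<in> Inv v" for v \<beta>
    proof -
      have "\<beta> \<in> Pos" "act v \<beta> \<notin> Pos" "act v \<beta> \<in> \<Phi>" using v act_roots pos_root by (auto simp: Inv_def)
      thus ?thesis using v neg_pos_iff pos_not_neg by (auto simp: Inv_def act_neg act_inv_act)
    qed
    from this[OF w] this[OF W_inv[OF w]] show "(\<lambda>\<beta>. - act w \<beta>) ` Inv w \<subseteq> Inv (iv w)"
      "(\<lambda>\<beta>. - act (iv w) \<beta>) ` Inv (iv w) \<subseteq> Inv w" using w by (auto simp: W_inv_inv)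
  qed
  thus ?thesis unfolding N_def using bij_betw_same_card by metis
qed

lemma N_w0_comp: "u \<in> W \<Longrightarrow> N (w0 \<circ> u) = card Pos - N u"
proof -
  assume u: "u \<in> W"
  have "Inv (w0 \<circ> u) = Pos - Inv u"
    using u w0_W w0_pos_iff act_roots pos_root by (auto simp: Inv_def act_comp)
  thus ?thesis unfolding N_def using card_Diff_subset[OF finite_Inv, of u Pos] by (auto simp: Inv_def)
qed

lemma N_comp_w0: "u \<in> W \<Longrightarrow> N (u \<circ> w0) = card Pos - N u"
  using N_w0_comp[of "iv u"] N_iv[of "u \<circ> w0"] N_iv[of u] w0_W
  by (simp add: W_inv W_comp W_inv_distrib iv_w0)

subsection \<open>Minimal coset representatives\<close>

context
  fixes J :: "('h \<Rightarrow> complex) set"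
  assumes J: "J \<subseteq> \<Delta>"
begin

lemma min_coset_reps_iff:
  "d \<in> min_coset_reps G J \<longleftrightarrow> d \<in> W \<and> (\<forall>v\<in>par J. N d \<le> N (d \<circ> v))"
  unfolding min_coset_reps_def using W_length W_comp par_W[OF J] by auto

text \<open>A negative image would make \<open>d \<circ> s \<alpha>\<close> shorter than
  \<open>d\<close> within the same coset.\<close>

lemma min_coset_pos:
  assumes "d \<in> min_coset_reps G J" "\<alpha> \<in> J"
  shows "act d \<alpha> \<in> Pos"
proof (rule ccontr)
  assume n: "act d \<alpha> \<notin> Pos"
  have d: "d \<in> W" and a: "\<alpha> \<in> \<Delta>" "\<alpha> \<in> \<Phi>" using assms min_coset_reps_iff J simple_sub by blast+
  have "N (iv d) = Suc (N (s \<alpha> \<circ> iv d))"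
    by (rule N_simple(2)) (use d a n in \<open>auto simp: W_inv W_inv_inv\<close>)
  moreover have "N (s \<alpha> \<circ> iv d) = N (d \<circ> s \<alpha>)"
    using N_iv[of "d \<circ> s \<alpha>"] d a by (simp add: W_comp W_refl W_inv_distrib refl_inv)
  moreover have "N d \<le> N (d \<circ> s \<alpha>)" using assms min_coset_reps_iff par_refl[OF J] by blast
  ultimately show False using N_iv[OF d] by simp
qed

lemma w0_w_par_min: "w0 \<circ> w_par G J \<in> min_coset_reps G J"
  unfolding min_coset_reps_iff
proof (intro conjI ballI)
  have wW: "w_par G J \<in> W" using w_par_par[OF J] par_W[OF J] by blast
  thus "w0 \<circ> w_par G J \<in> W" using w0_W W_comp by blast
  fix v assume v: "v \<in> par J"
  have pv: "w_par G J \<circ> v \<in> par J" using w_par_par[OF J] par_comp[OF J] v by blast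
  have "N (w_par G J \<circ> v) \<le> N (w_par G J)" using par_N_le[OF J pv] w_par_N[OF J] by simp
  thus "N (w0 \<circ> w_par G J) \<le> N (w0 \<circ> w_par G J \<circ> v)"
    using N_w0_comp[OF wW] N_w0_comp[OF par_W[OF J pv]] by (simp add: comp_assoc)
qed

text \<open>Writing w_0 = d v gives d = w_0 v^(-1), of length complementary to that of v^(-1).
  Minimality of d forces v^(-1) to be longest in the parabolic subgroup.\<close>

lemma d_par_eq: "d_par G J = w0 \<circ> w_par G J"
  unfolding d_par_def
proof (rule the_equality)
  let ?w = "w_par G J"
  have w: "?w \<in> par J" "?w \<circ> ?w = id" using w_par_par[OF J] w_par_invol[OF J] by auto
  have "w0 = w0 \<circ> ?w \<circ> ?w" using w by (simp add: comp_assoc)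
  thus "w0 \<circ> ?w \<in> min_coset_reps G J \<and> (\<exists>v\<in>par J. w0 = (w0 \<circ> ?w) \<circ> v)"
    using w0_w_par_min w by blast
  fix d assume "d \<in> min_coset_reps G J \<and> (\<exists>v\<in>par J. w0 = d \<circ> v)"
  then obtain v where d: "d \<in> W" "\<forall>v\<in>par J. N d \<le> N (d \<circ> v)" and v: "v \<in> par J" "w0 = d \<circ> v"
    using min_coset_reps_iff by blast
  have vW: "v \<in> W" "iv v \<in> par J" "iv v \<in> W" using v par_W[OF J] par_inv[OF J] by auto
  have dv: "d = w0 \<circ> iv v" using v vW by (simp add: comp_assoc W_inv_comp)
  have wW: "?w \<in> W" using w par_W[OF J] by blast
  have "N d \<le> N (d \<circ> (v \<circ> ?w))" using d(2) v(1) w(1) par_comp[OF J] by blast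
  moreover have "d \<circ> (v \<circ> ?w) = w0 \<circ> ?w" by (simp only: v(2) comp_assoc)
  ultimately have "N (w0 \<circ> iv v) \<le> N (w0 \<circ> ?w)" by (simp only: dv[symmetric])
  hence "card Pos - N (iv v) \<le> card Pos - N ?w" using N_w0_comp vW wW by simp
  hence "N ?w \<le> N (iv v)" using W_N_le[OF vW(3)] W_N_le[OF wW] by linarith
  hence "N (iv v) = card (PosJ J)" using w_par_N[OF J] par_N_le[OF J vW(2)] by simp
  hence "iv v = ?w" using longest_unique[OF J vW(2) _ w_par_par[OF J] w_par_N[OF J]] by blast
  thus "d = w0 \<circ> ?w" using dv by simp
qed

text \<open>d_J is the only minimal representative of its length, so every other Schubert class lies
  in a different degree. As \<open>d\<close> keeps the subsystem positive, \<open>PosJ J\<close> and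
  the w_J-image of \<open>Inv d\<close> are disjoint sets of inversions of d w_J; their number
  forces d w_J = w_0.\<close>

lemma min_coset_max:
  assumes "d \<in> min_coset_reps G J" "N d = card Pos - card (PosJ J)"
  shows "d = d_par G J"
proof -
  let ?w = "w_par G J"
  have d: "d \<in> W" using assms min_coset_reps_iff by blast
  have w: "?w \<in> par J" "?w \<in> W" using w_par_par[OF J] par_W[OF J] by auto
  have dpos: "act d \<beta> \<in> Pos" if b: "\<beta> \<in> PosJ J" for \<beta>
  proof -
    have dW: "w0 \<circ> d \<in> W" using d w0_W W_comp by blast
    \<comment> \<open>\<open>neg_all\<close> propagates negativity, so it is applied after
      multiplication by w_0, which exchanges the signs.\<close>
    have "act (w0 \<circ> d) \<alpha> \<notin> Pos" if "\<alpha> \<in> J" for \<alpha>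
      using min_coset_pos[OF assms(1) that] w0_pos_iff pos_root d w0_W by (simp add: act_comp)
    from neg_all[OF dW this b J] have "act w0 (act d \<beta>) \<notin> Pos" using d w0_W by (simp add: act_comp)
    thus ?thesis using w0_pos_iff b PosJ_roots d act_roots by blast
  qed
  have dis: "Inv d \<inter> PosJ J = {}" using dpos by (auto simp: Inv_def)
  have "PosJ J \<union> act ?w ` Inv d \<subseteq> Inv (d \<circ> ?w)"
  proof
    fix \<beta> assume "\<beta> \<in> PosJ J \<union> act ?w ` Inv d"
    thus "\<beta> \<in> Inv (d \<circ> ?w)"
    proof
      assume b: "\<beta> \<in> PosJ J"
      hence "act ?w \<beta> \<notin> Pos" using w_par_Inv[OF J] by (auto simp: Inv_def)
      hence "- act ?w \<beta> \<in> PosJ J" using par_PosJ[OF J w(1) b] PosJ_Pos by blast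
      hence "act d (- act ?w \<beta>) \<in> Pos" by (rule dpos)
      hence "act (d \<circ> ?w) \<beta> \<notin> Pos" using d w pos_not_neg[of "- act d (act ?w \<beta>)"] by (auto simp: act_comp act_neg)
      thus ?thesis using PosJ_Pos[OF b] by (simp add: Inv_def)
    next
      assume "\<beta> \<in> act ?w ` Inv d"
      then obtain \<gamma> where g: "\<gamma> \<in> Inv d" "\<beta> = act ?w \<gamma>" by blast
      hence "\<gamma> \<in> Pos - PosJ J" using dis by (auto simp: Inv_def)
      hence "\<beta> \<in> Pos" using par_compl[OF J w(1)] g by blast
      moreover have "act ?w \<beta> = \<gamma>" using act_comp[OF w(2) w(2), of \<gamma>] w_par_invol[OF J] g by simp
      ultimately show ?thesis using g d w by (simp add: Inv_def act_comp)
    qed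
  qed
  moreover have "PosJ J \<inter> act ?w ` Inv d = {}"
    using par_compl[OF J w(1)] dis unfolding Inv_def by blast
  moreover have "card (act ?w ` Inv d) = card (Inv d)"
    by (rule card_image) (use w act_eq_iff in \<open>auto simp: inj_on_def\<close>)
  ultimately have "card (PosJ J) + N d \<le> N (d \<circ> ?w)"
    unfolding N_def using card_mono[OF finite_Inv] card_Un_disjoint[OF finite_PosJ finite_imageI[OF finite_Inv]] by metis
  moreover have "card (PosJ J) \<le> card Pos" using card_mono[OF finite_pos] PosJ_Pos by (simp add: subset_iff)
  ultimately have "N (d \<circ> ?w) = card Pos" using assms(2) W_N_le[of "d \<circ> ?w"] d w W_comp by force
  hence "d \<circ> ?w = w0" using W_N_max d w W_comp by blast
  hence "d \<circ> (?w \<circ> ?w) = w0 \<circ> ?w" by (simp add: comp_assoc[symmetric])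
  thus ?thesis using w_par_invol[OF J] d_par_eq by simp
qed

end

subsection \<open>The sign character\<close>

text \<open>The determinant character, expressed through the parity of the inversion number;
  complex-valued so that it can be a scalar in antisymmetrisations.\<close>

definition weyl_sign :: "('h \<Rightarrow> 'h) \<Rightarrow> complex" where
  "weyl_sign w = (-1) ^ N w"

lemma weyl_sign_id [simp]: "weyl_sign id = 1"
  by (simp add: weyl_sign_def)

lemma weyl_sign_refl: "w \<in> W \<Longrightarrow> \<alpha> \<in> \<Delta> \<Longrightarrow> weyl_sign (s \<alpha> \<circ> w) = - weyl_sign w"
  using N_simple[of w \<alpha>] by (cases "act (iv w) \<alpha> \<in> Pos") (auto simp: weyl_sign_def)

lemma weyl_sign_comp:
  assumes "u \<in> W" "v \<in> W"
  shows "weyl_sign (u \<circ> v) = weyl_sign u * weyl_sign v"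
proof -
  have "u \<in> generated_by G \<Delta>" using assms W_par by (simp add: parabolic_def)
  thus ?thesis
  proof (induction rule: gen_induct)
    case id
    show ?case by (simp only: id_comp weyl_sign_id mult_1)
  next
    case (refl \<alpha> w)
    hence "w \<in> W" by (simp add: W_par parabolic_def)
    thus ?case using refl assms weyl_sign_refl[of "w \<circ> v" \<alpha>] weyl_sign_refl[of w \<alpha>] by (simp add: comp_assoc W_comp)
  qed
qed

lemma weyl_sign_square: "weyl_sign w * weyl_sign w = 1"
  by (simp add: weyl_sign_def flip: power_mult_distrib)

lemma weyl_sign_root_refl:
  assumes "J \<subseteq> \<Delta>" "\<beta> \<in> PosJ J"
  shows "weyl_sign (s \<beta>) = -1"
proof -
  obtain v \<alpha> where v: "v \<in> W" "\<alpha> \<in> \<Delta>" "\<alpha> \<in> \<Phi>" "\<beta> = act v \<alpha>"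
    using PosJ_conj[OF assms] par_W[OF assms(1)] assms(1) simple_sub by blast
  have "weyl_sign (s \<beta>) = weyl_sign v * weyl_sign (s \<alpha>) * weyl_sign (iv v)"
    using v refl_act[OF order_refl v(1,3)] by (simp add: weyl_sign_comp W_comp W_refl W_inv)
  also have "weyl_sign (iv v) = weyl_sign v" using N_iv[OF v(1)] by (simp add: weyl_sign_def)
  also have "weyl_sign (s \<alpha>) = -1" using weyl_sign_refl[OF W_id v(2)] by simp
  finally show ?thesis using weyl_sign_square[of v] by simp
qed

definition piJ :: "('h \<Rightarrow> complex) set \<Rightarrow> 'h \<Rightarrow> complex" where
  "piJ J = (\<Prod>\<beta>\<in>PosJ J. \<beta>)"

lemma piJ_sp: "piJ J \<in> sym_power G (card (PosJ J))"
  unfolding piJ_def using finite_PosJ PosJ_roots root_dual by (intro sp_prod) auto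

lemma piJ_R: "piJ J \<in> R"
  using piJ_sp sp_R by blast

lemma piJ_nonzero: "piJ J \<noteq> 0"
  unfolding piJ_def
proof (rule R_prod_nonzero[OF finite_PosJ])
  fix \<beta> assume "\<beta> \<in> PosJ J"
  hence "\<beta> \<in> \<Phi>" using PosJ_roots by blast
  thus "\<beta> \<in> R" "\<beta> \<noteq> 0" using R_dual root_dual root_nonzero by blast+
qed

text \<open>A reflection in a letter \<alpha> of \<open>J\<close> permutes the other positive roots
  of the subsystem and negates \<alpha>, so it changes the sign of the product.\<close>

lemma act_piJ:
  assumes "J \<subseteq> \<Delta>" "w \<in> par J"
  shows "act w (piJ J) = fscale (weyl_sign w) (piJ J)"
  using assms(2) unfolding parabolic_def
proof (induction rule: gen_induct)
  case id
  show ?case by (simp only: act_id weyl_sign_id fscale_one)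
next
  case (refl \<alpha> w)
  have a: "\<alpha> \<in> \<Delta>" "\<alpha> \<in> \<Phi>" "\<alpha> \<in> PosJ J" using refl assms(1) simple_sub J_PosJ[OF assms(1)] by blast+
  have wW: "w \<in> W" using refl(2) par_W[OF assms(1)] by (simp add: parabolic_def)
  have inv: "act (s \<alpha>) (act (s \<alpha>) \<beta>) = \<beta>" for \<beta>
    using act_comp[OF W_refl W_refl, of \<alpha> \<alpha> \<beta>] a refl_invol by simp
  have ne: "act (s \<alpha>) \<beta> \<noteq> \<alpha>" if "\<beta> \<in> PosJ J" for \<beta>
  proof
    assume "act (s \<alpha>) \<beta> = \<alpha>"
    hence "\<beta> = - \<alpha>" using inv[of \<beta>] act_refl_self[OF a(2)] by simp
    thus False using that a(3) PosJ_Pos pos_not_neg by blast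
  qed
  have bij: "bij_betw (act (s \<alpha>)) (PosJ J - {\<alpha>}) (PosJ J - {\<alpha>})"
    by (rule bij_betw_byWitness[where f' = "act (s \<alpha>)"])
       (use inv ne refl_PosJ[OF assms(1) _ refl(1)] in auto)
  have "act (s \<alpha>) (piJ J) = (\<Prod>\<beta>\<in>PosJ J. act (s \<alpha>) \<beta>)" by (simp add: piJ_def act_prod)
  also have "\<dots> = act (s \<alpha>) \<alpha> * (\<Prod>\<beta>\<in>PosJ J - {\<alpha>}. act (s \<alpha>) \<beta>)"
    using prod.remove[OF finite_PosJ a(3)] by blast
  also have "(\<Prod>\<beta>\<in>PosJ J - {\<alpha>}. act (s \<alpha>) \<beta>) = (\<Prod>\<beta>\<in>PosJ J - {\<alpha>}. \<beta>)"
    using prod.reindex_bij_betw[OF bij, of "\<lambda>\<beta>. \<beta>"] .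
  also have "act (s \<alpha>) \<alpha> * \<dots> = - (\<alpha> * (\<Prod>\<beta>\<in>PosJ J - {\<alpha>}. \<beta>))"
    by (simp add: act_refl_self a)
  also have "\<dots> = - piJ J"
    unfolding piJ_def using prod.remove[OF finite_PosJ a(3), of "\<lambda>\<beta>. \<beta>"] by simp
  finally have "act (s \<alpha>) (piJ J) = - piJ J" .
  thus ?case using refl(3) wW a weyl_sign_refl[OF wW a(1)]
    by (simp add: act_comp W_refl act_scale fs.scale_minus_left fs.scale_minus_right)
qed

subsection \<open>Demazure operators\<close>

abbreviation "dem \<equiv> demazure_simple G"

text \<open>Gives the definite description in \<open>demazure_simple\<close> its value: existence is
  \<open>shear_divisible_R\<close> with \<open>c = 1\<close>, uniqueness is cancellation of \<alpha>
  in \<open>R\<close>.\<close>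

lemma dem_spec:
  assumes "\<alpha> \<in> \<Phi>" "f \<in> R"
  shows "dem \<alpha> f \<in> R \<and> \<alpha> * dem \<alpha> f = f - act (s \<alpha>) f"
proof -
  obtain g where g: "g \<in> R" "f - (f \<circ> shear 1 \<alpha>) = \<alpha> * g" using shear_divisible_R assms by blast
  have "\<exists>!g. g \<in> R \<and> \<alpha> * g = f - act (s \<alpha>) f"
  proof (rule ex1I[of _ g])
    show "g \<in> R \<and> \<alpha> * g = f - act (s \<alpha>) f"
      using g act_refl[OF assms(1)] reflection_shear by metis
    fix h assume h: "h \<in> R \<and> \<alpha> * h = f - act (s \<alpha>) f"
    have "\<alpha> * h = \<alpha> * g" using h g act_refl[OF assms(1)] reflection_shear by metis
    thus "h = g" using R_cancel[OF R_dual[OF root_dual[OF assms(1)]] root_nonzero[OF assms(1)]] h g(1) by blast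
  qed
  from theI'[OF this] show ?thesis unfolding demazure_simple_def .
qed

lemmas dem_R = dem_spec[THEN conjunct1] and dem_mult = dem_spec[THEN conjunct2]

text \<open>The working tool for identities between Demazure operators: they are checked after
  multiplication by \<alpha>.\<close>

lemma dem_eqI:
  assumes "\<alpha> \<in> \<Phi>" "f \<in> R" "g \<in> R" "\<alpha> * g = f - act (s \<alpha>) f"
  shows "dem \<alpha> f = g"
proof (rule R_cancel[OF R_dual[OF root_dual[OF assms(1)]] root_nonzero[OF assms(1)] dem_R[OF assms(1,2)] assms(3)])
  show "\<alpha> * dem \<alpha> f = \<alpha> * g" by (simp only: dem_mult[OF assms(1,2)] assms(4))
qed

lemma dem_sp:
  assumes "\<alpha> \<in> \<Phi>" "f \<in> sym_power G k"
  shows "if k = 0 then dem \<alpha> f = 0 else dem \<alpha> f \<in> sym_power G (k - 1)"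
proof -
  obtain g where g: "if k = 0 then g = 0 else g \<in> sym_power G (k - 1)" "f - (f \<circ> shear 1 \<alpha>) = \<alpha> * g"
    using shear_divisible[OF assms] by blast
  have gR: "g \<in> R" using g(1) sp_R R_zero by metis
  have "\<alpha> * g = f - act (s \<alpha>) f" using g(2) act_refl[OF assms(1)] reflection_shear by metis
  hence "dem \<alpha> f = g" using dem_eqI[OF assms(1) sp_R[OF assms(2)] gR] by blast
  thus ?thesis using g(1) by metis
qed

lemma dem_add: "\<alpha> \<in> \<Phi> \<Longrightarrow> f \<in> R \<Longrightarrow> g \<in> R \<Longrightarrow> dem \<alpha> (f + g) = dem \<alpha> f + dem \<alpha> g"
  by (rule dem_eqI) (simp_all add: R_add dem_R distrib_left dem_mult act_add)

lemma dem_diff: "\<alpha> \<in> \<Phi> \<Longrightarrow> f \<in> R \<Longrightarrow> g \<in> R \<Longrightarrow> dem \<alpha> (f - g) = dem \<alpha> f - dem \<alpha> g"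
  by (rule dem_eqI) (simp_all add: R_diff dem_R right_diff_distrib dem_mult act_diff)

lemma dem_scale: "\<alpha> \<in> \<Phi> \<Longrightarrow> f \<in> R \<Longrightarrow> dem \<alpha> (fscale c f) = fscale c (dem \<alpha> f)"
  by (rule dem_eqI) (simp_all add: R_scale dem_R fscale_mult_right dem_mult act_scale fs.scale_right_diff_distrib)

lemma dem_zero: "\<alpha> \<in> \<Phi> \<Longrightarrow> dem \<alpha> 0 = 0"
  by (rule dem_eqI) (simp_all add: R_zero act_zero)

lemma dem_const: "\<alpha> \<in> \<Phi> \<Longrightarrow> dem \<alpha> (\<lambda>_. c) = 0"
  by (rule dem_eqI) (simp_all add: R_zero R_const act_const)

lemma dem_sum: "\<alpha> \<in> \<Phi> \<Longrightarrow> (\<And>i. i \<in> A \<Longrightarrow> F i \<in> R) \<Longrightarrow> dem \<alpha> (\<Sum>i\<in>A. F i) = (\<Sum>i\<in>A. dem \<alpha> (F i))"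
  by (induction A rule: infinite_finite_induct) (auto simp: dem_zero dem_add R_sum)

lemma dem_leibniz:
  assumes "\<alpha> \<in> \<Phi>" "\<mu> \<in> dual_space G" "f \<in> R"
  shows "dem \<alpha> (\<mu> * f) = fscale (\<mu> (cor \<alpha>)) f + act (s \<alpha>) \<mu> * dem \<alpha> f"
proof (rule dem_eqI)
  show "\<mu> * f \<in> R" using assms R_dual_mult by blast
  have "act (s \<alpha>) \<mu> \<in> R" using assms by (intro act_R W_refl R_dual)
  thus "fscale (\<mu> (cor \<alpha>)) f + act (s \<alpha>) \<mu> * dem \<alpha> f \<in> R"
    using assms by (intro R_add R_scale R_mult dem_R)
  have "\<alpha> * (fscale (\<mu> (cor \<alpha>)) f + act (s \<alpha>) \<mu> * dem \<alpha> f) =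
     fscale (\<mu> (cor \<alpha>)) \<alpha> * f + act (s \<alpha>) \<mu> * (\<alpha> * dem \<alpha> f)"
    by (simp only: distrib_left fscale_mult_left fscale_mult_right mult.left_commute)
  also have "\<dots> = (\<mu> - act (s \<alpha>) \<mu>) * f + act (s \<alpha>) \<mu> * (f - act (s \<alpha>) f)"
    using assms by (simp only: dem_mult act_refl_dual diff_diff_eq2 add_diff_cancel_left')
  also have "\<dots> = \<mu> * f - act (s \<alpha>) (\<mu> * f)"
    by (simp only: act_mult left_diff_distrib right_diff_distrib) simp
  finally show "\<alpha> * (fscale (\<mu> (cor \<alpha>)) f + act (s \<alpha>) \<mu> * dem \<alpha> f) = \<mu> * f - act (s \<alpha>) (\<mu> * f)" .
qed (rule assms)

lemma act_refl_twice: "\<alpha> \<in> \<Phi> \<Longrightarrow> act (s \<alpha>) (act (s \<alpha>) f) = f"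
  using act_comp[OF W_refl W_refl, of \<alpha> \<alpha> f] refl_invol[of \<alpha>] by simp

text \<open>An antisymmetric function divided by the antisymmetric \<alpha> is symmetric. Both
  \<open>dem_fixed\<close> and the self-adjointness \<open>tr_dem\<close> are instances.\<close>

lemma refl_quotient_fixed:
  assumes "\<alpha> \<in> \<Phi>" "h \<in> R" "act (s \<alpha>) (\<alpha> * h) = - (\<alpha> * h)"
  shows "act (s \<alpha>) h = h"
proof (rule R_cancel[OF R_dual[OF root_dual[OF assms(1)]] root_nonzero[OF assms(1)] act_R[OF W_refl[OF assms(1)] assms(2)] assms(2)])
  have "- (\<alpha> * act (s \<alpha>) h) = - (\<alpha> * h)" 
    using assms(3) by (simp only: act_mult act_refl_self[OF assms(1)] mult_minus_left)
  thus "\<alpha> * act (s \<alpha>) h = \<alpha> * h" by (simp only: neg_equal_iff_equal)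
qed

lemma dem_fixed: "\<alpha> \<in> \<Phi> \<Longrightarrow> f \<in> R \<Longrightarrow> act (s \<alpha>) (dem \<alpha> f) = dem \<alpha> f"
  by (rule refl_quotient_fixed) (simp_all add: dem_R dem_mult act_diff act_refl_twice)

lemma dem_dem: "\<alpha> \<in> \<Phi> \<Longrightarrow> f \<in> R \<Longrightarrow> dem \<alpha> (dem \<alpha> f) = 0"
  by (rule dem_eqI) (simp_all add: dem_R dem_fixed R_zero)

subsection \<open>Antisymmetrisation and the trace\<close>

lemma finite_par: "J \<subseteq> \<Delta> \<Longrightarrow> finite (par J)"
  using finite_subset[OF _ finite_W] par_W by blast

definition antisym :: "('h \<Rightarrow> complex) set \<Rightarrow> ('h \<Rightarrow> complex) \<Rightarrow> 'h \<Rightarrow> complex" where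
  "antisym J f = (\<Sum>w\<in>par J. fscale (weyl_sign w) (act w f))"

lemma par_comp_bij:
  assumes "J \<subseteq> \<Delta>" "v \<in> par J"
  shows "bij_betw (\<lambda>w. v \<circ> w) (par J) (par J)" "bij_betw (\<lambda>w. w \<circ> v) (par J) (par J)"
proof -
  have v: "v \<in> W" "iv v \<in> par J" using assms par_W par_inv by blast+
  show "bij_betw (\<lambda>w. v \<circ> w) (par J) (par J)"
    by (rule bij_betw_byWitness[where f' = "\<lambda>w. iv v \<circ> w"])
       (use v assms par_comp[OF assms(1)] in \<open>auto simp: comp_assoc[symmetric] W_inv_comp\<close>)
  show "bij_betw (\<lambda>w. w \<circ> v) (par J) (par J)"
    by (rule bij_betw_byWitness[where f' = "\<lambda>w. w \<circ> iv v"])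
       (use v assms par_comp[OF assms(1)] in \<open>auto simp: comp_assoc W_inv_comp\<close>)
qed

lemma antisym_R: "J \<subseteq> \<Delta> \<Longrightarrow> f \<in> R \<Longrightarrow> antisym J f \<in> R"
  unfolding antisym_def by (intro R_sum R_scale act_R par_W)

lemma antisym_sp: "J \<subseteq> \<Delta> \<Longrightarrow> f \<in> sym_power G k \<Longrightarrow> antisym J f \<in> sym_power G k"
  unfolding antisym_def by (intro sp_sum sp_scale act_sp par_W)

lemma antisym_add: "antisym J (f + g) = antisym J f + antisym J g"
  by (simp add: antisym_def act_add fs.scale_right_distrib sum.distrib)

lemma antisym_scale: "antisym J (fscale c f) = fscale c (antisym J f)"
  unfolding antisym_def act_scale fs.scale_sum_right by (simp add: mult.commute)

lemma act_antisym:
  assumes "J \<subseteq> \<Delta>" "v \<in> par J"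
  shows "act v (antisym J f) = fscale (weyl_sign v) (antisym J f)"
proof -
  have vW: "v \<in> W" using assms par_W by blast
  have "antisym J f = (\<Sum>w\<in>par J. fscale (weyl_sign (v \<circ> w)) (act (v \<circ> w) f))"
    unfolding antisym_def by (rule sum.reindex_bij_betw[symmetric, OF par_comp_bij(1)[OF assms]])
  also have "\<dots> = (\<Sum>w\<in>par J. fscale (weyl_sign v) (fscale (weyl_sign w) (act v (act w f))))"
    by (rule sum.cong) (use vW par_W[OF assms(1)] in \<open>auto simp: weyl_sign_comp act_comp\<close>)
  also have "\<dots> = fscale (weyl_sign v) (act v (antisym J f))"
    by (simp only: antisym_def act_sum act_scale fs.scale_sum_right)
  finally have "antisym J f = fscale (weyl_sign v) (act v (antisym J f))" .
  hence "fscale (weyl_sign v) (antisym J f) = fscale (weyl_sign v) (fscale (weyl_sign v) (act v (antisym J f)))" by (rule arg_cong)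
  thus ?thesis by (simp add: weyl_sign_square)
qed

lemma antisym_act:
  assumes "J \<subseteq> \<Delta>" "v \<in> par J"
  shows "antisym J (act v f) = fscale (weyl_sign v) (antisym J f)"
proof -
  have vW: "v \<in> W" using assms par_W by blast
  have "antisym J f = (\<Sum>w\<in>par J. fscale (weyl_sign (w \<circ> v)) (act (w \<circ> v) f))"
    unfolding antisym_def by (rule sum.reindex_bij_betw[symmetric, OF par_comp_bij(2)[OF assms]])
  also have "\<dots> = (\<Sum>w\<in>par J. fscale (weyl_sign v) (fscale (weyl_sign w) (act w (act v f))))"
    by (rule sum.cong) (use vW par_W[OF assms(1)] in \<open>auto simp: weyl_sign_comp act_comp mult.commute\<close>)
  also have "\<dots> = fscale (weyl_sign v) (antisym J (act v f))"
    by (simp only: antisym_def fs.scale_sum_right)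
  finally have "antisym J f = fscale (weyl_sign v) (antisym J (act v f))" .
  hence "fscale (weyl_sign v) (antisym J f) = fscale (weyl_sign v) (fscale (weyl_sign v) (antisym J (act v f)))" by (rule arg_cong)
  thus ?thesis by (simp add: weyl_sign_square)
qed

text \<open>The reflection in a root of \<open>PosJ J\<close> belongs to the subgroup and has sign
  -1, so twice the antisymmetrisation is a difference f - s f and divisible by that root.
  \<open>prod_roots_dvd\<close> collects the roots.\<close>

lemma antisym_div:
  assumes "J \<subseteq> \<Delta>" "f \<in> R"
  shows "\<exists>g\<in>R. antisym J f = piJ J * g"
  unfolding piJ_def
proof (rule prod_roots_dvd[OF finite_PosJ PosJ_roots])
  show "antisym J f \<in> R" by (rule antisym_R[OF assms])
  fix \<beta> assume b: "\<beta> \<in> PosJ J"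
  show "- \<beta> \<notin> PosJ J" using b PosJ_Pos pos_not_neg by blast
  have bR: "\<beta> \<in> \<Phi>" using b PosJ_roots by blast
  obtain h where h: "h \<in> R" "antisym J f - (antisym J f \<circ> shear 1 \<beta>) = \<beta> * h"
    using shear_divisible_R[OF bR antisym_R[OF assms]] by blast
  have "antisym J f \<circ> shear 1 \<beta> = fscale (-1) (antisym J f)"
    using act_antisym[OF assms(1) refl_par[OF assms(1) b], of f] weyl_sign_root_refl[OF assms(1) b] act_refl[OF bR, of "antisym J f"]
    by (simp add: reflection_shear)
  hence "\<beta> * h = fscale 2 (antisym J f)" using h(2) by (auto simp: fun_eq_iff pointwise)
  hence "antisym J f = \<beta> * fscale (1/2) h" by (simp add: fscale_mult_right)
  thus "\<exists>h\<in>R. antisym J f = \<beta> * h" using R_scale[OF h(1)] by blast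
qed

text \<open>Antisymmetrisation over \<open>W\<close> divided by the product of the positive roots is
  the classical formula for the Demazure operator of the longest element; tr takes its value at the
  origin.\<close>

definition tr :: "('h \<Rightarrow> complex) \<Rightarrow> complex" where
  "tr f = (THE g. g \<in> R \<and> antisym \<Delta> f = piJ \<Delta> * g) 0"

lemma tr_eqI:
  assumes "g \<in> R" "antisym \<Delta> f = piJ \<Delta> * g"
  shows "tr f = g 0"
proof -
  have "(THE g. g \<in> R \<and> antisym \<Delta> f = piJ \<Delta> * g) = g"
  proof (rule the_equality)
    fix h assume h: "h \<in> R \<and> antisym \<Delta> f = piJ \<Delta> * h"
    have "piJ \<Delta> * h = piJ \<Delta> * g" using h assms(2) by metis
    thus "h = g" using R_cancel[OF piJ_R piJ_nonzero] h assms(1) by blast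
  qed (use assms in blast)
  thus ?thesis by (simp add: tr_def)
qed

lemma tr_ex: "f \<in> R \<Longrightarrow> \<exists>g\<in>R. antisym \<Delta> f = piJ \<Delta> * g \<and> tr f = g 0"
  using antisym_div[OF order_refl] tr_eqI by metis

lemma tr_add:
  assumes "f \<in> R" "g \<in> R"
  shows "tr (f + g) = tr f + tr g"
proof -
  obtain u v where u: "u \<in> R" "antisym \<Delta> f = piJ \<Delta> * u" "tr f = u 0" and v: "v \<in> R" "antisym \<Delta> g = piJ \<Delta> * v" "tr g = v 0"
    using assms tr_ex by meson
  have "tr (f + g) = (u + v) 0"
    by (rule tr_eqI[OF R_add[OF u(1) v(1)]]) (simp only: antisym_add u v distrib_left)
  thus ?thesis using u v by (simp add: pointwise)
qed

lemma tr_scale: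
  assumes "f \<in> R"
  shows "tr (fscale c f) = c * tr f"
proof -
  obtain u where u: "u \<in> R" "antisym \<Delta> f = piJ \<Delta> * u" "tr f = u 0"
    using assms tr_ex by meson
  have "tr (fscale c f) = (fscale c u) 0"
    by (rule tr_eqI[OF R_scale[OF u(1)]]) (simp only: antisym_scale u fscale_mult_right)
  thus ?thesis using u by (simp add: pointwise)
qed

lemma tr_zero: "tr 0 = 0"
  using tr_scale[OF R_zero, of 0] by simp

lemma tr_neg: "f \<in> R \<Longrightarrow> tr (- f) = - tr f"
  using tr_scale[of f "-1"] fs.scale_minus_left[of 1 f] by simp

lemma tr_diff: "f \<in> R \<Longrightarrow> g \<in> R \<Longrightarrow> tr (f - g) = tr f - tr g"
  using tr_add[of f "- g"] tr_neg[of g] R_neg[of g] by simp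

lemma tr_sum: "(\<And>i. i \<in> A \<Longrightarrow> F i \<in> R) \<Longrightarrow> tr (\<Sum>i\<in>A. F i) = (\<Sum>i\<in>A. tr (F i))"
  by (induction A rule: infinite_finite_induct) (auto simp: tr_zero tr_add R_sum)

lemma tr_act:
  assumes "f \<in> R" "w \<in> W"
  shows "tr (act w f) = weyl_sign w * tr f"
proof -
  obtain u where u: "u \<in> R" "antisym \<Delta> f = piJ \<Delta> * u" "tr f = u 0"
    using assms tr_ex by meson
  have w: "w \<in> par \<Delta>" using assms W_par by blast
  have "tr (act w f) = (fscale (weyl_sign w) u) 0"
    by (rule tr_eqI[OF R_scale[OF u(1)]]) (simp only: antisym_act[OF order_refl w] u fscale_mult_right)
  thus ?thesis using u by (simp add: pointwise)
qed

lemma tr_fixed: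
  assumes "f \<in> R" "\<alpha> \<in> \<Delta>" "act (s \<alpha>) f = f"
  shows "tr f = 0"
proof -
  have "\<alpha> \<in> \<Phi>" using assms simple_sub by blast
  moreover have "weyl_sign (s \<alpha>) = -1" using weyl_sign_refl[OF W_id assms(2)] by simp
  ultimately have "tr f = - tr f" using tr_act[OF assms(1) W_refl, of \<alpha>] assms(3) by simp
  thus ?thesis by simp
qed

text \<open>Along a line through the origin the antisymmetrisation is a monomial of degree
  \<open>k\<close>, and also t^m times the quotient, where m is the number of positive roots. For k
  different from m the quotient has no constant coefficient.\<close>

lemma tr_homog:
  assumes "f \<in> sym_power G k" "k \<noteq> card Pos"
  shows "tr f = 0"
proof -
  obtain g where g: "g \<in> R" "antisym \<Delta> f = piJ \<Delta> * g" "tr f = g 0" using tr_ex sp_R assms(1) by blast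
  obtain x where x: "piJ \<Delta> x \<noteq> 0" using piJ_nonzero[of \<Delta>] by (auto simp: fun_eq_iff pointwise)
  obtain p where p: "\<And>t. g (0 + hsc t x) = poly p t" using R_line[OF g(1)] by blast
  have "poly (Polynomial.monom 1 (card Pos) * p) t = poly (Polynomial.monom (g x) k) t" for t
  proof -
    have "t ^ card Pos * piJ \<Delta> x * poly p t = (piJ \<Delta> * g) (hsc t x)"
      using sp_scaling[OF piJ_sp[of \<Delta>], of t x] p[of t] by (simp add: pointwise PosJ_simple)
    also have "\<dots> = t ^ k * (piJ \<Delta> x * g x)"
      using sp_scaling[OF antisym_sp[OF order_refl assms(1)], of t x] g(2) by (simp add: pointwise)
    finally show ?thesis using x by (simp add: poly_monom)
  qed
  hence "Polynomial.monom 1 (card Pos) * p = Polynomial.monom (g x) k" 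
    by (subst poly_eq_poly_eq_iff[symmetric]) (rule ext)
  hence "coeff (Polynomial.monom 1 (card Pos) * p) (card Pos) = coeff (Polynomial.monom (g x) k) (card Pos)"
    by simp
  hence "coeff p 0 = 0" using assms(2) by (simp add: coeff_monom_mult)
  thus ?thesis using g(3) p[of 0] by (simp add: poly_0_coeff_0)
qed

text \<open>Multiplying the difference of the two arguments by \<alpha> gives f (s g) - (s f) g,
  which is antisymmetric under s. The difference itself is then s-invariant, and invariants of a
  simple reflection have trace zero.\<close>

lemma tr_dem:
  assumes "\<alpha> \<in> \<Delta>" "f \<in> R" "g \<in> R"
  shows "tr (dem \<alpha> f * g) = tr (f * dem \<alpha> g)"
proof -
  have a: "\<alpha> \<in> \<Phi>" using assms simple_sub by blast
  let ?h = "dem \<alpha> f * g - f * dem \<alpha> g"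
  have hR: "dem \<alpha> f * g \<in> R" "f * dem \<alpha> g \<in> R" using assms a by (auto intro: R_mult dem_R)
  have "\<alpha> * ?h = (\<alpha> * dem \<alpha> f) * g - f * (\<alpha> * dem \<alpha> g)"
    by (simp only: right_diff_distrib mult.assoc mult.left_commute)
  also have "\<dots> = f * act (s \<alpha>) g - act (s \<alpha>) f * g"
    using a assms by (simp only: dem_mult) (simp add: left_diff_distrib right_diff_distrib)
  finally have e: "\<alpha> * ?h = f * act (s \<alpha>) g - act (s \<alpha>) f * g" .
  have "act (s \<alpha>) ?h = ?h"
    by (rule refl_quotient_fixed[OF a R_diff[OF hR]])
       (simp only: e act_diff act_mult act_refl_twice[OF a] minus_diff_eq)
  hence "tr ?h = 0" using tr_fixed[OF R_diff[OF hR] assms(1)] by blast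
  thus ?thesis using tr_diff[OF hR] by simp
qed

abbreviation "D \<equiv> top_poly G"

lemma D_eq: "D = fscale (1 / of_nat (card W)) (piJ \<Delta>)"
  by (simp add: top_poly_def piJ_def PosJ_simple)

lemma D_sp: "D \<in> sym_power G (card Pos)"
  unfolding D_eq using sp_scale piJ_sp[of \<Delta>] by (simp add: PosJ_simple)

lemma D_R: "D \<in> R"
  using D_sp sp_R by blast

lemma card_W: "card W \<noteq> 0"
  using finite_W W_id by auto

text \<open>\<open>D\<close> is antisymmetric, so antisymmetrising \<open>D * h\<close> yields the
  product of the positive roots times the average of \<open>h\<close>; the factor 1/|W| in
  \<open>D\<close> is exactly the one of the average.\<close>

lemma tr_D:
  assumes "h \<in> R"
  shows "tr (D * h) = h 0"
proof -
  let ?g = "fscale (1 / of_nat (card W)) (\<Sum>w\<in>W. act w h)"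
  have "antisym \<Delta> (D * h) = (\<Sum>w\<in>W. fscale (weyl_sign w) (act w (D * h)))" by (simp add: antisym_def W_par)
  also have "\<dots> = (\<Sum>w\<in>W. fscale (1 / of_nat (card W)) (piJ \<Delta> * act w h))"
  proof (rule sum.cong[OF refl])
    fix w assume w: "w \<in> W"
    have "act w (D * h) = fscale (1 / of_nat (card W)) (fscale (weyl_sign w) (piJ \<Delta>) * act w h)"
      using act_piJ[OF order_refl, of w] w by (simp add: W_par D_eq act_mult act_scale fscale_mult_left)
    thus "fscale (weyl_sign w) (act w (D * h)) = fscale (1 / of_nat (card W)) (piJ \<Delta> * act w h)"
      using weyl_sign_square[of w] by (simp add: fscale_mult_left mult.left_commute)
  qed
  also have "\<dots> = piJ \<Delta> * ?g"
    by (simp only: fs.scale_sum_right[symmetric] sum_distrib_left[symmetric] fscale_mult_right)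
  finally have "tr (D * h) = ?g 0"
    by (intro tr_eqI R_scale R_sum act_R assms)
  also have "\<dots> = h 0" using card_W by (simp add: pointwise act_at_zero)
  finally show ?thesis .
qed

text \<open>Invariants pass through the antisymmetrisation. Since the generators of the ideal vanish
  at the origin, they pair to zero with everything.\<close>

lemma tr_invariant_mult:
  assumes "g \<in> R" "f \<in> R" "\<And>w. w \<in> W \<Longrightarrow> act w g = g"
  shows "tr (g * f) = g 0 * tr f"
proof -
  obtain u where u: "u \<in> R" "antisym \<Delta> f = piJ \<Delta> * u" "tr f = u 0"
    using assms tr_ex by meson
  have "antisym \<Delta> (g * f) = (\<Sum>w\<in>W. g * fscale (weyl_sign w) (act w f))"
    unfolding antisym_def W_par[symmetric]
    by (rule sum.cong[OF refl]) (simp only: act_mult assms(3) fscale_mult_right)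
  also have "\<dots> = g * antisym \<Delta> f" by (simp only: antisym_def W_par[symmetric] sum_distrib_left)
  also have "\<dots> = piJ \<Delta> * (g * u)" by (simp only: u mult.left_commute)
  finally have "tr (g * f) = (g * u) 0" by (rule tr_eqI[OF R_mult[OF assms(1) u(1)]])
  thus ?thesis using u by (simp add: pointwise)
qed

section \<open>Averages over parabolic subgroups\<close>

definition av :: "('h \<Rightarrow> complex) set \<Rightarrow> ('h \<Rightarrow> complex) \<Rightarrow> 'h \<Rightarrow> complex" where
  "av J f = fscale (1 / of_nat (card (par J))) (\<Sum>w\<in>par J. act w f)"

lemma card_par: "J \<subseteq> \<Delta> \<Longrightarrow> card (par J) \<noteq> 0"
  using finite_par par_id by auto

lemma av_R: "J \<subseteq> \<Delta> \<Longrightarrow> f \<in> R \<Longrightarrow> av J f \<in> R"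
  unfolding av_def by (intro R_scale R_sum act_R par_W)

lemma av_sp: "J \<subseteq> \<Delta> \<Longrightarrow> f \<in> sym_power G k \<Longrightarrow> av J f \<in> sym_power G k"
  unfolding av_def by (intro sp_scale sp_sum act_sp par_W)

lemma av_add: "av J (f + g) = av J f + av J g"
  by (simp add: av_def act_add sum.distrib fs.scale_right_distrib)

lemma av_scale: "av J (fscale c f) = fscale c (av J f)"
  by (simp add: av_def act_scale fs.scale_sum_right mult.commute)

lemma av_zero: "av J 0 = 0"
  by (simp add: av_def act_zero)

lemma av_sum: "av J (\<Sum>i\<in>A. F i) = (\<Sum>i\<in>A. av J (F i))"
  by (induction A rule: infinite_finite_induct) (auto simp: av_zero av_add)

lemma av_act:
  assumes "J \<subseteq> \<Delta>" "v \<in> par J"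
  shows "act v (av J f) = av J f"
proof -
  have "act v (av J f) = fscale (1 / of_nat (card (par J))) (\<Sum>w\<in>par J. act (v \<circ> w) f)"
    unfolding av_def act_scale act_sum using par_W[OF assms(1)] assms(2) by (simp add: act_comp)
  also have "(\<Sum>w\<in>par J. act (v \<circ> w) f) = (\<Sum>w\<in>par J. act w f)"
    by (rule sum.reindex_bij_betw[OF par_comp_bij(1)[OF assms]])
  finally show ?thesis by (simp add: av_def)
qed

lemma scale_card_par: "J \<subseteq> \<Delta> \<Longrightarrow> fscale (1 / of_nat (card (par J))) (\<Sum>w\<in>par J. f) = f"
  using card_par by (auto simp: fun_eq_iff pointwise)

subsection \<open>The coinvariant ideal\<close>

lemma sym_alg_sel [simp]: "monoid.mult (sym_alg G) = (*)" "add (sym_alg G) = (+)" "zero (sym_alg G) = 0" "one (sym_alg G) = 1"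
  by (simp_all add: sym_alg_def)

lemma cring_sym_alg: "cring (sym_alg G)"
proof (rule cringI)
  show "abelian_group (sym_alg G)"
  proof (rule abelian_groupI)
    fix f assume "f \<in> R"
    thus "\<exists>g\<in>R. g \<oplus>\<^bsub>sym_alg G\<^esub> f = \<zero>\<^bsub>sym_alg G\<^esub>"
      by (intro bexI[of _ "- f"]) (simp_all add: R_neg)
  qed (simp_all add: R_add R_zero add_ac)
  show "comm_monoid (sym_alg G)"
    by (rule comm_monoidI) (simp_all add: R_mult R_one mult_ac)
qed (simp add: distrib_right)

abbreviation "I \<equiv> coinv_ideal G"

definition gens :: "('h \<Rightarrow> complex) set" where
  "gens = {f. \<exists>m>0. f \<in> sym_graded G m \<and> (\<forall>w\<in>W. act w f = f)}"

lemma I_eq: "I = genideal (sym_alg G) gens"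
  by (simp add: coinv_ideal_def gens_def)

lemma gens_cases: "f \<in> gens \<Longrightarrow> f \<in> R \<and> f 0 = 0 \<and> (\<forall>w\<in>W. act w f = f)"
proof -
  assume "f \<in> gens"
  then obtain m where m: "m > 0" "f \<in> sym_graded G m" "\<forall>w\<in>W. act w f = f" by (auto simp: gens_def)
  show ?thesis
  proof (cases "even m")
    case True
    hence "f \<in> sym_power G (m div 2)" "m div 2 > 0" using m by (auto simp: sym_graded_def)
    thus ?thesis using m(3) sp_R sp_at_zero by blast
  next
    case False
    hence "f = 0" using m(2) by (simp add: sym_graded_def)
    thus ?thesis using m(3) R_zero by (simp add: pointwise)
  qed
qed

lemma gensI:
  assumes "f \<in> sym_power G k" "k > 0" "\<And>w. w \<in> W \<Longrightarrow> act w f = f"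
  shows "f \<in> gens"
  unfolding gens_def using assms by (intro CollectI exI[of _ "2 * k"]) (simp add: sym_graded_def)

lemma ideal_I: "ideal I (sym_alg G)"
  unfolding I_eq using ring.genideal_ideal[OF cring.axioms(1)[OF cring_sym_alg]] gens_cases by blast

lemma gens_I: "f \<in> gens \<Longrightarrow> f \<in> I"
  unfolding I_eq using ring.genideal_self[OF cring.axioms(1)[OF cring_sym_alg]] gens_cases by blast

text \<open>Induction over the ideal in terms of pointwise operations; closure under negation comes
  from multiplication by -1 in \<open>R\<close>.\<close>

lemma I_minimal:
  assumes "K \<subseteq> R" "0 \<in> K" "\<And>f g. f \<in> K \<Longrightarrow> g \<in> K \<Longrightarrow> f + g \<in> K"
    "\<And>f g. f \<in> K \<Longrightarrow> g \<in> R \<Longrightarrow> g * f \<in> K" "gens \<subseteq> K"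
  shows "I \<subseteq> K"
  unfolding I_eq
proof (rule ring.genideal_minimal[OF cring.axioms(1)[OF cring_sym_alg] _ assms(5)])
  have neg: "- f \<in> K" if "f \<in> K" for f using assms(4)[OF that R_neg[OF R_one]] by simp
  have minv: "inv\<^bsub>add_monoid (sym_alg G)\<^esub> f = - f" if "f \<in> K" for f
  proof -
    have gr: "Group.group (add_monoid (sym_alg G))"
      using abelian_group.a_group ring.is_abelian_group cring.axioms(1)[OF cring_sym_alg] by blast
    show ?thesis
      by (rule group.inv_equality[OF gr]) (use that neg assms(1) in auto)
  qed
  show "ideal K (sym_alg G)"
  proof (rule idealI[OF cring.axioms(1)[OF cring_sym_alg]])
    show "subgroup K (add_monoid (sym_alg G))"
      by (rule subgroup.intro) (use assms minv neg in auto)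
    show "x \<otimes>\<^bsub>sym_alg G\<^esub> a \<in> K" "a \<otimes>\<^bsub>sym_alg G\<^esub> x \<in> K" if "a \<in> K" "x \<in> R" for a x
      using assms(4) that by (simp_all add: mult.commute)
  qed
qed

lemma I_R: "f \<in> I \<Longrightarrow> f \<in> R"
  using ideal.Icarr[OF ideal_I] by blast

lemma I_add: "f \<in> I \<Longrightarrow> g \<in> I \<Longrightarrow> f + g \<in> I"
  using additive_subgroup.a_closed[OF ideal.axioms(1)[OF ideal_I]] by simp

lemma I_zero: "0 \<in> I"
  using additive_subgroup.zero_closed[OF ideal.axioms(1)[OF ideal_I]] by simp

lemma I_mult: "f \<in> I \<Longrightarrow> g \<in> R \<Longrightarrow> g * f \<in> I"
  using ideal.I_l_closed[OF ideal_I] by simp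

lemma I_scale: "f \<in> I \<Longrightarrow> fscale c f \<in> I"
  using I_mult[OF _ R_const[of c]] by (simp add: const_mult)

lemma I_diff: "f \<in> I \<Longrightarrow> g \<in> I \<Longrightarrow> f - g \<in> I"
  using I_add[of f "fscale (-1) g"] I_scale[of g "-1"] by (simp add: fs.scale_minus_left)

lemma I_sum: "(\<And>i. i \<in> A \<Longrightarrow> F i \<in> I) \<Longrightarrow> (\<Sum>i\<in>A. F i) \<in> I"
  by (induction A rule: infinite_finite_induct) (auto simp: I_zero I_add)

lemma act_I:
  assumes "w \<in> W" "f \<in> I"
  shows "act w f \<in> I"
proof -
  have "I \<subseteq> {f \<in> R. act w f \<in> I}"
  proof (rule I_minimal)
    show "gens \<subseteq> {f \<in> R. act w f \<in> I}" using gens_cases gens_I assms(1) by fastforce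
  qed (use assms(1) in \<open>auto simp: R_zero R_add R_mult act_zero act_add act_mult I_zero I_add I_mult act_R\<close>)
  thus ?thesis using assms(2) by blast
qed

lemma I_tr:
  assumes "f \<in> I" "g \<in> R"
  shows "tr (f * g) = 0"
proof -
  have "I \<subseteq> {f \<in> R. \<forall>g\<in>R. tr (f * g) = 0}"
  proof (rule I_minimal)
    show "gens \<subseteq> {f \<in> R. \<forall>g\<in>R. tr (f * g) = 0}" using gens_cases tr_invariant_mult by auto
    show "g * f \<in> {f \<in> R. \<forall>g\<in>R. tr (f * g) = 0}" if "f \<in> {f \<in> R. \<forall>g\<in>R. tr (f * g) = 0}" "g \<in> R" for f g
    proof -
      have "tr (g * f * k) = 0" if "k \<in> R" for k
      proof -
        have "g * f * k = f * (g * k)" by (simp only: mult_ac)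
        moreover have "tr (f * (g * k)) = 0" using \<open>f \<in> _\<close> R_mult[OF \<open>g \<in> R\<close> that] by blast
        ultimately show ?thesis by metis
      qed
      thus ?thesis using that R_mult by simp
    qed
  qed (auto simp: R_zero R_add tr_zero distrib_right tr_add R_mult)
  thus ?thesis using assms by blast
qed

lemma av_cong:
  assumes "J \<subseteq> \<Delta>" "\<And>w. w \<in> par J \<Longrightarrow> act w f - f \<in> I"
  shows "av J f - f \<in> I"
proof -
  have "av J f - f = fscale (1 / of_nat (card (par J))) (\<Sum>w\<in>par J. act w f - f)"
    unfolding sum_subtractf fs.scale_right_diff_distrib scale_card_par[OF assms(1)] by (simp only: av_def)
  thus ?thesis using assms(2) by (simp add: I_scale I_sum)
qed

lemma av_I: "J \<subseteq> \<Delta> \<Longrightarrow> f \<in> I \<Longrightarrow> av J f \<in> I"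
  unfolding av_def by (intro I_scale I_sum act_I par_W)

text \<open>If all \<open>dem \<alpha> f\<close> lie in the ideal, then \<open>f\<close> is congruent to its average, an invariant.\<close>

lemma descent:
  assumes "\<And>f. L f \<Longrightarrow> f \<in> R" "\<And>f \<alpha>. L f \<Longrightarrow> \<alpha> \<in> \<Delta> \<Longrightarrow> L (dem \<alpha> f)" "\<And>f. L f \<Longrightarrow> f 0 = 0" "L f"
  shows "f \<in> I"
proof -
  \<comment> \<open>Induction on the number of components: a Demazure operator kills the constant
    component and shifts the others down by one.\<close>
  have main: "f \<in> I" if "L f" "\<And>k. F k \<in> sym_power G k" "f = (\<Sum>k<n. F k)" for n F f
    using that
  proof (induction n arbitrary: f F)
    case 0
    show ?case using I_zero 0(3) by simp
  next
    case (Suc n)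
    have fR: "f \<in> R" using assms(1) Suc by blast
    have FR: "F k \<in> R" for k using Suc(3) sp_R by blast
    have fdem: "dem \<alpha> f \<in> I" if a: "\<alpha> \<in> \<Delta>" for \<alpha>
    proof (rule Suc.IH)
      have a': "\<alpha> \<in> \<Phi>" using a simple_sub by blast
      show "L (dem \<alpha> f)" using assms(2) Suc(2) a by blast
      show "dem \<alpha> (F (Suc k)) \<in> sym_power G k" for k using dem_sp[OF a' Suc(3)[of "Suc k"]] by simp
      have "dem \<alpha> f = (\<Sum>k<Suc n. dem \<alpha> (F k))" unfolding Suc(4) by (rule dem_sum[OF a' FR])
      also have "\<dots> = dem \<alpha> (F 0) + (\<Sum>k<n. dem \<alpha> (F (Suc k)))" by (rule sum.lessThan_Suc_shift)
      also have "dem \<alpha> (F 0) = 0" using dem_sp[OF a' Suc(3)[of 0]] by simp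
      finally show "dem \<alpha> f = (\<Sum>k<n. dem \<alpha> (F (Suc k)))" by simp
    qed
    have fs: "f - act (s \<alpha>) f \<in> I" if a: "\<alpha> \<in> \<Delta>" for \<alpha>
    proof -
      have a': "\<alpha> \<in> \<Phi>" using a simple_sub by blast
      have "\<alpha> * dem \<alpha> f \<in> I" by (rule I_mult[OF fdem[OF a] R_dual[OF root_dual[OF a']]])
      thus ?thesis by (simp only: dem_mult[OF a' fR])
    qed
    \<comment> \<open>Only simple reflections are controlled by \<open>dem\<close>; a general
      element is reached by telescoping along a word, using that the group preserves the
      ideal.\<close>
    have fw: "f - act w f \<in> I" if "w \<in> W" for w
    proof -
      have "w \<in> generated_by G \<Delta>" using that W_par by (simp add: parabolic_def)
      thus ?thesis
      proof (induction rule: gen_induct)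
        case id
        show ?case unfolding act_id using I_zero by simp
      next
        case (refl \<alpha> w)
        have w: "w \<in> W" using refl(2) by (simp add: W_par parabolic_def)
        have a': "\<alpha> \<in> \<Phi>" using refl simple_sub by blast
        have "f - act (s \<alpha> \<circ> w) f = (f - act (s \<alpha>) f) + act (s \<alpha>) (f - act w f)"
          unfolding act_comp[OF W_refl[OF a'] w] act_diff by simp
        moreover have "(f - act (s \<alpha>) f) + act (s \<alpha>) (f - act w f) \<in> I"
          by (intro I_add fs refl(1) act_I W_refl a' refl(3))
        ultimately show ?case by metis
      qed
    qed
    \<comment> \<open>The average of a constant is that constant and not a generator, so the degree
      0 part has to vanish beforehand; this is the purpose of the third assumption on
      \<open>L\<close>.\<close>
    have "F 0 = 0"
    proof -
      obtain a where a: "F 0 = (\<lambda>_. a)" using Suc(3)[of 0] sym_power_0 by blast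
      have "f 0 = (\<Sum>k<Suc n. F k 0)" unfolding Suc(4) by (rule sum_fun_apply)
      also have "\<dots> = F 0 0 + (\<Sum>k<n. F (Suc k) 0)" by (rule sum.lessThan_Suc_shift)
      also have "(\<Sum>k<n. F (Suc k) 0) = 0" using sp_at_zero[OF Suc(3)] by simp
      finally have "a = 0" using assms(3)[OF Suc(2)] a by simp
      thus ?thesis using a by (simp add: zero_fun_def)
    qed
    have "av \<Delta> (F k) \<in> I" for k
    proof (cases "k = 0")
      case True
      thus ?thesis using \<open>F 0 = 0\<close> I_zero by (simp add: av_zero)
    next
      case False
      show ?thesis
        using False av_sp[OF order_refl Suc(3)] av_act[OF order_refl] by (intro gens_I gensI) (auto simp: W_par)
    qed
    hence "av \<Delta> f \<in> I" unfolding Suc(4) av_sum by (intro I_sum)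
    moreover have "av \<Delta> f - f \<in> I"
    proof (rule av_cong[OF order_refl])
      fix w assume "w \<in> par \<Delta>"
      hence "0 - (f - act w f) \<in> I" by (intro I_diff I_zero fw) (simp add: W_par)
      thus "act w f - f \<in> I" by simp
    qed
    ultimately have "av \<Delta> f - (av \<Delta> f - f) \<in> I" by (rule I_diff)
    thus ?case by simp
  qed
  obtain n F where "\<forall>k. F k \<in> sym_power G k" "f = (\<Sum>k<n. F k)" using R_decomp assms(1,4) by blast
  thus ?thesis using main[OF assms(4)] by blast
qed

text \<open>\<open>descent\<close> applies to the radical of the pairing: self-adjointness makes it
  stable under \<open>dem\<close>, and pairing with \<open>D\<close> shows that its members vanish
  at the origin.\<close>

lemma I_iff: "f \<in> I \<longleftrightarrow> f \<in> R \<and> (\<forall>g\<in>R. tr (f * g) = 0)"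
proof
  assume "f \<in> R \<and> (\<forall>g\<in>R. tr (f * g) = 0)"
  thus "f \<in> I"
  proof (rule descent[where L = "\<lambda>f. f \<in> R \<and> (\<forall>g\<in>R. tr (f * g) = 0)", rotated -1])
    fix f \<alpha> assume f: "f \<in> R \<and> (\<forall>g\<in>R. tr (f * g) = 0)"
    show "f 0 = 0" using tr_D[of f] f D_R by (simp add: mult.commute)
    assume a: "\<alpha> \<in> \<Delta>"
    have a': "\<alpha> \<in> \<Phi>" using a simple_sub by blast
    show "dem \<alpha> f \<in> R \<and> (\<forall>g\<in>R. tr (dem \<alpha> f * g) = 0)"
      using f tr_dem[OF a] dem_R[OF a'] by simp
  qed blast
qed (use I_R I_tr in blast)

lemma I_at_zero: "f \<in> I \<Longrightarrow> f 0 = 0"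
  using I_tr[OF _ D_R] tr_D[OF I_R] by (simp add: mult.commute)

lemma D_notin_I: "D \<notin> I"
  using I_tr[of D 1] tr_D[of 1] R_one by (auto simp: pointwise)

lemma dem_I: "\<alpha> \<in> \<Delta> \<Longrightarrow> f \<in> I \<Longrightarrow> dem \<alpha> f \<in> I"
  using simple_sub unfolding I_iff by (auto simp: tr_dem dem_R subset_iff)

text \<open>Products with such a function have no component in the one degree that tr detects. Hence
  only finitely many degrees survive in the quotient.\<close>

lemma sp_high_I:
  assumes "f \<in> sym_power G k" "k > card Pos"
  shows "f \<in> I"
  unfolding I_iff
proof (intro conjI ballI)
  show fR: "f \<in> R" using assms sp_R by blast
  fix g assume "g \<in> R"
  thus "tr (f * g) = 0"
  proof (induction rule: R_graded_induct)
    case (homog l g)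
    show ?case by (rule tr_homog[OF sp_mult[OF assms(1) homog]]) (use assms in simp)
  next
    case zero
    show ?case by (simp add: tr_zero)
  next
    case (add g h)
    thus ?case using fR by (simp add: distrib_left tr_add R_mult)
  qed
qed

subsection \<open>Compositions of Demazure operators\<close>

definition dem_word :: "('h \<Rightarrow> complex) list \<Rightarrow> ('h \<Rightarrow> complex) \<Rightarrow> 'h \<Rightarrow> complex" where
  "dem_word js = foldr dem js"

lemma dem_word_Nil [simp]: "dem_word [] f = f"
  and dem_word_Cons [simp]: "dem_word (\<alpha> # js) f = dem \<alpha> (dem_word js f)"
  and dem_word_append: "dem_word (js @ ks) f = dem_word js (dem_word ks f)"
  by (simp_all add: dem_word_def comp_apply)

lemma dem_word_R: "set js \<subseteq> \<Phi> \<Longrightarrow> f \<in> R \<Longrightarrow> dem_word js f \<in> R"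
  by (induction js) (simp_all add: dem_R)

lemma dem_word_add: "set js \<subseteq> \<Phi> \<Longrightarrow> f \<in> R \<Longrightarrow> g \<in> R \<Longrightarrow> dem_word js (f + g) = dem_word js f + dem_word js g"
  by (induction js) (simp_all add: dem_add dem_word_R)

lemma dem_word_diff: "set js \<subseteq> \<Phi> \<Longrightarrow> f \<in> R \<Longrightarrow> g \<in> R \<Longrightarrow> dem_word js (f - g) = dem_word js f - dem_word js g"
  by (induction js) (simp_all add: dem_diff dem_word_R)

lemma dem_word_scale: "set js \<subseteq> \<Phi> \<Longrightarrow> f \<in> R \<Longrightarrow> dem_word js (fscale c f) = fscale c (dem_word js f)"
  by (induction js) (simp_all add: dem_scale dem_word_R)

lemma dem_word_const: "set js \<subseteq> \<Phi> \<Longrightarrow> js \<noteq> [] \<Longrightarrow> dem_word js (\<lambda>_. c) = 0"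
proof (induction js)
  case (Cons \<alpha> js)
  thus ?case by (cases "js = []") (simp_all add: dem_const dem_zero)
qed simp

lemma dem_word_I: "set js \<subseteq> \<Delta> \<Longrightarrow> f \<in> I \<Longrightarrow> dem_word js f \<in> I"
  by (induction js) (simp_all add: dem_I)

lemma dem_word_sp:
  assumes "set js \<subseteq> \<Phi>" "f \<in> sym_power G k"
  shows "if k < length js then dem_word js f = 0 else dem_word js f \<in> sym_power G (k - length js)"
  using assms(1)
proof (induction js)
  case Nil
  thus ?case using assms(2) by simp
next
  case (Cons \<alpha> js)
  have a: "\<alpha> \<in> \<Phi>" using Cons.prems by simp
  show ?case
  proof (cases "k < length js")
    case True
    thus ?thesis using Cons a by (simp add: dem_zero)
  next
    case False
    hence "dem_word js f \<in> sym_power G (k - length js)" using Cons by simp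
    from dem_sp[OF a this] False show ?thesis by (auto split: if_splits)
  qed
qed

text \<open>When the linear form is moved out to the left, each letter may act on it once: the
  letter disappears from the word and leaves as coefficient the value of \<mu> on the coroot of the
  matching entry of the inversion list.\<close>

lemma dem_word_leibniz:
  assumes "set js \<subseteq> \<Phi>" "\<mu> \<in> dual_space G" "f \<in> R"
  shows "dem_word js (\<mu> * f) = act (wp js) \<mu> * dem_word js f +
    (\<Sum>i<length js. fscale (\<mu> (cor (inversion_list js ! i))) (dem_word (take i js @ drop (Suc i) js) f))"
  using assms(1)
proof (induction js)
  case Nil
  show ?case by (simp only: wp_Nil act_id dem_word_Nil list.size lessThan_0 sum.empty add_0_right)
next
  case (Cons \<alpha> js)
  let ?w = "wp js"
  have a: "\<alpha> \<in> \<Phi>" and w: "?w \<in> W" and js: "set js \<subseteq> \<Phi>" using Cons.prems wp_W by auto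
  have wm: "act ?w \<mu> \<in> dual_space G" using act_dual w assms(2) by blast
  have gR: "dem_word js f \<in> R" using dem_word_R js assms(3) by blast
  have hR: "dem_word (take i js @ drop (Suc i) js) f \<in> R" for i
    using js set_take_subset[of i js] set_drop_subset[of "Suc i" js] assms(3) by (intro dem_word_R) auto
  \<comment> \<open>Equivariance of coroots turns the coefficient into one that depends only on the
    inversion.\<close>
  have c: "act ?w \<mu> (cor \<alpha>) = \<mu> (cor (act (iv ?w) \<alpha>))"
    using cor_act[OF W_inv[OF w] a] by (simp add: act_def comp_apply)
  have "dem_word (\<alpha> # js) (\<mu> * f) = dem \<alpha> (act ?w \<mu> * dem_word js f +
      (\<Sum>i<length js. fscale (\<mu> (cor (inversion_list js ! i))) (dem_word (take i js @ drop (Suc i) js) f)))"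
    using Cons.IH js by simp
  also have "\<dots> = dem \<alpha> (act ?w \<mu> * dem_word js f) +
      dem \<alpha> (\<Sum>i<length js. fscale (\<mu> (cor (inversion_list js ! i))) (dem_word (take i js @ drop (Suc i) js) f))"
    by (intro dem_add a R_dual_mult wm gR R_sum R_scale hR)
  also have "dem \<alpha> (\<Sum>i<length js. fscale (\<mu> (cor (inversion_list js ! i))) (dem_word (take i js @ drop (Suc i) js) f))
     = (\<Sum>i<length js. dem \<alpha> (fscale (\<mu> (cor (inversion_list js ! i))) (dem_word (take i js @ drop (Suc i) js) f)))"
    by (intro dem_sum a R_scale hR)
  also have "\<dots> = (\<Sum>i<length js. fscale (\<mu> (cor (inversion_list js ! i))) (dem \<alpha> (dem_word (take i js @ drop (Suc i) js) f)))"
    by (intro sum.cong refl dem_scale a hR)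
  also have "dem \<alpha> (act ?w \<mu> * dem_word js f) = fscale (\<mu> (cor (act (iv ?w) \<alpha>))) (dem_word js f)
      + act (s \<alpha> \<circ> ?w) \<mu> * dem \<alpha> (dem_word js f)"
    using dem_leibniz[OF a wm gR] c act_comp[OF W_refl[OF a] w] by simp
  finally show ?case
    by (simp only: wp_Cons dem_word_Cons length_Cons sum.lessThan_Suc_shift inversion_list.simps nth_Cons_0 nth_Cons_Suc
        take_0 drop_Suc_Cons drop_0 append_Nil take_Suc_Cons append_Cons add_ac)
qed

lemma reduced_choice:
  assumes "w \<in> W"
  obtains js where "set js \<subseteq> \<Delta>" "wp js = w" "length js = N w" "demazure G w = dem_word js"
proof -
  let ?js = "SOME js. reduced_expression G js w"
  have "reduced_expression G ?js w" using someI_ex[OF W_reduced[OF assms]] .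
  thus ?thesis using that[of ?js] W_length[OF assms] 
    unfolding reduced_expression_def demazure_def dem_word_def by simp
qed

text \<open>For a reduced word the list enumerates the inversions without repetition, so the
  correction terms of the Leibniz rule depend on the product of the word alone.\<close>

lemma sum_inversion_list:
  assumes "set js \<subseteq> \<Delta>" "length js = N (wp js)"
  shows "(\<Sum>i<length js. F (inversion_list js ! i)) = (\<Sum>\<beta>\<in>Inv (wp js). F \<beta>)"
proof -
  have sub: "Inv (wp js) \<subseteq> set (inversion_list js)" using Inv_subset_inversion_list[OF assms(1)] .
  have "card (set (inversion_list js)) \<le> length js" using card_length[of "inversion_list js"] by simp
  hence "card (set (inversion_list js)) \<le> card (Inv (wp js))" using assms(2) by (simp add: N_def)
  hence eq: "Inv (wp js) = set (inversion_list js)" using card_seteq[OF _ sub] by simp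
  hence "card (set (inversion_list js)) = length (inversion_list js)" using assms(2) by (simp add: N_def)
  hence d: "distinct (inversion_list js)" by (rule card_distinct)
  show ?thesis unfolding eq
    using sum.reindex_bij_betw[OF bij_betw_nth[OF d, of "{..<length js}" "set (inversion_list js)"]] by simp
qed

text \<open>The twisted Leibniz rule expresses the commutator of \<open>dem_word js\<close> with multiplication by a linear
  form through words of smaller length, in a way that depends only on the product of the word; so by
  induction two reduced words of the same element give the same operator (Bernstein, Gelfand, Gelfand).\<close>

lemma dem_word_eq:
  assumes "set js \<subseteq> \<Delta>" "f \<in> R"
  shows "dem_word js f = (if N (wp js) = length js then demazure G (wp js) f else 0)"
  using assms
proof (induction "length js" arbitrary: js f)
  case 0
  have "demazure G id = dem_word []"
    by (rule reduced_choice[OF W_id]) simp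
  hence "demazure G id f = f" by simp
  moreover have js: "js = []" using 0 by simp
  ultimately show ?case unfolding js wp_Nil N_id by simp
next
  case (Suc n)
  have jsR: "set js \<subseteq> \<Phi>" using Suc simple_sub by blast
  show ?case
  proof (cases "N (wp js) = length js")
    case True
    have w: "wp js \<in> W" using wp_W jsR by blast
    obtain ks where ks: "set ks \<subseteq> \<Delta>" "wp ks = wp js" "length ks = N (wp js)" "demazure G (wp js) = dem_word ks"
      using reduced_choice[OF w] .
    have ksR: "set ks \<subseteq> \<Phi>" using ks simple_sub by blast
    \<comment> \<open>The value that the induction hypothesis assigns to any word of length
      \<open>n\<close> with product \<open>u\<close>, including 0 for non-reduced ones.\<close>
    define T where "T u f = (if N u = n then demazure G u f else 0)" for u f
    have red: "dem_word ls (\<mu> * f) = act (wp js) \<mu> * dem_word ls f +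
        (\<Sum>\<beta>\<in>Inv (wp js). fscale (\<mu> (cor \<beta>)) (T (wp js \<circ> s \<beta>) f))"
      if ls: "set ls \<subseteq> \<Delta>" "wp ls = wp js" "length ls = Suc n" and f: "\<mu> \<in> dual_space G" "f \<in> R" for ls \<mu> f
    proof -
      have lsR: "set ls \<subseteq> \<Phi>" using ls simple_sub by blast
      have "dem_word (take i ls @ drop (Suc i) ls) f = T (wp js \<circ> s (inversion_list ls ! i)) f" if i: "i < length ls" for i
      proof -
        let ?ls = "take i ls @ drop (Suc i) ls"
        have "set ?ls \<subseteq> \<Delta>" using ls(1) set_take_subset[of i ls] set_drop_subset[of "Suc i" ls] by auto
        moreover have "n = length ?ls" using i ls(3) by simp
        ultimately have "dem_word ?ls f = (if N (wp ?ls) = length ?ls then demazure G (wp ?ls) f else 0)"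
          using Suc(1) f(2) by blast
        thus ?thesis using wp_delete[OF lsR i] ls(2) \<open>n = length ?ls\<close> by (simp add: T_def)
      qed
      hence "(\<Sum>i<length ls. fscale (\<mu> (cor (inversion_list ls ! i))) (dem_word (take i ls @ drop (Suc i) ls) f)) =
         (\<Sum>i<length ls. fscale (\<mu> (cor (inversion_list ls ! i))) (T (wp js \<circ> s (inversion_list ls ! i)) f))"
        by (intro sum.cong) auto
      also have "\<dots> = (\<Sum>\<beta>\<in>Inv (wp js). fscale (\<mu> (cor \<beta>)) (T (wp js \<circ> s \<beta>) f))"
        using sum_inversion_list[OF ls(1), of "\<lambda>\<beta>. fscale (\<mu> (cor \<beta>)) (T (wp js \<circ> s \<beta>) f)"] 
        by (simp only: ls True Suc.hyps(2)[symmetric])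
      finally show ?thesis using dem_word_leibniz[OF lsR f] by (simp only: ls(2))
    qed
    \<comment> \<open>The correction terms in \<open>red\<close> are the same for both words, so
      agreement on f passes to \<mu> f. The induction starts because non-empty words kill
      constants.\<close>
    have "dem_word js g = dem_word ks g" if "g \<in> R" for g
      using that
    proof (induction rule: R_induct)
      case (const c)
      have "js \<noteq> []" "ks \<noteq> []" using Suc(2) ks(3) True by auto
      thus ?case by (simp add: dem_word_const jsR ksR)
    next
      case (add f g)
      thus ?case by (simp add: dem_word_add jsR ksR)
    next
      case (scale c f)
      thus ?case by (simp add: dem_word_scale jsR ksR)
    next
      case (mult \<mu> f)
      have "dem_word js (\<mu> * f) = act (wp js) \<mu> * dem_word js f +
          (\<Sum>\<beta>\<in>Inv (wp js). fscale (\<mu> (cor \<beta>)) (T (wp js \<circ> s \<beta>) f))"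
        by (rule red[OF Suc.prems(1) refl _ mult(1,2)]) (simp only: Suc.hyps(2))
      also have "\<dots> = act (wp js) \<mu> * dem_word ks f +
          (\<Sum>\<beta>\<in>Inv (wp js). fscale (\<mu> (cor \<beta>)) (T (wp js \<circ> s \<beta>) f))"
        by (simp only: mult(3))
      also have "\<dots> = dem_word ks (\<mu> * f)"
        by (rule red[symmetric, OF ks(1,2) _ mult(1,2)]) (simp only: ks(3) True Suc.hyps(2))
      finally show ?case .
    qed
    thus ?thesis using True ks(4) Suc.prems(2) by simp
  next
    case False
    \<comment> \<open>A non-reduced word gives 0. Either its tail is already non-reduced, or the
      tail's product has a reduced word starting with \<alpha>; by the induction hypothesis that
      word gives the same operator, and applying \<open>dem \<alpha>\<close> twice gives 0.\<close>
    obtain \<alpha> js' where js': "js = \<alpha> # js'" using Suc(2) by (cases js) auto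
    have a: "\<alpha> \<in> \<Delta>" "\<alpha> \<in> \<Phi>" and s': "set js' \<subseteq> \<Delta>" "set js' \<subseteq> \<Phi>" and l: "n = length js'"
      using js' Suc simple_sub by auto
    have w: "wp js' \<in> W" using wp_W s' by blast
    have IH: "dem_word js' f = (if N (wp js') = length js' then demazure G (wp js') f else 0)"
      using Suc(1)[OF l s'(1) Suc.prems(2)] .
    have "dem_word js f = 0"
    proof (cases "N (wp js') = length js'")
      case False
      thus ?thesis using IH a js' by (simp add: dem_zero)
    next
      case True
      have "act (iv (wp js')) \<alpha> \<notin> Pos"
        using N_simple(1)[OF w a(1)] True False js' by auto
      hence N: "N (wp js') = Suc (N (s \<alpha> \<circ> wp js'))" using N_simple(2)[OF w a(1)] by blast
      obtain ks where ks: "set ks \<subseteq> \<Delta>" "wp ks = s \<alpha> \<circ> wp js'" "length ks = N (s \<alpha> \<circ> wp js')"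
        using reduced_choice[OF W_comp[OF W_refl[OF a(2)] w]] by metis
      have "s \<alpha> \<circ> (s \<alpha> \<circ> wp js') = wp js'"
        using refl_invol[OF a(2)] by (simp add: comp_assoc[symmetric])
      hence wk: "wp (\<alpha> # ks) = wp js'" using ks(2) by simp
      have "dem_word (\<alpha> # ks) f = (if N (wp (\<alpha> # ks)) = length (\<alpha> # ks) then demazure G (wp (\<alpha> # ks)) f else 0)"
        by (rule Suc.hyps(1)) (simp_all add: l True[symmetric] N ks a Suc.prems)
      hence "dem_word js' f = dem_word (\<alpha> # ks) f" using IH wk ks N True by simp
      moreover have "dem_word ks f \<in> R" using dem_word_R ks(1) simple_sub Suc.prems(2) by blast
      ultimately show ?thesis using js' dem_dem[OF a(2)] by simp
    qed
    thus ?thesis using False by simp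
  qed
qed

lemma demazure_word:
  assumes "w \<in> W"
  obtains js where "set js \<subseteq> \<Delta>" "set js \<subseteq> \<Phi>" "demazure G w = dem_word js"
proof -
  obtain js where js: "set js \<subseteq> \<Delta>" "demazure G w = dem_word js"
    using reduced_choice[OF assms] by blast
  show ?thesis by (rule that[OF js(1) order_trans[OF js(1) simple_sub] js(2)])
qed

lemma demazure_R: "w \<in> W \<Longrightarrow> f \<in> R \<Longrightarrow> demazure G w f \<in> R"
  by (erule demazure_word) (simp add: dem_word_R)

lemma demazure_I: "w \<in> W \<Longrightarrow> f \<in> I \<Longrightarrow> demazure G w f \<in> I"
  by (erule demazure_word) (simp add: dem_word_I)

lemma demazure_diff: "w \<in> W \<Longrightarrow> f \<in> R \<Longrightarrow> g \<in> R \<Longrightarrow> demazure G w (f - g) = demazure G w f - demazure G w g"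
  by (erule demazure_word) (simp add: dem_word_diff)

lemma demazure_sp: "w \<in> W \<Longrightarrow> f \<in> sym_power G k \<Longrightarrow> N w \<le> k \<Longrightarrow> demazure G w f \<in> sym_power G (k - N w)"
proof -
  assume w: "w \<in> W" and f: "f \<in> sym_power G k" "N w \<le> k"
  obtain js where js: "set js \<subseteq> \<Delta>" "length js = N w" "demazure G w = dem_word js"
    using reduced_choice[OF w] by blast
  have "set js \<subseteq> \<Phi>" using js(1) simple_sub by blast
  from dem_word_sp[OF this f(1)] show ?thesis using js f by simp
qed

text \<open>Putting \<alpha> in front of a reduced word of \<open>w\<close> makes it non-reduced,
  and non-reduced words act as zero.\<close>

lemma dem_demazure_zero:
  assumes "w \<in> W" "\<alpha> \<in> \<Delta>" "act (iv w) \<alpha> \<notin> Pos" "f \<in> R"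
  shows "dem \<alpha> (demazure G w f) = 0"
proof -
  obtain js where js: "set js \<subseteq> \<Delta>" "wp js = w" "length js = N w" "demazure G w = dem_word js"
    using reduced_choice[OF assms(1)] by blast
  have "N w = Suc (N (s \<alpha> \<circ> w))" using N_simple(2) assms by blast
  hence "dem_word (\<alpha> # js) f = 0" using dem_word_eq[of "\<alpha> # js" f] js assms by simp
  thus ?thesis using js by simp
qed

text \<open>Words shorter than w_0 send \<open>D\<close> into positive degree, longer and
  non-reduced ones to zero, and a reduced word of full length represents w_0. If that last value lay
  in the ideal, all words would give functions vanishing at the origin, and \<open>descent\<close>
  would yield \<open>D \<in> I\<close>.\<close>

lemma demazure_w0_D: "demazure G w0 D \<notin> I"
proof
  assume z: "demazure G w0 D \<in> I"
  let ?L = "\<lambda>f. f \<in> R \<and> (\<forall>ks. set ks \<subseteq> \<Delta> \<longrightarrow> dem_word ks f 0 = 0)"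
  have "D \<in> I"
  proof (rule descent[where L = ?L])
    fix f \<alpha> assume f: "?L f"
    show "f \<in> R" using f by blast
    show "f 0 = 0" using f[THEN conjunct2, rule_format, of "[]"] by simp
    assume a: "\<alpha> \<in> \<Delta>"
    have "dem_word ks (dem \<alpha> f) 0 = 0" if "set ks \<subseteq> \<Delta>" for ks
      using f[THEN conjunct2, rule_format, of "ks @ [\<alpha>]"] that a by (simp add: dem_word_append)
    thus "?L (dem \<alpha> f)" using dem_R f a simple_sub by blast
  next
    have "dem_word ks D 0 = 0" if ks: "set ks \<subseteq> \<Delta>" for ks
    proof (cases "length ks = card Pos")
      case True
      have w: "wp ks \<in> W" using wp_W ks simple_sub by blast
      show ?thesis
      proof (cases "N (wp ks) = length ks")
        case N: True
        hence "wp ks = w0" using W_N_max[OF w] True by simp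
        thus ?thesis using dem_word_eq[OF ks D_R] N I_at_zero[OF z] by simp
      next
        case False
        thus ?thesis using dem_word_eq[OF ks D_R] by (simp add: pointwise)
      qed
    next
      case False
      have "set ks \<subseteq> \<Phi>" using ks simple_sub by blast
      from dem_word_sp[OF this D_sp] show ?thesis using False sp_at_zero
        by (cases "card Pos < length ks") (auto simp: pointwise)
    qed
    thus "?L D" using D_R by blast
  qed
  thus False using D_notin_I by blast
qed

text \<open>A polynomial representative of the class \<open>schubert G d\<close>; it reduces
  statements about Schubert classes to congruences modulo \<open>I\<close>.\<close>

definition schub :: "('h \<Rightarrow> 'h) \<Rightarrow> 'h \<Rightarrow> complex" where
  "schub d = demazure G (iv d \<circ> w0) D"

lemma schub_sp:
  assumes "d \<in> W"
  shows "schub d \<in> sym_power G (N d)"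
proof -
  have w: "iv d \<circ> w0 \<in> W" using assms W_inv W_comp w0_W by blast
  have "N (iv d \<circ> w0) = card Pos - N d" using N_comp_w0 W_inv assms N_iv by simp
  thus ?thesis using demazure_sp[OF w D_sp] W_N_le[OF assms] by (simp add: schub_def)
qed

subsection \<open>The coinvariant algebra\<close>

abbreviation "cls \<equiv> coinv_class G"

lemma cls_eq: "cls f = {i + f | i. i \<in> I}"
  unfolding coinv_class_def a_r_coset_def' sym_alg_sel by blast

lemma cls_mem: "f \<in> R \<Longrightarrow> g \<in> cls f \<Longrightarrow> g \<in> R \<and> g - f \<in> I"
  unfolding cls_eq using I_R R_add by force

lemma cls_self: "f \<in> cls f"
proof -
  have "f = 0 + f" by simp
  thus ?thesis unfolding cls_eq using I_zero by blast
qed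

lemma cls_eq_iff: "f \<in> R \<Longrightarrow> g \<in> R \<Longrightarrow> cls f = cls g \<longleftrightarrow> f - g \<in> I"
proof
  assume R: "f \<in> R" "g \<in> R"
  have sub: "cls f \<subseteq> cls g" if d: "f - g \<in> I" for f g
  proof
    fix x assume "x \<in> cls f"
    then obtain i where i: "i \<in> I" "x = i + f" unfolding cls_eq by blast
    have "x = (i + (f - g)) + g" using i by simp
    thus "x \<in> cls g" unfolding cls_eq using I_add[OF i(1) d] by blast
  qed
  show "f - g \<in> I" if "cls f = cls g"
    using cls_mem[OF R(2), of f] cls_self[of f] that by blast
  show "cls f = cls g" if "f - g \<in> I"
  proof -
    have "0 - (f - g) \<in> I" by (rule I_diff[OF I_zero that])
    hence "g - f \<in> I" by simp
    thus ?thesis using sub that by blast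
  qed
qed

lemma carrier_coinv: "carrier (coinv_alg G) = cls ` R"
  by (auto simp: coinv_alg_def Let_def FactRing_def A_RCOSETS_def' coinv_class_def)

lemma coinv_ops:
  assumes "f \<in> R" "g \<in> R"
  shows "cls f \<oplus>\<^bsub>coinv_alg G\<^esub> cls g = cls (f + g)"
    and "cls f \<otimes>\<^bsub>coinv_alg G\<^esub> cls g = cls (f * g)"
    and "c \<odot>\<^bsub>coinv_alg G\<^esub> cls f = cls (fscale c f)"
    and "\<zero>\<^bsub>coinv_alg G\<^esub> = cls 0"
proof -
  interpret ideal I "sym_alg G" by (rule ideal_I)
  have m: "cls f \<otimes>\<^bsub>sym_alg G Quot I\<^esub> cls g = cls (f * g)" if "f \<in> R" "g \<in> R" for f g
    using rcoset_mult_add[OF that] by (simp add: FactRing_def coinv_class_def)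
  show "cls f \<oplus>\<^bsub>coinv_alg G\<^esub> cls g = cls (f + g)"
    using a_rcos_sum[OF assms] by (simp add: coinv_alg_def Let_def FactRing_def coinv_class_def)
  show "cls f \<otimes>\<^bsub>coinv_alg G\<^esub> cls g = cls (f * g)"
    using m[OF assms] by (simp add: coinv_alg_def Let_def)
  show "c \<odot>\<^bsub>coinv_alg G\<^esub> cls f = cls (fscale c f)"
    using m[OF R_const assms(1)] by (simp add: coinv_alg_def Let_def const_mult)
  have "cls 0 = I" unfolding cls_eq by simp
  thus "\<zero>\<^bsub>coinv_alg G\<^esub> = cls 0" by (simp add: coinv_alg_def Let_def FactRing_def)
qed

text \<open>Under these assumptions all representatives have the same image class, so the set inside
  \<open>the_elem\<close> is a singleton.\<close>

lemma coinv_induced_cls: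
  assumes "f \<in> R" "\<And>g. g \<in> R \<Longrightarrow> F g \<in> R" "\<And>g h. g \<in> R \<Longrightarrow> h \<in> R \<Longrightarrow> g - h \<in> I \<Longrightarrow> F g - F h \<in> I"
  shows "coinv_induced G F (cls f) = cls (F f)"
proof -
  have "cls (F g) = cls (F f)" if "g \<in> cls f" for g
  proof -
    have "g \<in> R" "g - f \<in> I" using cls_mem[OF assms(1) that] by blast+
    thus ?thesis using cls_eq_iff assms by blast
  qed
  hence "(\<lambda>g. cls (F g)) ` cls f = {cls (F f)}" using cls_self[of f] by blast
  thus ?thesis unfolding coinv_induced_def by simp
qed

lemma coinv_induced_act: "w \<in> W \<Longrightarrow> f \<in> R \<Longrightarrow> coinv_induced G (act w) (cls f) = cls (act w f)"
  by (rule coinv_induced_cls) (simp_all add: act_R act_diff[symmetric] act_I)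

lemma schubert_cls:
  assumes "d \<in> W"
  shows "schubert G d = cls (schub d)"
proof -
  have w: "iv d \<circ> w0 \<in> W" using assms W_inv W_comp w0_W by blast
  show ?thesis unfolding schubert_def schub_def
    by (rule coinv_induced_cls[OF D_R])
       (simp_all add: w demazure_R demazure_diff[symmetric] demazure_I)
qed

text \<open>Finitely many roots span the dual space, so products of \<open>k\<close> roots
  suffice.\<close>

lemma span_monomials:
  "\<exists>M. finite M \<and> M \<subseteq> sym_power G k \<and> sym_power G k \<subseteq> fs.span M"
proof (induction k)
  case 0
  have "1 \<in> sym_power G 0" unfolding sym_power_eq monomials_0 by (rule fs.span_base) simp
  moreover have "sym_power G 0 \<subseteq> fs.span {1}" unfolding sym_power_eq monomials_0 by blast
  ultimately show ?case by (intro exI[of _ "{1}"]) simp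
next
  case (Suc k)
  then obtain M where M: "finite M" "M \<subseteq> sym_power G k" "sym_power G k \<subseteq> fs.span M" by blast
  let ?M = "(\<lambda>(\<beta>, m). \<beta> * m) ` (\<Phi> \<times> M)"
  have mult: "\<mu> * f \<in> fs.span ?M" if \<mu>: "\<mu> \<in> dual_space G" and f: "f \<in> sym_power G k" for \<mu> f
  proof -
    have root: "\<beta> * f \<in> fs.span ?M" if b: "\<beta> \<in> \<Phi>" for \<beta>
    proof -
      have "fs.span M \<subseteq> {f. \<beta> * f \<in> fs.span ?M}"
      proof (rule fs.span_minimal)
        show "M \<subseteq> {f. \<beta> * f \<in> fs.span ?M}" using b by (auto intro!: fs.span_base)
        show "fs.subspace {f. \<beta> * f \<in> fs.span ?M}"
          by (rule fs.subspaceI)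
             (simp_all only: mem_Collect_eq distrib_left fscale_mult_right mult_zero_right
               fs.span_zero fs.span_add fs.span_scale)
      qed
      thus ?thesis using M(3) f by blast
    qed
    have "fs.span \<Phi> \<subseteq> {\<mu>. \<mu> * f \<in> fs.span ?M}"
    proof (rule fs.span_minimal)
      show "\<Phi> \<subseteq> {\<mu>. \<mu> * f \<in> fs.span ?M}" using root by blast
      show "fs.subspace {\<mu>. \<mu> * f \<in> fs.span ?M}"
        by (rule fs.subspaceI)
           (simp_all only: mem_Collect_eq distrib_right fscale_mult_left mult_zero_left
             fs.span_zero fs.span_add fs.span_scale)
    qed
    thus ?thesis using \<mu> span_roots by blast
  qed
  have "sym_power G (Suc k) \<subseteq> fs.span ?M"
    unfolding sym_power_eq[of "Suc k"]
  proof (rule fs.span_minimal[OF _ fs.subspace_span])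
    show "monomials (Suc k) \<subseteq> fs.span ?M"
    proof
      fix g assume "g \<in> monomials (Suc k)"
      then obtain \<mu> f where g: "g = \<mu> * f" "\<mu> \<in> dual_space G" "f \<in> monomials k" unfolding monomials_Suc by blast
      hence "f \<in> sym_power G k" unfolding sym_power_eq by (intro fs.span_base)
      thus "g \<in> fs.span ?M" using mult g by blast
    qed
  qed
  moreover have "?M \<subseteq> sym_power G (Suc k)" using M(2) sp_dual_mult root_dual by auto
  moreover have "finite ?M" using M(1) finite_roots by simp
  ultimately show ?case by blast
qed

subsection \<open>The trace on parabolic invariants\<close>

context
  fixes J :: "('h \<Rightarrow> complex) set"
  assumes J: "J \<subseteq> \<Delta>"
begin

lemma card_PosJ_le: "card (PosJ J) \<le> card Pos"
  using card_mono[OF finite_pos] PosJ_Pos by (simp add: subset_iff)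

text \<open>For \<alpha> in \<open>J\<close> the element w_0 d makes \<alpha> negative, so
  \<open>dem \<alpha>\<close> annihilates the representative, and a function annihilated by
  \<open>dem \<alpha>\<close> is fixed by the reflection. Invariance thus holds for the polynomial
  itself, not only for its class.\<close>

lemma schub_fixed:
  assumes "d \<in> min_coset_reps G J" "w \<in> par J"
  shows "act w (schub d) = schub d"
proof -
  have d: "d \<in> W" using assms min_coset_reps_iff[OF J] by blast
  have v: "iv d \<circ> w0 \<in> W" using d W_inv W_comp w0_W by blast
  have iv: "iv (iv d \<circ> w0) = w0 \<circ> d" using d w0_W by (simp add: W_inv_distrib W_inv W_inv_inv iv_w0)
  have fix_refl: "act (s \<alpha>) (schub d) = schub d" if a: "\<alpha> \<in> J" for \<alpha>
  proof -
    have a': "\<alpha> \<in> \<Delta>" "\<alpha> \<in> \<Phi>" using a J simple_sub by blast+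
    have "act d \<alpha> \<in> Pos" using min_coset_pos[OF J assms(1) a] .
    hence "act (w0 \<circ> d) \<alpha> \<notin> Pos" using d w0_W w0_pos_iff[OF pos_root] by (simp add: act_comp)
    hence "dem \<alpha> (schub d) = 0" unfolding schub_def using dem_demazure_zero[OF v a'(1) _ D_R] iv by simp
    hence "schub d - act (s \<alpha>) (schub d) = 0"
      using dem_mult[OF a'(2), of "schub d"] demazure_R[OF v D_R] unfolding schub_def by simp
    thus ?thesis by (simp only: right_minus_eq)
  qed
  have "w \<in> generated_by G J" using assms(2) by (simp add: parabolic_def)
  thus ?thesis
  proof (induction rule: gen_induct)
    case id
    show ?case by (rule act_id)
  next
    case (refl \<alpha> w)
    have "\<alpha> \<in> \<Phi>" "w \<in> W" using refl J simple_sub par_W[OF J] by (auto simp: parabolic_def)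
    thus ?case using act_comp[OF W_refl, of \<alpha> w "schub d"] refl fix_refl by simp
  qed
qed

lemma d_par_min: "d_par G J \<in> min_coset_reps G J"
  using w0_w_par_min[OF J] d_par_eq[OF J] by simp

lemma d_par_W: "d_par G J \<in> W"
  using d_par_min min_coset_reps_iff[OF J] by blast

lemma d_par_N: "N (d_par G J) = card Pos - card (PosJ J)"
  using N_w0_comp[OF par_W[OF J w_par_par[OF J]]] w_par_N[OF J] d_par_eq[OF J] by simp

abbreviation "X \<equiv> schub (d_par G J)"

lemma X_sp: "X \<in> sym_power G (card Pos - card (PosJ J))"
  using schub_sp[OF d_par_W] d_par_N by simp

lemma X_R: "X \<in> R"
  using X_sp sp_R by blast

text \<open>\<open>X\<close> is the operator of w_J applied to \<open>D\<close>. The ideal is stable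
  under the letters of a reduced word of d_J, but these complete the word of w_J to a reduced word
  of w_0, whose value on \<open>D\<close> is outside the ideal.\<close>

lemma X_notin_I: "X \<notin> I"
proof
  assume X: "X \<in> I"
  let ?d = "d_par G J" and ?w = "w_par G J"
  have w: "?w \<in> W" using par_W[OF J w_par_par[OF J]] .
  have iw: "iv ?w = ?w" by (rule inv_unique_comp[OF w_par_invol[OF J] w_par_invol[OF J]])
  have "iv ?d \<circ> w0 = iv ?w \<circ> iv w0 \<circ> w0" by (simp only: d_par_eq[OF J] W_inv_distrib[OF w0_W w])
  also have "\<dots> = ?w" by (simp only: iw iv_w0 comp_assoc w0_invol comp_id)
  finally have X_eq: "X = demazure G ?w D" by (simp only: schub_def)
  obtain us where us: "set us \<subseteq> \<Delta>" "wp us = ?d" "length us = N ?d"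
    using reduced_choice[OF d_par_W] by metis
  obtain ks where ks: "set ks \<subseteq> \<Delta>" "wp ks = ?w" "length ks = N ?w" "demazure G ?w = dem_word ks"
    using reduced_choice[OF w] by metis
  have "wp (us @ ks) = w0" by (simp only: wp_append us ks d_par_eq[OF J] comp_assoc w_par_invol[OF J] comp_id)
  moreover have "length (us @ ks) = N w0"
    using card_PosJ_le by (simp add: us ks d_par_N w_par_N[OF J] w0_N)
  moreover have "set (us @ ks) \<subseteq> \<Delta>" using us(1) ks(1) by simp
  ultimately have "dem_word (us @ ks) D = demazure G w0 D" using dem_word_eq[OF _ D_R, of "us @ ks"] by simp
  moreover have "dem_word us (dem_word ks D) \<in> I"
    by (rule dem_word_I[OF us(1)]) (use X X_eq ks(4) in simp)
  ultimately show False using demazure_w0_D by (simp add: dem_word_append)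
qed

text \<open>For an arbitrary f, the trace of a times the antisymmetrisation of f over the subgroup
  is |W_J| tr (a f). That antisymmetrisation is \<open>piJ J\<close> times an invariant b, so
  pairing with invariants already detects everything.\<close>

lemma trace_nondeg:
  assumes "a \<in> R" "\<And>w. w \<in> par J \<Longrightarrow> act w a - a \<in> I"
    and "\<And>b. b \<in> R \<Longrightarrow> (\<And>w. w \<in> par J \<Longrightarrow> act w b = b) \<Longrightarrow> tr (a * b * piJ J) = 0"
  shows "a \<in> I"
  unfolding I_iff
proof (intro conjI ballI)
  fix f assume f: "f \<in> R"
  obtain b where b: "b \<in> R" "antisym J f = piJ J * b" using antisym_div[OF J f] by blast
  have "act w b = b" if w: "w \<in> par J" for w
  proof (rule R_cancel[OF piJ_R piJ_nonzero act_R[OF par_W[OF J w] b(1)] b(1)])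
    have "fscale (weyl_sign w) (piJ J * act w b) = act w (antisym J f)"
      unfolding b act_mult act_piJ[OF J w] by (simp only: fscale_mult_left)
    also have "\<dots> = fscale (weyl_sign w) (piJ J * b)" by (subst act_antisym[OF J w]) (simp only: b)
    finally have "fscale (weyl_sign w) (fscale (weyl_sign w) (piJ J * act w b)) = fscale (weyl_sign w) (fscale (weyl_sign w) (piJ J * b))"
      by (rule arg_cong)
    thus "piJ J * act w b = piJ J * b" by (simp add: weyl_sign_square)
  qed
  hence "tr (a * b * piJ J) = 0" using assms(3) b by blast
  moreover have "a * b * piJ J = a * antisym J f" by (simp only: b mult_ac)
  ultimately have "0 = tr (a * antisym J f)" by simp
  also have "\<dots> = tr (\<Sum>w\<in>par J. fscale (weyl_sign w) (a * act w f))"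
    by (simp only: antisym_def sum_distrib_left fscale_mult_right)
  also have "\<dots> = (\<Sum>w\<in>par J. tr (fscale (weyl_sign w) (a * act w f)))"
    by (intro tr_sum R_scale R_mult act_R assms(1) f par_W[OF J])
  also have "\<dots> = (\<Sum>w\<in>par J. tr (a * f))"
  proof (rule sum.cong[OF refl])
    fix w assume w: "w \<in> par J"
    have wW: "w \<in> W" using par_W[OF J w] .
    have R: "a * act w f \<in> R" "act w a * act w f \<in> R" using assms(1) f wW by (auto intro: R_mult act_R)
    \<comment> \<open>Modulo \<open>I\<close>, which is invisible to tr, \<open>a\<close> may be
      replaced by \<open>act w a\<close>; the product then is a translate of
      \<open>a * f\<close>.\<close>
    have "tr ((act w a - a) * act w f) = 0" by (rule I_tr[OF assms(2)[OF w] act_R[OF wW f]])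
    hence "tr (a * act w f) = tr (act w (a * f))" using tr_diff[OF R(2,1)] by (simp add: left_diff_distrib act_mult)
    also have "\<dots> = weyl_sign w * tr (a * f)" by (rule tr_act[OF R_mult[OF assms(1) f] wW])
    finally show "tr (fscale (weyl_sign w) (a * act w f)) = tr (a * f)"
      using tr_scale[OF R(1)] weyl_sign_square[of w] by (simp add: mult.assoc[symmetric])
  qed
  finally have "of_nat (card (par J)) * tr (a * f) = 0" by simp
  moreover have "card (par J) \<noteq> 0" using finite_par[OF J] par_id[OF J] by auto
  ultimately show "tr (a * f) = 0" by simp
qed (rule assms(1))

text \<open>In this degree \<open>a * piJ J\<close> already has the degree of tr, so every component
  of \<open>b\<close> except the constant one overshoots.\<close>

lemma trace_top:
  assumes "a \<in> sym_power G (card Pos - card (PosJ J))" "b \<in> R"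
  shows "tr (a * b * piJ J) = b 0 * tr (a * piJ J)"
  using assms(2)
proof (induction rule: R_graded_induct)
  case (homog k b)
  have aR: "a * piJ J \<in> R" using assms(1) sp_R piJ_R R_mult by blast
  show ?case
  proof (cases "k = 0")
    case True
    then obtain c where "b = (\<lambda>_. c)" using homog sym_power_0 by blast
    moreover have "a * (\<lambda>_. c) * piJ J = fscale c (a * piJ J)" by (auto simp: fun_eq_iff pointwise)
    ultimately show ?thesis using tr_scale[OF aR] by simp
  next
    case False
    have "a * b * piJ J \<in> sym_power G (card Pos - card (PosJ J) + k + card (PosJ J))"
      by (intro sp_mult assms(1) homog piJ_sp)
    hence "tr (a * b * piJ J) = 0" by (rule tr_homog) (use False card_PosJ_le in simp)
    thus ?thesis using sp_at_zero[OF homog] False by simp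
  qed
next
  case zero
  have "(0 :: 'h \<Rightarrow> complex) 0 = 0" by (rule zero_fun_apply)
  thus ?case by (simp only: mult_zero_right mult_zero_left tr_zero)
next
  case (add f g)
  have "a \<in> R" using assms(1) sp_R by blast
  hence "a * f * piJ J \<in> R" "a * g * piJ J \<in> R" using add piJ_R R_mult by blast+
  thus ?case using add plus_fun_apply[of f g 0] by (simp add: distrib_left distrib_right tr_add)
qed

lemma tr_X: "tr (X * piJ J) \<noteq> 0"
proof
  assume z: "tr (X * piJ J) = 0"
  have "X \<in> I"
  proof (rule trace_nondeg[OF X_R])
    show "act w X - X \<in> I" if "w \<in> par J" for w
      using schub_fixed[OF d_par_min that] I_zero by simp
    show "tr (X * b * piJ J) = 0" if "b \<in> R" for b
      using trace_top[OF X_sp that] z by simp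
  qed
  thus False using X_notin_I by blast
qed

text \<open>The coefficient is chosen so that the difference has trace zero against
  \<open>piJ J\<close>; by \<open>trace_top\<close> it then pairs to zero with all invariants. So
  the top component of the invariants is a line modulo \<open>I\<close>, the source of
  uniqueness.\<close>

lemma top_component:
  assumes "a \<in> sym_power G (card Pos - card (PosJ J))" "\<And>w. w \<in> par J \<Longrightarrow> act w a = a"
  shows "a - fscale (tr (a * piJ J) / tr (X * piJ J)) X \<in> I"
proof -
  let ?c = "tr (a * piJ J) / tr (X * piJ J)"
  let ?a = "a - fscale ?c X"
  have a: "?a \<in> sym_power G (card Pos - card (PosJ J))" using assms(1) X_sp sp_diff sp_scale by blast
  have aR: "a * piJ J \<in> R" "X * piJ J \<in> R" using assms(1) sp_R piJ_R R_mult X_R by blast+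
  have "tr (?a * piJ J) = tr (a * piJ J) - ?c * tr (X * piJ J)"
    using aR by (simp add: left_diff_distrib fscale_mult_left tr_diff tr_scale R_scale)
  hence z: "tr (?a * piJ J) = 0" using tr_X by simp
  show ?thesis
  proof (rule trace_nondeg[OF sp_R[OF a]])
    show "act w ?a - ?a \<in> I" if w: "w \<in> par J" for w
      using schub_fixed[OF d_par_min w] assms(2)[OF w] I_zero by (simp add: act_diff act_scale)
    show "tr (?a * b * piJ J) = 0" if "b \<in> R" for b
      using trace_top[OF a that] z by simp
  qed
qed

text \<open>Purely by degree: by \<open>min_coset_max\<close> no other minimal representative has
  the length of d_J.\<close>

lemma tr_schub:
  assumes "d \<in> min_coset_reps G J" "d \<noteq> d_par G J"
  shows "tr (schub d * piJ J) = 0"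
proof (rule tr_homog)
  have d: "d \<in> W" using assms min_coset_reps_iff[OF J] by blast
  show "schub d * piJ J \<in> sym_power G (N d + card (PosJ J))" by (intro sp_mult schub_sp piJ_sp d)
  show "N d + card (PosJ J) \<noteq> card Pos" using min_coset_max[OF J assms(1)] assms(2) by force
qed

section \<open>The parabolic coinvariants as classes of invariant polynomials\<close>

definition invariants :: "('h \<Rightarrow> complex) set" where
  "invariants = {f \<in> R. \<forall>w\<in>par J. act w f = f}"

lemma invariants_R: "f \<in> invariants \<Longrightarrow> f \<in> R"
  by (simp add: invariants_def)

lemma invariants_zero: "0 \<in> invariants"
  and invariants_add: "f \<in> invariants \<Longrightarrow> g \<in> invariants \<Longrightarrow> f + g \<in> invariants"
  and invariants_mult: "f \<in> invariants \<Longrightarrow> g \<in> invariants \<Longrightarrow> f * g \<in> invariants"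
  and invariants_scale: "f \<in> invariants \<Longrightarrow> fscale c f \<in> invariants"
  by (simp_all add: invariants_def R_zero R_add R_mult R_scale act_zero act_add act_mult act_scale)

lemma invariants_sum: "(\<And>i. i \<in> A \<Longrightarrow> F i \<in> invariants) \<Longrightarrow> (\<Sum>i\<in>A. F i) \<in> invariants"
  by (induction A rule: infinite_finite_induct) (auto simp: invariants_zero invariants_add)

lemma av_invariants: "f \<in> R \<Longrightarrow> av J f \<in> invariants"
  using av_R[OF J] av_act[OF J] by (simp add: invariants_def)

lemma av_fixed: "f \<in> invariants \<Longrightarrow> av J f = f"
  unfolding av_def using scale_card_par[OF J, of f] by (simp add: invariants_def)

abbreviation "A \<equiv> coinv_alg_par G J"

text \<open>A class fixed by the subgroup contains the average of any of its representatives, and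
  this average is a genuine invariant.\<close>

lemma carrier_A: "carrier A = cls ` invariants"
proof
  show "cls ` invariants \<subseteq> carrier A"
    unfolding coinv_alg_par_def using carrier_coinv coinv_induced_act par_W[OF J] by (auto simp: invariants_def)
  show "carrier A \<subseteq> cls ` invariants"
  proof
    fix a assume "a \<in> carrier A"
    hence a: "a \<in> cls ` R" "\<forall>w\<in>par J. coinv_induced G (act w) a = a"
      unfolding coinv_alg_par_def by (simp_all add: carrier_coinv)
    then obtain f where f: "f \<in> R" "a = cls f" by blast
    have "act w f - f \<in> I" if w: "w \<in> par J" for w
    proof -
      have "cls (act w f) = cls f" using a(2) w f coinv_induced_act[OF par_W[OF J w] f(1)] by metis
      thus ?thesis using cls_eq_iff act_R[OF par_W[OF J w]] f(1) by blast
    qed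
    hence "cls (av J f) = cls f" using av_cong[OF J] cls_eq_iff av_R[OF J] f(1) by blast
    thus "a \<in> cls ` invariants" using f av_invariants by (metis imageI)
  qed
qed

lemma
  assumes "f \<in> R" "g \<in> R"
  shows A_add: "cls f \<oplus>\<^bsub>A\<^esub> cls g = cls (f + g)"
    and A_mult: "cls f \<otimes>\<^bsub>A\<^esub> cls g = cls (f * g)"
    and A_smult: "c \<odot>\<^bsub>A\<^esub> cls f = cls (fscale c f)"
    and A_zero: "\<zero>\<^bsub>A\<^esub> = cls 0"
  using coinv_ops[OF assms] by (simp_all add: coinv_alg_par_def)

section \<open>Finite sums and finite dimension\<close>

lemma abelian_monoid_A: "abelian_monoid A"
proof (rule abelian_monoidI)
  show "\<zero>\<^bsub>A\<^esub> \<in> carrier A" using A_zero[OF R_zero R_zero] invariants_zero carrier_A by simp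
  fix x y z assume "x \<in> carrier A" "y \<in> carrier A"
  then obtain f g where fg: "f \<in> invariants" "x = cls f" "g \<in> invariants" "y = cls g" by (auto simp: carrier_A)
  show "x \<oplus>\<^bsub>A\<^esub> y \<in> carrier A" using fg by (simp add: A_add invariants_R carrier_A invariants_add)
  show "x \<oplus>\<^bsub>A\<^esub> y = y \<oplus>\<^bsub>A\<^esub> x" using fg by (simp add: A_add invariants_R add.commute)
  assume "z \<in> carrier A"
  then obtain h where "h \<in> invariants" "z = cls h" by (auto simp: carrier_A)
  thus "(x \<oplus>\<^bsub>A\<^esub> y) \<oplus>\<^bsub>A\<^esub> z = x \<oplus>\<^bsub>A\<^esub> (y \<oplus>\<^bsub>A\<^esub> z)"
    using fg by (simp add: A_add invariants_R R_add add.assoc)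
next
  fix x assume "x \<in> carrier A"
  then obtain f where f: "f \<in> invariants" "x = cls f" by (auto simp: carrier_A)
  show "\<zero>\<^bsub>A\<^esub> \<oplus>\<^bsub>A\<^esub> x = x"
    using f A_zero[OF R_zero R_zero] by (simp add: A_add invariants_R R_zero)
qed

lemma finsum_cls:
  assumes "finite B" "\<And>b. b \<in> B \<Longrightarrow> F b \<in> invariants"
  shows "(\<Oplus>\<^bsub>A\<^esub>b\<in>B. cls (F b)) = cls (\<Sum>b\<in>B. F b)"
  using assms
proof (induction B)
  case empty
  show ?case using abelian_monoid.finsum_empty[OF abelian_monoid_A] A_zero[OF R_zero R_zero] by simp
next
  case (insert b B)
  have "(\<Oplus>\<^bsub>A\<^esub>b\<in>insert b B. cls (F b)) = cls (F b) \<oplus>\<^bsub>A\<^esub> (\<Oplus>\<^bsub>A\<^esub>b\<in>B. cls (F b))"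
    by (rule abelian_monoid.finsum_insert[OF abelian_monoid_A]) (use insert in \<open>auto simp: carrier_A\<close>)
  also have "(\<Oplus>\<^bsub>A\<^esub>b\<in>B. cls (F b)) = cls (\<Sum>b\<in>B. F b)" using insert by blast
  also have "cls (F b) \<oplus>\<^bsub>A\<^esub> cls (\<Sum>b\<in>B. F b) = cls (F b + (\<Sum>b\<in>B. F b))"
    using insert invariants_R by (intro A_add R_sum) auto
  finally show ?case using insert by simp
qed

definition rep :: "('h \<Rightarrow> complex) set \<Rightarrow> 'h \<Rightarrow> complex" where
  "rep a = (SOME f. f \<in> invariants \<and> cls f = a)"

lemma rep: "a \<in> carrier A \<Longrightarrow> rep a \<in> invariants \<and> cls (rep a) = a"
proof -
  assume "a \<in> carrier A"
  hence "\<exists>f. f \<in> invariants \<and> cls f = a" unfolding carrier_A by blast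
  thus ?thesis unfolding rep_def by (rule someI_ex)
qed

lemma rep_cls: "f \<in> invariants \<Longrightarrow> f - rep (cls f) \<in> I"
proof -
  assume f: "f \<in> invariants"
  hence "rep (cls f) \<in> invariants" "cls (rep (cls f)) = cls f" using rep carrier_A by blast+
  thus ?thesis using f cls_eq_iff invariants_R by metis
qed

text \<open>Averages of finite spanning sets in the degrees up to the number of positive roots;
  beyond that all classes vanish by \<open>sp_high_I\<close>.\<close>

lemma finite_spanning_set:
  "\<exists>B. finite B \<and> B \<subseteq> carrier A \<and> (\<forall>a\<in>carrier A. \<exists>c. a = (\<Oplus>\<^bsub>A\<^esub>b\<in>B. c b \<odot>\<^bsub>A\<^esub> b))"
proof -
  have "\<forall>k. \<exists>M. finite M \<and> M \<subseteq> sym_power G k \<and> sym_power G k \<subseteq> fs.span M"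
    using span_monomials by blast
  then obtain M where M: "\<And>k. finite (M k)" "\<And>k. M k \<subseteq> sym_power G k" "\<And>k. sym_power G k \<subseteq> fs.span (M k)"
    by metis
  define S where "S = av J ` (\<Union>k\<le>card Pos. M k)"
  define B where "B = cls ` S"
  have finS: "finite S" using M(1) by (simp add: S_def)
  have SR: "S \<subseteq> invariants" unfolding S_def using M(2) sp_R av_invariants by blast
  have BA: "B \<subseteq> carrier A" using SR carrier_A B_def by blast
  have repB: "rep b \<in> invariants \<and> cls (rep b) = b" if "b \<in> B" for b using rep BA that by blast
  have "\<exists>c. a = (\<Oplus>\<^bsub>A\<^esub>b\<in>B. c b \<odot>\<^bsub>A\<^esub> b)" if a: "a \<in> carrier A" for a
  proof -
    obtain f where f: "f \<in> invariants" "a = cls f" using a carrier_A by blast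
    obtain n F where F: "\<And>k. F k \<in> sym_power G k" "f = (\<Sum>k<n. F k)" using R_decomp invariants_R f(1) by metis
    have avs: "av J (F k) \<in> fs.span S" if k: "k \<le> card Pos" for k
    proof -
      have "fs.span (M k) \<subseteq> {g. av J g \<in> fs.span S}"
      proof (rule fs.span_minimal)
        show "M k \<subseteq> {g. av J g \<in> fs.span S}" using k by (auto simp: S_def intro!: fs.span_base)
        show "fs.subspace {g. av J g \<in> fs.span S}"
          by (rule fs.subspaceI)
             (simp_all only: mem_Collect_eq av_zero av_add av_scale fs.span_zero fs.span_add fs.span_scale)
      qed
      thus ?thesis using M(3) F(1) by blast
    qed
    define g where "g = (\<Sum>k<n. if k \<le> card Pos then av J (F k) else 0)"
    have "g \<in> fs.span S" unfolding g_def by (rule fs.span_sum) (use avs fs.span_zero in auto)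
    then obtain u where u: "g = (\<Sum>v\<in>S. fscale (u v) v)" using fs.span_finite[OF finS] by auto
    have gRJ: "g \<in> invariants" unfolding u using SR by (intro invariants_sum invariants_scale) auto
    have "f = (\<Sum>k<n. av J (F k))" using av_fixed[OF f(1)] F(2) av_sum[of J F "{..<n}"] by metis
    hence "f - g = (\<Sum>k<n. av J (F k) - (if k \<le> card Pos then av J (F k) else 0))"
      unfolding g_def by (simp only: sum_subtractf)
    also have "\<dots> \<in> I"
    proof (rule I_sum)
      fix k
      show "av J (F k) - (if k \<le> card Pos then av J (F k) else 0) \<in> I"
        using av_I[OF J sp_high_I[OF F(1)], of k] I_zero by simp
    qed
    finally have fg: "f - g \<in> I" .
    \<comment> \<open>Several members of \<open>S\<close> may have the same class, so their
      coefficients are added over each fibre.\<close>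
    define c where "c b = (\<Sum>v\<in>{v \<in> S. cls v = b}. u v)" for b
    have cR: "fscale (c b) (rep b) \<in> invariants" if "b \<in> B" for b using repB[OF that] invariants_scale by blast
    have "(\<Sum>b\<in>B. fscale (c b) (rep b)) = (\<Sum>b\<in>B. \<Sum>v\<in>{v \<in> S. cls v = b}. fscale (u v) (rep (cls v)))"
      by (intro sum.cong refl) (simp add: c_def fs.scale_sum_left)
    also have "\<dots> = (\<Sum>v\<in>S. fscale (u v) (rep (cls v)))"
      unfolding B_def by (rule sum.image_gen[OF finS, symmetric])
    finally have e: "g - (\<Sum>b\<in>B. fscale (c b) (rep b)) = (\<Sum>v\<in>S. fscale (u v) (v - rep (cls v)))"
      unfolding u by (simp only: sum_subtractf fs.scale_right_diff_distrib)
    have "\<dots> \<in> I" using rep_cls SR by (intro I_sum I_scale) auto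
    hence gI: "g - (\<Sum>b\<in>B. fscale (c b) (rep b)) \<in> I" using e by simp
    have sR: "(\<Sum>b\<in>B. fscale (c b) (rep b)) \<in> R" using cR invariants_R by (intro R_sum) auto
    have "a = cls g" using fg cls_eq_iff invariants_R f gRJ by blast
    also have "\<dots> = cls (\<Sum>b\<in>B. fscale (c b) (rep b))" using gI cls_eq_iff invariants_R[OF gRJ] sR by blast
    also have "\<dots> = (\<Oplus>\<^bsub>A\<^esub>b\<in>B. cls (fscale (c b) (rep b)))"
      by (rule finsum_cls[symmetric]) (use finS cR in \<open>auto simp: B_def\<close>)
    also have "\<dots> = (\<Oplus>\<^bsub>A\<^esub>b\<in>B. c b \<odot>\<^bsub>A\<^esub> b)"
    proof (rule abelian_monoid.finsum_cong'[OF abelian_monoid_A refl])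
      have e: "c b \<odot>\<^bsub>A\<^esub> b = cls (fscale (c b) (rep b))" if "b \<in> B" for b
        using A_smult[OF invariants_R R_zero, of "rep b" "c b"] repB[OF that] by simp
      show "(\<lambda>b. c b \<odot>\<^bsub>A\<^esub> b) \<in> B \<rightarrow> carrier A" using e cR carrier_A by simp
      show "cls (fscale (c b) (rep b)) = c b \<odot>\<^bsub>A\<^esub> b" if "b \<in> B" for b using e that by simp
    qed
    finally show ?thesis by blast
  qed
  moreover have "finite B" using finS B_def by simp
  ultimately show ?thesis using BA by blast
qed

text \<open>The denominator normalises the value on the Schubert class of d_J to 1;
  \<open>restrict\<close> makes the function extensional. Independence of the chosen representative
  is \<open>trJ_cls\<close>.\<close>

definition trJ :: "('h \<Rightarrow> complex) set \<Rightarrow> complex" where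
  "trJ = restrict (\<lambda>a. tr (rep a * piJ J) / tr (X * piJ J)) (carrier A)"

lemma trJ_cls:
  assumes "f \<in> invariants"
  shows "trJ (cls f) = tr (f * piJ J) / tr (X * piJ J)"
proof -
  have c: "cls f \<in> carrier A" using assms carrier_A by blast
  have R: "f * piJ J \<in> R" "rep (cls f) * piJ J \<in> R" using assms rep[OF c] invariants_R piJ_R R_mult by blast+
  have "tr ((f - rep (cls f)) * piJ J) = 0" using I_tr[OF rep_cls[OF assms] piJ_R] .
  hence "tr (f * piJ J) = tr (rep (cls f) * piJ J)" using tr_diff[OF R] by (simp add: left_diff_distrib)
  thus ?thesis using c by (simp add: trJ_def)
qed

lemma schub_invariants: "d \<in> min_coset_reps G J \<Longrightarrow> schub d \<in> invariants"
  using schub_fixed sp_R[OF schub_sp] min_coset_reps_iff[OF J] unfolding invariants_def by blast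

lemma trJ_nondeg:
  assumes "a \<in> carrier A" "\<And>b. b \<in> carrier A \<Longrightarrow> trJ (a \<otimes>\<^bsub>A\<^esub> b) = 0"
  shows "a = \<zero>\<^bsub>A\<^esub>"
proof -
  obtain f where f: "f \<in> invariants" "a = cls f" using assms carrier_A by blast
  have "f \<in> I"
  proof (rule trace_nondeg[OF invariants_R[OF f(1)]])
    show "act w f - f \<in> I" if "w \<in> par J" for w using f(1) that I_zero by (simp add: invariants_def)
    fix b assume b: "b \<in> R" "\<And>w. w \<in> par J \<Longrightarrow> act w b = b"
    hence bJ: "b \<in> invariants" by (simp add: invariants_def)
    have "cls b \<in> carrier A" using bJ carrier_A by blast
    hence "trJ (cls f \<otimes>\<^bsub>A\<^esub> cls b) = 0" using assms(2) f(2) by blast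
    hence "trJ (cls (f * b)) = 0" by (simp only: A_mult[OF invariants_R[OF f(1)] b(1)])
    thus "tr (f * b * piJ J) = 0" using trJ_cls[OF invariants_mult[OF f(1) bJ]] tr_X by simp
  qed
  hence "cls f = cls 0" using cls_eq_iff[OF invariants_R[OF f(1)] R_zero] by simp
  thus ?thesis using f A_zero[OF R_zero R_zero] by simp
qed

lemma A_comm:
  assumes "a \<in> carrier A" "b \<in> carrier A"
  shows "a \<otimes>\<^bsub>A\<^esub> b = b \<otimes>\<^bsub>A\<^esub> a"
proof -
  obtain f where f: "f \<in> invariants" "a = cls f" using assms(1) carrier_A by blast
  obtain g where g: "g \<in> invariants" "b = cls g" using assms(2) carrier_A by blast
  show ?thesis unfolding f(2) g(2) A_mult[OF invariants_R[OF f(1)] invariants_R[OF g(1)]] A_mult[OF invariants_R[OF g(1)] invariants_R[OF f(1)]]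
    by (subst mult.commute) (rule refl)
qed

lemma trJ_symmetrizing: "symmetrizing_form A trJ"
  unfolding symmetrizing_form_def
proof (intro conjI ballI allI impI)
  show "\<exists>B. finite B \<and> B \<subseteq> carrier A \<and> (\<forall>a\<in>carrier A. \<exists>c. a = (\<Oplus>\<^bsub>A\<^esub>b\<in>B. c b \<odot>\<^bsub>A\<^esub> b))"
    by (rule finite_spanning_set)
next
  fix a b assume "a \<in> carrier A" "b \<in> carrier A"
  then obtain f g where fg: "f \<in> invariants" "a = cls f" "g \<in> invariants" "b = cls g" unfolding carrier_A by (elim imageE)
  have R: "f * piJ J \<in> R" "g * piJ J \<in> R" using fg invariants_R piJ_R R_mult by blast+
  have "trJ (a \<oplus>\<^bsub>A\<^esub> b) = trJ (cls (f + g))" using fg A_add invariants_R by simp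
  also have "\<dots> = trJ a + trJ b"
    using fg R by (simp add: trJ_cls invariants_add distrib_right tr_add add_divide_distrib)
  finally show "trJ (a \<oplus>\<^bsub>A\<^esub> b) = trJ a + trJ b" .
next
  fix c a assume "a \<in> carrier A"
  then obtain f where f: "f \<in> invariants" "a = cls f" using carrier_A by blast
  have R: "f * piJ J \<in> R" using f invariants_R piJ_R R_mult by blast
  have "trJ (c \<odot>\<^bsub>A\<^esub> a) = trJ (cls (fscale c f))" using f A_smult[OF invariants_R R_zero] by simp
  also have "\<dots> = c * trJ a" using f R by (simp add: trJ_cls invariants_scale fscale_mult_left tr_scale)
  finally show "trJ (c \<odot>\<^bsub>A\<^esub> a) = c * trJ a" .
next
  fix a b assume "a \<in> carrier A" "b \<in> carrier A"
  thus "trJ (a \<otimes>\<^bsub>A\<^esub> b) = trJ (b \<otimes>\<^bsub>A\<^esub> a)" using A_comm by metis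
next
  fix a assume "a \<in> carrier A" "\<forall>b\<in>carrier A. trJ (a \<otimes>\<^bsub>A\<^esub> b) = 0"
  thus "a = \<zero>\<^bsub>A\<^esub>" using trJ_nondeg by blast
next
  fix b assume "b \<in> carrier A" "\<forall>a\<in>carrier A. trJ (a \<otimes>\<^bsub>A\<^esub> b) = 0"
  thus "b = \<zero>\<^bsub>A\<^esub>" using trJ_nondeg A_comm by metis
qed

section \<open>Degree, values on Schubert classes and uniqueness\<close>

abbreviation "deg \<equiv> - 2 * int (weyl_length G w0) + 2 * int (weyl_length G (w_par G J))"

lemma deg_eq: "deg = - 2 * int (card Pos - card (PosJ J))"
  using W_length[OF w0_W] w0_N par_length[OF J w_par_par[OF J]] w_par_N[OF J] card_PosJ_le by simp

lemma trJ_homogeneous: "homogeneous_form (coinv_par_graded G J) deg trJ"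
  unfolding homogeneous_form_def
proof (intro allI ballI impI)
  fix m a assume a: "a \<in> coinv_par_graded G J m" and m: "int m + deg \<noteq> 0"
  obtain f where f: "f \<in> sym_graded G m" "a = cls f"
    using a unfolding coinv_par_graded_def coinv_graded_def by blast
  \<comment> \<open>Two representatives of the same class: \<open>f\<close> is homogeneous but
    perhaps not invariant, \<open>g\<close> is invariant but perhaps not homogeneous. The degree
    argument uses \<open>f\<close>, the value of \<open>trJ\<close> uses \<open>g\<close>, and
    \<open>I_tr\<close> connects them.\<close>
  obtain g where g: "g \<in> invariants" "a = cls g" using a unfolding coinv_par_graded_def carrier_A by blast
  have fR: "f \<in> R" using f(1) sp_R R_zero by (auto simp: sym_graded_def split: if_splits)
  have "tr (f * piJ J) = 0"
  proof (cases "even m")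
    case True
    hence "f \<in> sym_power G (m div 2)" using f(1) by (simp add: sym_graded_def)
    moreover have "m div 2 + card (PosJ J) \<noteq> card Pos"
      using m True card_PosJ_le unfolding deg_eq by auto
    ultimately show ?thesis using tr_homog[OF sp_mult[OF _ piJ_sp]] by blast
  next
    case False
    thus ?thesis using f(1) by (simp add: sym_graded_def tr_zero)
  qed
  moreover have "tr ((g - f) * piJ J) = 0"
    using I_tr[OF _ piJ_R] cls_eq_iff[OF invariants_R[OF g(1)] fR] f(2) g(2) by blast
  moreover have "g * piJ J \<in> R" "f * piJ J \<in> R" using invariants_R[OF g(1)] fR piJ_R R_mult by blast+
  ultimately have "tr (g * piJ J) = 0" using tr_diff[of "g * piJ J" "f * piJ J"] by (simp add: left_diff_distrib)
  thus "trJ a = 0" using trJ_cls[OF g(1)] g(2) by simp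
qed

lemma trJ_schubert:
  assumes "d \<in> min_coset_reps G J"
  shows "trJ (schubert G d) = (if d = d_par G J then 1 else 0)"
proof -
  have "d \<in> W" using assms min_coset_reps_iff[OF J] by blast
  hence "trJ (schubert G d) = tr (schub d * piJ J) / tr (X * piJ J)"
    using schubert_cls trJ_cls[OF schub_invariants[OF assms]] by simp
  thus ?thesis using tr_X tr_schub[OF assms] by simp
qed

text \<open>The right-hand side does not mention \<open>T\<close>, so any two such forms agree.
  Homogeneity removes all components but the top one, which is a multiple of the class of
  \<open>X\<close>, where the value 1 is prescribed.\<close>

lemma form_unique:
  assumes "symmetrizing_form A T" "homogeneous_form (coinv_par_graded G J) deg T"
    "T (schubert G (d_par G J)) = 1"
    and f: "f \<in> invariants" "\<And>k. F k \<in> sym_power G k" "f = (\<Sum>k<n. F k)"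
  shows "T (cls f) = (\<Sum>k<n. if k = card Pos - card (PosJ J)
     then tr (av J (F k) * piJ J) / tr (X * piJ J) else 0)"
proof -
  note sf = assms(1)[unfolded symmetrizing_form_def, THEN conjunct2]
  have T_add: "T (cls (g + h)) = T (cls g) + T (cls h)" if gh: "g \<in> invariants" "h \<in> invariants" for g h
  proof -
    have "cls g \<in> carrier A" "cls h \<in> carrier A" using gh carrier_A by blast+
    hence "T (cls g \<oplus>\<^bsub>A\<^esub> cls h) = T (cls g) + T (cls h)" using sf[THEN conjunct1] by blast
    thus ?thesis by (simp only: A_add[OF invariants_R[OF gh(1)] invariants_R[OF gh(2)]])
  qed
  have T_scale: "T (cls (fscale c g)) = c * T (cls g)" if g: "g \<in> invariants" for g c
  proof -
    have "cls g \<in> carrier A" using g carrier_A by blast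
    hence "T (c \<odot>\<^bsub>A\<^esub> cls g) = c * T (cls g)" using sf[THEN conjunct2, THEN conjunct1] by blast
    thus ?thesis by (simp only: A_smult[OF invariants_R[OF g] R_zero])
  qed
  have T_zero: "T (cls 0) = 0" using T_scale[OF invariants_zero, of 0] by simp
  have T_sum: "T (cls (\<Sum>k\<in>K. H k)) = (\<Sum>k\<in>K. T (cls (H k)))" if "\<And>k. H k \<in> invariants" for K :: "nat set" and H
    using that by (induction K rule: infinite_finite_induct) (simp_all add: T_zero T_add invariants_sum)
  have FJ: "av J (F k) \<in> invariants" "av J (F k) \<in> sym_power G k" for k using av_invariants av_sp[OF J] f(2) sp_R by blast+
  have "f = (\<Sum>k<n. av J (F k))" using av_fixed[OF f(1)] f(3) av_sum[of J F "{..<n}"] by metis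
  hence "T (cls f) = (\<Sum>k<n. T (cls (av J (F k))))" using T_sum[of "\<lambda>k. av J (F k)"] FJ by simp
  also have "\<dots> = (\<Sum>k<n. if k = card Pos - card (PosJ J)
     then tr (av J (F k) * piJ J) / tr (X * piJ J) else 0)"
  proof (rule sum.cong[OF refl])
    fix k
    show "T (cls (av J (F k))) = (if k = card Pos - card (PosJ J)
     then tr (av J (F k) * piJ J) / tr (X * piJ J) else 0)"
    proof (cases "k = card Pos - card (PosJ J)")
      case True
      let ?c = "tr (av J (F k) * piJ J) / tr (X * piJ J)"
      have X: "X \<in> invariants" using schub_invariants[OF d_par_min] .
      have "av J (F k) - fscale ?c X \<in> I"
        using top_component[of "av J (F k)"] FJ[of k] True by (simp add: invariants_def)
      hence "cls (av J (F k)) = cls (fscale ?c X)"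
        using cls_eq_iff[OF invariants_R[OF FJ(1)] invariants_R[OF invariants_scale[OF X]]] by blast
      hence "T (cls (av J (F k))) = ?c * T (cls X)" using T_scale[OF X] by simp
      moreover have "T (cls X) = 1" using assms(3) schubert_cls[OF d_par_W] by simp
      ultimately show ?thesis using True by simp
    next
      case False
      have "cls (av J (F k)) \<in> coinv_par_graded G J (2 * k)"
        unfolding coinv_par_graded_def coinv_graded_def carrier_A using FJ[of k] by (simp add: sym_graded_def)
      moreover have "int (2 * k) + deg \<noteq> 0" unfolding deg_eq using False by auto
      ultimately have "T (cls (av J (F k))) = 0" using assms(2) unfolding homogeneous_form_def by blast
      thus ?thesis using False by simp
    qed
  qed
  finally show ?thesis .
qed

text \<open>Forms are total functions, so extensionality fixes their values off the carrier; on the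
  carrier \<open>form_unique\<close> gives the same expression for \<open>T\<close> and for
  \<open>trJ\<close>.\<close>

lemma ex1_form: "\<exists>!T. T \<in> extensional (carrier A) \<and> symmetrizing_form A T \<and>
    homogeneous_form (coinv_par_graded G J) deg T \<and>
    (\<forall>d\<in>min_coset_reps G J. T (schubert G d) = (if d = d_par G J then 1 else 0))"
proof (rule ex1I[of _ trJ])
  have trJ: "trJ \<in> extensional (carrier A)" by (simp add: trJ_def)
  thus "trJ \<in> extensional (carrier A) \<and> symmetrizing_form A trJ \<and>
    homogeneous_form (coinv_par_graded G J) deg trJ \<and>
    (\<forall>d\<in>min_coset_reps G J. trJ (schubert G d) = (if d = d_par G J then 1 else 0))"
    using trJ_symmetrizing trJ_homogeneous trJ_schubert by blast
  fix T assume T: "T \<in> extensional (carrier A) \<and> symmetrizing_form A T \<and>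
    homogeneous_form (coinv_par_graded G J) deg T \<and>
    (\<forall>d\<in>min_coset_reps G J. T (schubert G d) = (if d = d_par G J then 1 else 0))"
  have T1: "T (schubert G (d_par G J)) = 1" "trJ (schubert G (d_par G J)) = 1"
    using T d_par_min trJ_schubert by simp_all
  show "T = trJ"
  proof (rule extensionalityI[of _ "carrier A"])
    fix a assume "a \<in> carrier A"
    then obtain f where f: "f \<in> invariants" "a = cls f" using carrier_A by blast
    obtain n F where F: "\<forall>k. F k \<in> sym_power G k" "f = (\<Sum>k<n. F k)" using R_decomp[OF invariants_R[OF f(1)]] by blast
    have F1: "\<And>k. F k \<in> sym_power G k" using F(1) by blast
    note u = form_unique[where f = f and F = F and n = n, OF _ _ _ f(1) F1 F(2)]
    have "T (cls f) = trJ (cls f)"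
      unfolding u[OF trJ_symmetrizing trJ_homogeneous T1(2)] by (rule u) (use T T1 in blast)+
    thus "T a = trJ a" by (simp only: f(2))
  qed (use T trJ in blast)+
qed

end

end

theorem theorem3p8:
  fixes G :: "'h::ab_group_add root_datum"
    and J :: "('h \<Rightarrow> complex) set"
  assumes "semisimple_root_datum G"
    and "J \<subseteq> simple_roots G"
  shows "\<exists>!tr. tr \<in> extensional (carrier (coinv_alg_par G J)) \<and>
    symmetrizing_form (coinv_alg_par G J) tr \<and>
    homogeneous_form (coinv_par_graded G J)
      (- 2 * int (weyl_length G (w_0 G)) + 2 * int (weyl_length G (w_par G J))) tr \<and>
    (\<forall>d\<in>min_coset_reps G J. tr (schubert G d) = (if d = d_par G J then 1 else 0))"
proof -
  interpret root_system_datum G by unfold_locales (rule assms(1))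
  show ?thesis by (rule ex1_form[OF assms(2)])
qed

end
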